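(* Let $\Bbbk$ be a perfect field with algebraic closure $\overline{\Bbbk}$. The category of elliptic curves in $\mathbb{P}^2_{\overline{\Bbbk}}$ with morphisms of varieties is equivalent to $\mathcal{GR}^{\mathrm{sm}}_{(0,1,1)}(V_3)$, the category whose objects are the smooth quiver Grassmannians $\mathrm{Gr}_{(0,1,1)}(V_3^f)$ for $f$ such that the cubic polynomial $\nu_3^{-1}(f)$ is irreducible, and whose morphisms are all morphisms of projective varieties.
   Context: A projective variety in $\mathbb{P}^n_{\overline{\Bbbk}}$ is the vanishing set of a prime homogeneous ideal of $\overline{\Bbbk}[x_0,\dots,x_n]$; a projective curve is a projective variety in $\mathbb{P}^2_{\overline{\Bbbk}}$ of dimension one; a variety is smooth (non-singular) if at every point the dimension of its tangent space equals its dimension. Morphisms of varieties are everywhere-defined rational maps. Elliptic curves are non-singular curves of genus one; morphisms in the category of elliptic curves here are all morphisms of varieties. Quiver: $Q$ has vertices $1,2,3$, one arrow $2\to 1$ and three arrows $2\to 3$. For a finite-dimensional representation $W$ of $Q$ and a dimension vector $\mathbf e$, the quiver Grassmannian $\mathrm{Gr}_{\mathbf e}(W)$ is the projective variety of subrepresentations of $W$ of dimension vector $\mathbf e$. The representation $V_3^f$: for $d\in\{2,3\}$ let $M_{2,d}$ be the set of $m=(m_0,m_1,m_2)\in\mathbb{N}^3$ with $m_0+m_1+m_2=d$, so $|M_{2,3}|=10$ and $|M_{2,2}|=6$. Let $e_0,e_1,e_2$ be the standard basis vectors of $\mathbb{N}^3$. For a linear form $f=\sum_{m\in M_{2,3}}c_m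 x_m$ on $\overline{\Bbbk}^{M_{2,3}}$, write $\nu_3^{-1}(f)=\sum_m c_m x_0^{m_0}x_1^{m_1}x_2^{m_2}\in\overline{\Bbbk}[x_0,x_1,x_2]$ for the corresponding homogeneous cubic (its pullback under the $3$-uple Veronese embedding $\nu_3$). If $\nu_3^{-1}(f)$ is irreducible, $V_3^f$ is the $\overline{\Bbbk}$-representation of $Q$ with spaces $\overline{\Bbbk}$, $\overline{\Bbbk}^{M_{2,3}}$, $\overline{\Bbbk}^{M_{2,2}}$ at the vertices $1,2,3$ (dimension vector $(1,10,6)$), with the map $f$ on the arrow $2\to1$ and the maps $\varphi_i:(x_m)_{m\in M_{2,3}}\mapsto(x_{n+e_i})_{n\in M_{2,2}}$, $i=0,1,2$, on the three arrows $2\to3$. A point of $\mathrm{Gr}_{(0,1,1)}(V_3^f)$ is a pair of lines $L\subset\overline{\Bbbk}^{M_{2,3}}$, $L'\subset\overline{\Bbbk}^{M_{2,2}}$ with $f(L)=0$ and $\varphi_i(L)\subset L'$ for all $i$; $\mathrm{Gr}_{(0,1,1)}(V_3^f)$ is identified with the subvariety of $\mathbb{P}^{9}_{\overline{\Bbbk}}$ consisting of the lines $L$. *)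

theory Defs
  imports
    "HOL-Analysis.Cartesian_Space"
    "HOL-Algebra.Algebraic_Closure_Type"
    "HOL-Library.Poly_Mapping"
    "HOL-Library.Extended_Nat"
begin

unbundle no fps_syntax
no_notation var (\<open>X\<index>\<close>)

definition perfect_field :: "'k::field itself \<Rightarrow> bool" where
  "perfect_field _ \<longleftrightarrow> (\<forall>p :: 'k poly. irreducible p \<longrightarrow> coprime p (pderiv p))"


section \<open>Homogeneous polynomials and ideals\<close>

text \<open>
  Polynomials over \<open>'a\<close> with one variable for each element of the finite type \<open>'i\<close>.
  The homogeneous coordinate ring of projective \<open>n\<close>-space is the case \<open>CARD('i) = n + 1\<close>.
\<close>

type_synonym ('i, 'a) mpoly = "('i \<Rightarrow>\<^sub>0 nat) \<Rightarrow>\<^sub>0 'a"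

definition mdeg :: "('i::finite \<Rightarrow>\<^sub>0 nat) \<Rightarrow> nat" where
  "mdeg m = (\<Sum>i\<in>UNIV. Poly_Mapping.lookup m i)"

definition mpoly_eval :: "('i::finite, 'a::comm_ring_1) mpoly \<Rightarrow> 'a ^ 'i \<Rightarrow> 'a" where
  "mpoly_eval F x = (\<Sum>m\<in>Poly_Mapping.keys F. Poly_Mapping.lookup F m *
     (\<Prod>i\<in>UNIV. (x $ i) ^ Poly_Mapping.lookup m i))"

definition mpoly_deriv :: "'i \<Rightarrow> ('i::finite, 'a::comm_ring_1) mpoly \<Rightarrow> ('i, 'a) mpoly" where
  "mpoly_deriv i F =
     (\<Sum>m\<in>Poly_Mapping.keys F. Poly_Mapping.single (m - Poly_Mapping.single i 1)
        (of_nat (Poly_Mapping.lookup m i) * Poly_Mapping.lookup F m))"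

definition mpoly_scale :: "'a \<Rightarrow> ('i::finite, 'a::comm_ring_1) mpoly \<Rightarrow> ('i, 'a) mpoly" where
  "mpoly_scale c F = Poly_Mapping.single 0 c * F"

interpretation mpoly: vector_space "mpoly_scale :: 'a::field \<Rightarrow> ('i::finite, 'a) mpoly \<Rightarrow> _"
  by unfold_locales
    (simp_all add: mpoly_scale_def algebra_simps single_add mult_single flip: mult.assoc)

definition homogeneous :: "nat \<Rightarrow> ('i::finite, 'a::comm_ring_1) mpoly \<Rightarrow> bool" where
  "homogeneous d F \<longleftrightarrow> (\<forall>m\<in>Poly_Mapping.keys F. mdeg m = d)"

definition homogeneous_component ::
    "nat \<Rightarrow> ('i::finite, 'a::comm_ring_1) mpoly \<Rightarrow> ('i, 'a) mpoly" where
  "homogeneous_component d F =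
     (\<Sum>m\<in>{m\<in>Poly_Mapping.keys F. mdeg m = d}.
        Poly_Mapping.single m (Poly_Mapping.lookup F m))"

definition homogeneous_prime_ideal :: "('i::finite, 'a::comm_ring_1) mpoly set \<Rightarrow> bool" where
  "homogeneous_prime_ideal I \<longleftrightarrow>
     primeideal I ring_of_type_algebra \<and> (\<forall>F\<in>I. \<forall>d. homogeneous_component d F \<in> I)"


section \<open>Projective varieties\<close>

text \<open>
  A point of projective space is a one-dimensional subspace of \<^typ>\<open>'a ^ 'i\<close>.
\<close>

definition projective_space :: "('a::field ^ 'i) set set" where
  "projective_space = {L. vec.subspace L \<and> vec.dim L = 1}"

definition vanishing_set :: "('i::finite, 'a::field) mpoly set \<Rightarrow> ('a ^ 'i) set set" where
  "vanishing_set I = {L\<in>projective_space. \<forall>F\<in>I. \<forall>x\<in>L. mpoly_eval F x = 0}"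

definition vanishing_ideal :: "('a::field ^ 'i) set set \<Rightarrow> ('i::finite, 'a) mpoly set" where
  "vanishing_ideal X = {F. \<forall>L\<in>X. \<forall>x\<in>L. mpoly_eval F x = 0}"

definition projective_variety :: "('a::field ^ 'i::finite) set set \<Rightarrow> bool" where
  "projective_variety X \<longleftrightarrow> (\<exists>I. homogeneous_prime_ideal I \<and> X = vanishing_set I)"

text \<open>
  Krull dimension: the supremum of the lengths of chains of irreducible closed subsets.  The
  irrelevant ideal is prime, so the empty set has to be excluded from the chains explicitly.
\<close>

definition variety_dim :: "('a::field ^ 'i::finite) set set \<Rightarrow> enat" where
  "variety_dim X =
     (SUP n \<in> {n. \<exists>Z :: nat \<Rightarrow> ('a ^ 'i) set set.
                  (\<forall>i\<le>n. projective_variety (Z i) \<and> Z i \<noteq> {}) \<and>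
                  (\<forall>i<n. Z i \<subset> Z (Suc i)) \<and> Z n \<subseteq> X}. enat n)"

text \<open>
  \<open>cone_tangent_space X L\<close> is the tangent space of the affine cone over \<open>X\<close> along the line \<open>L\<close>.
  By Euler's identity it contains \<open>L\<close> if \<open>L \<in> X\<close>, and the tangent space of \<open>X\<close> at \<open>L\<close> is its
  quotient by \<open>L\<close> (up to a twist by the dual of \<open>L\<close>); hence the subtraction of 1.
\<close>

definition cone_tangent_space ::
    "('a::field ^ 'i::finite) set set \<Rightarrow> ('a ^ 'i) set \<Rightarrow> ('a ^ 'i) set" where
  "cone_tangent_space X L =
     {v. \<forall>F\<in>vanishing_ideal X. \<forall>x\<in>L. (\<Sum>i\<in>UNIV. mpoly_eval (mpoly_deriv i F) x * v $ i) = 0}"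

definition tangent_dim :: "('a::field ^ 'i::finite) set set \<Rightarrow> ('a ^ 'i) set \<Rightarrow> nat" where
  "tangent_dim X L = vec.dim (cone_tangent_space X L) - 1"

definition smooth :: "('a::field ^ 'i::finite) set set \<Rightarrow> bool" where
  "smooth X \<longleftrightarrow> (\<forall>L\<in>X. enat (tangent_dim X L) = variety_dim X)"

definition projective_curve :: "('a::field ^ 3) set set \<Rightarrow> bool" where
  "projective_curve X \<longleftrightarrow> projective_variety X \<and> variety_dim X = 1"

text \<open>
  The dimension of the degree \<open>d\<close> part of the homogeneous coordinate ring, that is, of the
  quotient of the forms of degree \<open>d\<close> by those vanishing on \<open>X\<close>.
\<close>

definition hilbert_function :: "('a::field ^ 'i::finite) set set \<Rightarrow> nat \<Rightarrow> nat" where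
  "hilbert_function X d =
     mpoly.dim {F :: ('i, 'a) mpoly. homogeneous d F} -
     mpoly.dim {F \<in> vanishing_ideal X. homogeneous d F}"

definition hilbert_polynomial :: "('a::field ^ 'i::finite) set set \<Rightarrow> rat poly" where
  "hilbert_polynomial X =
     (THE P. \<forall>\<^sub>F d in sequentially. poly P (of_nat d) = of_nat (hilbert_function X d))"

text \<open>
  The genus of a smooth projective curve, as its arithmetic genus \<open>(-1) ^ r * (P 0 - 1)\<close>, where
  \<open>P\<close> is the Hilbert polynomial and \<open>r = 1\<close> the dimension.
\<close>

definition curve_genus :: "('a::field ^ 3) set set \<Rightarrow> rat" where
  "curve_genus X = 1 - poly (hilbert_polynomial X) 0"

definition elliptic_curve :: "('a::field ^ 3) set set \<Rightarrow> bool" where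
  "elliptic_curve X \<longleftrightarrow> projective_curve X \<and> smooth X \<and> curve_genus X = 1"


section \<open>Morphisms of projective varieties\<close>

text \<open>
  A rational map from \<open>X\<close> to a projective space is an equivalence class of tuples of forms of
  equal degree, not all vanishing on \<open>X\<close>, where tuples are equivalent if they are proportional
  on \<open>X\<close>.  Different tuples of one class may define the map at different points.
\<close>

definition rational_tuple ::
    "('a::field ^ 'i::finite) set set \<Rightarrow> ('j \<Rightarrow> ('i, 'a) mpoly) \<Rightarrow> bool" where
  "rational_tuple X F \<longleftrightarrow> (\<exists>d. \<forall>j. homogeneous d (F j)) \<and> (\<exists>j. F j \<notin> vanishing_ideal X)"

definition rational_rel ::
    "('a::field ^ 'i::finite) set set \<Rightarrow>
     (('j \<Rightarrow> ('i, 'a) mpoly) \<times> ('j \<Rightarrow> ('i, 'a) mpoly)) set" where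
  "rational_rel X =
     {(F, G). rational_tuple X F \<and> rational_tuple X G \<and>
              (\<forall>j k. F j * G k - F k * G j \<in> vanishing_ideal X)}"

definition rational_maps ::
    "('a::field ^ 'i::finite) set set \<Rightarrow> ('j \<Rightarrow> ('i, 'a) mpoly) set set" where
  "rational_maps X = {F. rational_tuple X F} // rational_rel X"

definition rational_value ::
    "('j::finite \<Rightarrow> ('i::finite, 'a::field) mpoly) set \<Rightarrow> ('a ^ 'i) set \<Rightarrow> ('a ^ 'j) set \<Rightarrow> bool" where
  "rational_value R L M \<longleftrightarrow>
     (\<exists>F\<in>R. \<exists>x\<in>L. (\<chi> j. mpoly_eval (F j) x) \<noteq> 0 \<and> M = vec.span {\<chi> j. mpoly_eval (F j) x})"

text \<open>
  A morphism is an everywhere defined rational map, identified with the function on points that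
  it induces.
\<close>

definition variety_morphisms ::
    "('a::field ^ 'i::finite) set set \<Rightarrow> ('a ^ 'j::finite) set set \<Rightarrow>
     (('a ^ 'i) set \<Rightarrow> ('a ^ 'j) set) set" where
  "variety_morphisms X Y =
     {\<phi> \<in> X \<rightarrow>\<^sub>E Y. \<exists>R\<in>rational_maps X. \<forall>L\<in>X. rational_value R L (\<phi> L)}"


section \<open>Categories and their equivalence\<close>

text \<open>
  The hom-sets need not be disjoint, so composition receives the objects as arguments:
  \<open>Comp C X Y Z g f\<close> is the composite of \<open>f : X \<rightarrow> Y\<close> and \<open>g : Y \<rightarrow> Z\<close>.
\<close>

record ('o, 'm) category =
  Obj :: "'o set"
  Hom :: "'o \<Rightarrow> 'o \<Rightarrow> 'm set"
  Ident :: "'o \<Rightarrow> 'm"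
  Comp :: "'o \<Rightarrow> 'o \<Rightarrow> 'o \<Rightarrow> 'm \<Rightarrow> 'm \<Rightarrow> 'm"

definition is_category :: "('o, 'm) category \<Rightarrow> bool" where
  "is_category C \<longleftrightarrow>
     (\<forall>X\<in>Obj C. Ident C X \<in> Hom C X X) \<and>
     (\<forall>X\<in>Obj C. \<forall>Y\<in>Obj C. \<forall>Z\<in>Obj C. \<forall>f\<in>Hom C X Y. \<forall>g\<in>Hom C Y Z.
        Comp C X Y Z g f \<in> Hom C X Z) \<and>
     (\<forall>X\<in>Obj C. \<forall>Y\<in>Obj C. \<forall>f\<in>Hom C X Y.
        Comp C X X Y f (Ident C X) = f \<and> Comp C X Y Y (Ident C Y) f = f) \<and>
     (\<forall>W\<in>Obj C. \<forall>X\<in>Obj C. \<forall>Y\<in>Obj C. \<forall>Z\<in>Obj C.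
        \<forall>f\<in>Hom C W X. \<forall>g\<in>Hom C X Y. \<forall>h\<in>Hom C Y Z.
          Comp C W Y Z h (Comp C W X Y g f) = Comp C W X Z (Comp C X Y Z h g) f)"

definition is_iso :: "('o, 'm) category \<Rightarrow> 'o \<Rightarrow> 'o \<Rightarrow> 'm \<Rightarrow> bool" where
  "is_iso C X Y f \<longleftrightarrow>
     f \<in> Hom C X Y \<and>
     (\<exists>g\<in>Hom C Y X. Comp C X Y X g f = Ident C X \<and> Comp C Y X Y f g = Ident C Y)"

record ('o, 'm, 'p, 'n) functor_data =
  on_obj :: "'o \<Rightarrow> 'p"
  on_hom :: "'o \<Rightarrow> 'o \<Rightarrow> 'm \<Rightarrow> 'n"

definition is_functor ::
    "('o, 'm) category \<Rightarrow> ('p, 'n) category \<Rightarrow> ('o, 'm, 'p, 'n) functor_data \<Rightarrow> bool" where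
  "is_functor C D F \<longleftrightarrow>
     (\<forall>X\<in>Obj C. on_obj F X \<in> Obj D) \<and>
     (\<forall>X\<in>Obj C. \<forall>Y\<in>Obj C. \<forall>f\<in>Hom C X Y.
        on_hom F X Y f \<in> Hom D (on_obj F X) (on_obj F Y)) \<and>
     (\<forall>X\<in>Obj C. on_hom F X X (Ident C X) = Ident D (on_obj F X)) \<and>
     (\<forall>X\<in>Obj C. \<forall>Y\<in>Obj C. \<forall>Z\<in>Obj C. \<forall>f\<in>Hom C X Y. \<forall>g\<in>Hom C Y Z.
        on_hom F X Z (Comp C X Y Z g f) =
          Comp D (on_obj F X) (on_obj F Y) (on_obj F Z) (on_hom F Y Z g) (on_hom F X Y f))"

definition id_functor :: "('o, 'm, 'o, 'm) functor_data" where
  "id_functor = \<lparr>on_obj = (\<lambda>X. X), on_hom = (\<lambda>X Y f. f)\<rparr>"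

definition comp_functor ::
    "('p, 'n, 'q, 'l) functor_data \<Rightarrow> ('o, 'm, 'p, 'n) functor_data \<Rightarrow>
     ('o, 'm, 'q, 'l) functor_data" where
  "comp_functor G F =
     \<lparr>on_obj = (\<lambda>X. on_obj G (on_obj F X)),
      on_hom = (\<lambda>X Y f. on_hom G (on_obj F X) (on_obj F Y) (on_hom F X Y f))\<rparr>"

definition naturally_isomorphic ::
    "('o, 'm) category \<Rightarrow> ('p, 'n) category \<Rightarrow> ('o, 'm, 'p, 'n) functor_data \<Rightarrow>
     ('o, 'm, 'p, 'n) functor_data \<Rightarrow> bool" where
  "naturally_isomorphic C D F G \<longleftrightarrow>
     (\<exists>\<eta>. (\<forall>X\<in>Obj C. is_iso D (on_obj F X) (on_obj G X) (\<eta> X)) \<and>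
          (\<forall>X\<in>Obj C. \<forall>Y\<in>Obj C. \<forall>f\<in>Hom C X Y.
             Comp D (on_obj F X) (on_obj F Y) (on_obj G Y) (\<eta> Y) (on_hom F X Y f) =
             Comp D (on_obj F X) (on_obj G X) (on_obj G Y) (on_hom G X Y f) (\<eta> X)))"

definition equivalent_categories :: "('o, 'm) category \<Rightarrow> ('p, 'n) category \<Rightarrow> bool" where
  "equivalent_categories C D \<longleftrightarrow>
     is_category C \<and> is_category D \<and>
     (\<exists>F G. is_functor C D F \<and> is_functor D C G \<and>
            naturally_isomorphic C C (comp_functor G F) id_functor \<and>
            naturally_isomorphic D D (comp_functor F G) id_functor)"

definition variety_category ::
    "('a::field ^ 'i::finite) set set set \<Rightarrow>
     (('a ^ 'i) set set, ('a ^ 'i) set \<Rightarrow> ('a ^ 'i) set) category" where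
  "variety_category Xs =
     \<lparr>Obj = Xs, Hom = variety_morphisms, Ident = (\<lambda>X. restrict id X),
      Comp = (\<lambda>X Y Z g f. compose X g f)\<rparr>"


section \<open>The quiver Grassmannians\<close>

text \<open>
  Representations of the quiver with one arrow \<open>2 \<rightarrow> 1\<close> and three arrows \<open>2 \<rightarrow> 3\<close>; the index types
  \<open>'i\<close>, \<open>'j\<close>, \<open>'k\<close> give bases of the spaces at the vertices 1, 2, 3.
\<close>

record ('a, 'i, 'j, 'k) quiver_rep =
  arrow21 :: "'a ^ 'j \<Rightarrow> 'a ^ 'i"
  arrow23 :: "3 \<Rightarrow> 'a ^ 'j \<Rightarrow> 'a ^ 'k"

definition subrepresentation ::
    "('a::field, 'i::finite, 'j::finite, 'k::finite) quiver_rep \<Rightarrow>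
     ('a ^ 'i) set \<times> ('a ^ 'j) set \<times> ('a ^ 'k) set \<Rightarrow> bool" where
  "subrepresentation W = (\<lambda>(U1, U2, U3).
     vec.subspace U1 \<and> vec.subspace U2 \<and> vec.subspace U3 \<and>
     arrow21 W ` U2 \<subseteq> U1 \<and> (\<forall>i. arrow23 W i ` U2 \<subseteq> U3))"

definition quiver_Grassmannian ::
    "nat \<times> nat \<times> nat \<Rightarrow> ('a::field, 'i::finite, 'j::finite, 'k::finite) quiver_rep \<Rightarrow>
     (('a ^ 'i) set \<times> ('a ^ 'j) set \<times> ('a ^ 'k) set) set" where
  "quiver_Grassmannian e W =
     {(U1, U2, U3). subrepresentation W (U1, U2, U3) \<and> (vec.dim U1, vec.dim U2, vec.dim U3) = e}"

text \<open>
  \<open>d mexp\<close>, for a numeral type \<open>d\<close>, is the set of exponents of monomials of degree \<open>d\<close> in three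
  variables; it is the index set \<open>M\<^sub>2\<^sub>,\<^sub>d\<close> of the coordinates.
\<close>

typedef ('d::finite) mexp = "{m :: 3 \<Rightarrow>\<^sub>0 nat. mdeg m = CARD('d)}"
proof
  show "Poly_Mapping.single 0 CARD('d) \<in> {m :: 3 \<Rightarrow>\<^sub>0 nat. mdeg m = CARD('d)}"
    by (simp add: mdeg_def lookup_single when_def sum.delta)
qed

instance mexp :: (finite) finite
proof
  have "Poly_Mapping.lookup m i \<le> mdeg m" for m :: "3 \<Rightarrow>\<^sub>0 nat" and i
    unfolding mdeg_def by (rule member_le_sum) auto
  then have "Poly_Mapping.lookup ` {m :: 3 \<Rightarrow>\<^sub>0 nat. mdeg m = CARD('a)} \<subseteq> (\<Pi>\<^sub>E i\<in>UNIV. {..CARD('a)})"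
    by (auto simp: PiE_iff) metis
  then have "finite (Poly_Mapping.lookup ` {m :: 3 \<Rightarrow>\<^sub>0 nat. mdeg m = CARD('a)})"
    by (rule finite_subset) (intro finite_PiE; simp)
  then have "finite {m :: 3 \<Rightarrow>\<^sub>0 nat. mdeg m = CARD('a)}"
    by (rule finite_imageD) (auto intro!: inj_onI poly_mapping_eqI)
  moreover have "UNIV = (Abs_mexp :: _ \<Rightarrow> 'a mexp) ` {m. mdeg m = CARD('a)}"
    by (rule type_definition.univ[OF type_definition_mexp])
  ultimately show "finite (UNIV :: 'a mexp set)"
    by (metis finite_imageI)
qed

definition mexp_shift :: "3 \<Rightarrow> 2 mexp \<Rightarrow> 3 mexp" where
  "mexp_shift i n = Abs_mexp (Rep_mexp n + Poly_Mapping.single i 1)"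

lemma Rep_mexp_shift: "Rep_mexp (mexp_shift i n) = Rep_mexp n + Poly_Mapping.single i 1"
proof -
  have "mdeg (Rep_mexp n + Poly_Mapping.single i 1) = 3"
    using Rep_mexp[of n]
    by (simp add: mdeg_def lookup_add sum.distrib lookup_single when_def sum.delta)
  then show ?thesis
    by (simp add: mexp_shift_def Abs_mexp_inverse)
qed

text \<open>
  A linear form \<open>f\<close> is given by its vector \<open>c\<close> of coefficients; \<open>cubic c\<close> is the pullback of \<open>f\<close>
  under the Veronese embedding.
\<close>

definition cubic :: "'a::field ^ 3 mexp \<Rightarrow> (3, 'a) mpoly" where
  "cubic c = (\<Sum>m\<in>UNIV. Poly_Mapping.single (Rep_mexp m) (c $ m))"

definition V3 :: "'a::field ^ 3 mexp \<Rightarrow> ('a, 1, 3 mexp, 2 mexp) quiver_rep" where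
  "V3 c = \<lparr>arrow21 = (\<lambda>x. \<chi> _. \<Sum>m\<in>UNIV. c $ m * x $ m),
           arrow23 = (\<lambda>i x. \<chi> n. x $ mexp_shift i n)\<rparr>"

definition Gr_V3 :: "'a::field ^ 3 mexp \<Rightarrow> ('a ^ 3 mexp) set set" where
  "Gr_V3 c = (\<lambda>(U1, U2, U3). U2) ` quiver_Grassmannian (0, 1, 1) (V3 c)"

definition elliptic_curve_category ::
    "(('a::field ^ 3) set set, ('a ^ 3) set \<Rightarrow> ('a ^ 3) set) category" where
  "elliptic_curve_category = variety_category {X. elliptic_curve X}"

definition smooth_Grassmannian_category ::
    "(('a::field ^ 3 mexp) set set, ('a ^ 3 mexp) set \<Rightarrow> ('a ^ 3 mexp) set) category" where
  "smooth_Grassmannian_category =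
     variety_category {Gr_V3 c | c. irreducible (cubic c) \<and> smooth (Gr_V3 c)}"

end

(*
  The Veronese embedding identifies the plane cubic X = V(cubic c) with Gr_V3 c: the 3 x 6 matrix
  of the vectors phi_i(y) has rank one exactly if y is a multiple of a vector of cubic monomials.
  Locally on its image the inverse is the linear map y |-> (y_iij)_j, so X and Gr_V3 c are
  isomorphic, and this map also identifies their tangent spaces. It remains to match the objects.
  A variety in the plane of dimension one is cut out by a prime form of some degree d, its Hilbert
  polynomial gives the genus (d - 1)(d - 2)/2, and this is 1 exactly for d = 3.

  The dimensions rest on one elimination argument modulo a prime ideal,
  which yields both the Nullstellensatz and the fact that a form not divisible by the equation of
  a plane curve vanishes on no irreducible subset of the curve with more than one point.
*)
theory Submission
  imports Defs
begin

text \<open>What shapes the proof is the dimension of the Veronese image. A proper closed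
  irreducible subset of the image must be shown to be a point, but its preimage in the plane is not
  visibly closed and irreducible. Hence the dimension argument on a curve asks of a subset only
  irreducibility against finite unions of lines, a property that survives the pullback. It is enough
  because eliminating one variable leaves a form in two variables, and such a form splits into
  linear factors over an algebraically closed field. As the characteristic is arbitrary, no step may
  divide by a degree: derivatives are read off as linear coefficients of restrictions to lines, and
  tangent spaces are compared through the linear inverse charts. The projective plane itself is told
  apart from the curves by its genus 0. Morphisms are handled in a local form, a tuple of forms
  around each point, for which composition is substitution; the two functors are then inverse to
  each other on the nose.\<close>

unbundle no fps_syntax

section \<open>Ring homomorphisms between type-class rings\<close>

locale ring_morphism =
  fixes h :: "'a::comm_ring_1 \<Rightarrow> 'b::comm_ring_1"
  assumes zero [simp]: "h 0 = 0"
    and one [simp]: "h 1 = 1"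
    and add: "h (x + y) = h x + h y"
    and mult: "h (x * y) = h x * h y"
begin

lemma sum: "h (sum f A) = (\<Sum>x\<in>A. h (f x))"
  by (induction A rule: infinite_finite_induct) (simp_all add: add)

lemma prod: "h (prod f A) = (\<Prod>x\<in>A. h (f x))"
  by (induction A rule: infinite_finite_induct) (simp_all add: mult)

lemma power: "h (x ^ n) = h x ^ n"
  by (induction n) (simp_all add: mult)

lemma uminus: "h (- x) = - h x"
  by (metis add add_eq_0_iff zero neg_eq_iff_add_eq_0)

lemma diff: "h (x - y) = h x - h y"
  using add[of x "- y"] by (simp add: uminus)

end

lemma ring_morphism_id: "ring_morphism (\<lambda>x. x)"
  by unfold_locales auto

lemma ring_morphism_const_poly: "ring_morphism (\<lambda>c. [:c:])"
  by unfold_locales (auto simp: pCons_one)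

lemma ring_morphism_single: "ring_morphism (Poly_Mapping.single (0 :: 'i \<Rightarrow>\<^sub>0 nat))"
  by unfold_locales (auto simp: single_add mult_single)

lemma ring_morphism_poly: "ring_morphism (\<lambda>p. poly p c)"
  by unfold_locales auto

lemma ring_morphism_comp:
  "ring_morphism g \<Longrightarrow> ring_morphism h \<Longrightarrow> ring_morphism (\<lambda>x. g (h x))"
  by (simp add: ring_morphism_def)


section \<open>Polynomials in several variables\<close>

lemma mpoly_sum_monomials:
  "F = (\<Sum>m\<in>Poly_Mapping.keys F. Poly_Mapping.single m (Poly_Mapping.lookup F m))"
  by (rule poly_mapping_eqI)
    (auto simp: lookup_sum lookup_single when_def sum.delta in_keys_iff)

definition monom_val :: "('i::finite \<Rightarrow> 'b::comm_ring_1) \<Rightarrow> ('i \<Rightarrow>\<^sub>0 nat) \<Rightarrow> 'b" where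
  "monom_val p m = (\<Prod>i\<in>UNIV. p i ^ Poly_Mapping.lookup m i)"

lemma monom_val_0 [simp]: "monom_val p 0 = 1"
  by (simp add: monom_val_def)

lemma monom_val_add: "monom_val p (m + n) = monom_val p m * monom_val p n"
  by (simp add: monom_val_def lookup_add power_add prod.distrib)

lemma monom_val_single [simp]: "monom_val p (Poly_Mapping.single i k) = p i ^ k"
proof -
  have "monom_val p (Poly_Mapping.single i k) = (\<Prod>j\<in>UNIV. if j = i then p i ^ k else 1)"
    unfolding monom_val_def by (intro prod.cong) (auto simp: lookup_single when_def)
  then show ?thesis by (simp add: prod.delta)
qed

lemma monom_val_scale: "monom_val (\<lambda>i. s * p i) m = s ^ mdeg m * monom_val p m"
  by (simp add: monom_val_def mdeg_def power_mult_distrib prod.distrib power_sum)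

lemma (in ring_morphism) monom_val: "h (monom_val p m) = monom_val (\<lambda>i. h (p i)) m"
  by (simp add: monom_val_def prod power)

text \<open>The universal property of the polynomial ring in computational form. Evaluation,
  substitution, restriction to a line, grading and nesting are instances, so their algebraic laws
  are proved only once.\<close>

definition insertion ::
    "('a::comm_ring_1 \<Rightarrow> 'b::comm_ring_1) \<Rightarrow> ('i::finite \<Rightarrow> 'b) \<Rightarrow> ('i, 'a) mpoly \<Rightarrow> 'b" where
  "insertion h p F =
     (\<Sum>m\<in>Poly_Mapping.keys F. h (Poly_Mapping.lookup F m) * monom_val p m)"

definition mvar :: "'i::finite \<Rightarrow> ('i, 'a::comm_ring_1) mpoly" where
  "mvar i = Poly_Mapping.single (Poly_Mapping.single i 1) 1"

definition mconst :: "'a::comm_ring_1 \<Rightarrow> ('i::finite, 'a) mpoly" where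
  "mconst c = Poly_Mapping.single 0 c"

lemma ring_morphism_mconst: "ring_morphism mconst"
  unfolding mconst_def by (rule ring_morphism_single)

lemma monom_val_mvar:
  fixes m :: "'i::finite \<Rightarrow>\<^sub>0 nat"
  shows "monom_val mvar m = Poly_Mapping.single m (1 :: 'a::comm_ring_1)"
proof -
  have pow: "mvar i ^ k = Poly_Mapping.single (Poly_Mapping.single i k) (1 :: 'a)" for i :: 'i and k
    by (induction k) (simp_all add: mvar_def mult_single single_add [symmetric])
  have prd: "(\<Prod>i\<in>A. Poly_Mapping.single (f i) (1 :: 'a)) = Poly_Mapping.single (\<Sum>i\<in>A. f i) 1"
    if "finite A" for A :: "'i set" and f :: "'i \<Rightarrow> 'i \<Rightarrow>\<^sub>0 nat"
    using that by induction (simp_all add: mult_single)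
  have "(\<Sum>i\<in>UNIV. Poly_Mapping.single i (Poly_Mapping.lookup m i)) = m"
    by (rule poly_mapping_eqI) (simp add: lookup_sum lookup_single when_def sum.delta)
  then show ?thesis
    by (simp add: monom_val_def pow prd)
qed

lemma single_conv_mvar: "Poly_Mapping.single m c = mconst c * monom_val mvar m"
  by (simp add: monom_val_mvar mconst_def mult_single)

text \<open>Constants and variables generate the polynomial ring, so a property compatible with sums
  and products needs checking on generators only.\<close>

lemma mpoly_ring_induct [case_names const var add mult]:
  assumes "\<And>c. P (mconst c)" "\<And>i. P (mvar i)"
    "\<And>F G. P F \<Longrightarrow> P G \<Longrightarrow> P (F + G)" "\<And>F G. P F \<Longrightarrow> P G \<Longrightarrow> P (F * G)"
  shows "P (F :: ('i::finite, 'a::comm_ring_1) mpoly)"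
proof -
  have P1: "P 1" using assms(1)[of 1] by (simp add: mconst_def)
  have P0: "P 0" using assms(1)[of 0] by (simp add: mconst_def)
  have pow: "P (mvar i ^ k)" for i k
    by (induction k) (use P1 assms in auto)
  have "P (\<Prod>i\<in>A. mvar i ^ f i)" if "finite A" for A and f :: "'i \<Rightarrow> nat"
    using that by induction (use P1 pow assms(4) in auto)
  then have mono: "P (Poly_Mapping.single m c)" for m c
    unfolding single_conv_mvar monom_val_def by (intro assms) auto
  have "P (\<Sum>m\<in>A. Poly_Mapping.single m (g m))" if "finite A" for A :: "('i \<Rightarrow>\<^sub>0 nat) set" and g
    using that by (induction rule: finite_induct) (simp_all add: P0 assms(3) mono)
  then show ?thesis
    by (subst mpoly_sum_monomials) auto
qed

context ring_morphism
begin

lemma insertion_superset: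
  assumes "finite A" "Poly_Mapping.keys F \<subseteq> A"
  shows "insertion h p F = (\<Sum>m\<in>A. h (Poly_Mapping.lookup F m) * monom_val p m)"
  unfolding insertion_def using assms by (intro sum.mono_neutral_left) (auto simp: in_keys_iff)

lemma insertion_single [simp]: "insertion h p (Poly_Mapping.single m c) = h c * monom_val p m"
  by (subst insertion_superset[of "{m}"]) auto

lemma insertion_mconst [simp]: "insertion h p (mconst c) = h c"
  by (simp add: mconst_def)

lemma insertion_mvar [simp]: "insertion h p (mvar i) = p i"
  by (simp add: mvar_def)

lemma insertion_add: "insertion h p (F + G) = insertion h p F + insertion h p G"
proof -
  define A where "A = Poly_Mapping.keys F \<union> Poly_Mapping.keys G"
  have "insertion h p K = (\<Sum>m\<in>A. h (Poly_Mapping.lookup K m) * monom_val p m)"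
    if "Poly_Mapping.keys K \<subseteq> A" for K
    using that by (intro insertion_superset) (auto simp: A_def)
  moreover have "Poly_Mapping.keys (F + G) \<subseteq> A" by (simp add: A_def keys_add)
  ultimately show ?thesis
    by (simp add: A_def lookup_add add distrib_right sum.distrib)
qed

lemma insertion_0 [simp]: "insertion h p 0 = 0"
  by (simp add: insertion_def)

lemma insertion_sum: "insertion h p (sum f A) = (\<Sum>x\<in>A. insertion h p (f x))"
  by (induction A rule: infinite_finite_induct) (simp_all add: insertion_add)

lemma insertion_mult: "insertion h p (F * G) = insertion h p F * insertion h p G"
proof -
  have *: "F * G = (\<Sum>m\<in>Poly_Mapping.keys F. \<Sum>n\<in>Poly_Mapping.keys G.
      Poly_Mapping.single (m + n) (Poly_Mapping.lookup F m * Poly_Mapping.lookup G n))"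
    by (subst mpoly_sum_monomials[of F], subst mpoly_sum_monomials[of G])
      (simp add: sum_product mult_single)
  show ?thesis
    unfolding * insertion_sum insertion_single mult monom_val_add
    by (simp add: insertion_def sum_product algebra_simps)
qed

lemma ring_morphism_insertion: "ring_morphism (insertion h p)"
proof
  show "insertion h p 1 = 1"
    using insertion_mconst[of p 1] by (simp add: mconst_def)
qed (simp_all add: insertion_add insertion_mult)

end

text \<open>The uniqueness half of the universal property.\<close>

lemma ring_morphism_eq_insertion:
  assumes "ring_morphism \<phi>"
  shows "\<phi> F = insertion (\<lambda>c. \<phi> (mconst c)) (\<lambda>i. \<phi> (mvar i)) F"
proof -
  interpret \<phi>: ring_morphism \<phi> by fact
  have "\<phi> (Poly_Mapping.single m c) = \<phi> (mconst c) * monom_val (\<lambda>i. \<phi> (mvar i)) m" for m c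
    by (simp add: single_conv_mvar \<phi>.mult \<phi>.monom_val)
  then show ?thesis
    by (subst mpoly_sum_monomials[of F]) (simp add: \<phi>.sum insertion_def)
qed

lemma ring_morphism_insertion_comp:
  assumes "ring_morphism \<phi>" "ring_morphism h"
  shows "\<phi> (insertion h p F) = insertion (\<lambda>c. \<phi> (h c)) (\<lambda>i. \<phi> (p i)) F"
proof -
  interpret \<phi>: ring_morphism \<phi> by fact
  show ?thesis by (simp add: insertion_def \<phi>.sum \<phi>.mult \<phi>.monom_val)
qed

lemma insertion_mvar_self: "insertion mconst mvar F = F"
  using ring_morphism_eq_insertion[OF ring_morphism_id, of F] by simp

lemma mpoly_eval_insertion: "mpoly_eval F x = insertion (\<lambda>c. c) (\<lambda>i. x $ i) F"
  by (simp add: mpoly_eval_def insertion_def monom_val_def)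

interpretation mpoly_eval: ring_morphism "\<lambda>F. mpoly_eval F x" for x
  unfolding mpoly_eval_insertion
  by (rule ring_morphism.ring_morphism_insertion[OF ring_morphism_id])

lemma mpoly_eval_mvar [simp]: "mpoly_eval (mvar i) x = x $ i"
  unfolding mpoly_eval_insertion by (simp add: ring_morphism.insertion_mvar[OF ring_morphism_id])

lemma mpoly_eval_single [simp]:
  "mpoly_eval (Poly_Mapping.single m c) x = c * monom_val (\<lambda>i. x $ i) m"
  unfolding mpoly_eval_insertion by (simp add: ring_morphism.insertion_single[OF ring_morphism_id])

lemma mpoly_eval_mconst [simp]: "mpoly_eval (mconst c) x = c"
  by (simp add: mconst_def)

definition mpoly_subst ::
    "('j::finite \<Rightarrow> ('i::finite, 'a::comm_ring_1) mpoly) \<Rightarrow> ('j, 'a) mpoly \<Rightarrow> ('i, 'a) mpoly" where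
  "mpoly_subst = insertion mconst"

interpretation mpoly_subst: ring_morphism "mpoly_subst G" for G
  unfolding mpoly_subst_def
  by (rule ring_morphism.ring_morphism_insertion[OF ring_morphism_mconst])

lemma mpoly_subst_mvar [simp]: "mpoly_subst G (mvar i) = G i"
  and mpoly_subst_mconst [simp]: "mpoly_subst G (mconst c) = mconst c"
  unfolding mpoly_subst_def
  by (simp_all add: ring_morphism.insertion_mvar[OF ring_morphism_mconst]
    ring_morphism.insertion_mconst[OF ring_morphism_mconst])

lemma mpoly_eval_subst:
  "mpoly_eval (mpoly_subst G F) x = mpoly_eval F (\<chi> j. mpoly_eval (G j) x)"
  unfolding mpoly_subst_def
  by (subst ring_morphism_insertion_comp[OF mpoly_eval.ring_morphism_axioms ring_morphism_mconst])
    (simp add: mpoly_eval_insertion[of F])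


section \<open>Directional derivatives\<close>

definition dir_deriv :: "('i::finite, 'a::comm_ring_1) mpoly \<Rightarrow> 'a ^ 'i \<Rightarrow> 'a ^ 'i \<Rightarrow> 'a" where
  "dir_deriv F x v = (\<Sum>i\<in>UNIV. mpoly_eval (mpoly_deriv i F) x * v $ i)"

text \<open>The restriction of a polynomial to the affine line \<open>x + t v\<close>, kept as a
  polynomial in \<open>t\<close>. Its linear coefficient is the directional derivative, so the
  product rule becomes a statement about coefficients 0 and 1 of a product, valid in every
  characteristic.\<close>

definition line_poly :: "'a::comm_ring_1 ^ 'i::finite \<Rightarrow> 'a ^ 'i \<Rightarrow> ('i, 'a) mpoly \<Rightarrow> 'a poly" where
  "line_poly x v = insertion (\<lambda>c. [:c:]) (\<lambda>i. [:x $ i, v $ i:])"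

interpretation line_poly: ring_morphism "line_poly x v" for x v
  unfolding line_poly_def
  by (rule ring_morphism.ring_morphism_insertion[OF ring_morphism_const_poly])

lemma line_poly_mvar [simp]: "line_poly x v (mvar i) = [:x $ i, v $ i:]"
  and line_poly_mconst [simp]: "line_poly x v (mconst c) = [:c:]"
  and line_poly_single:
    "line_poly x v (Poly_Mapping.single m c) = [:c:] * monom_val (\<lambda>i. [:x $ i, v $ i:]) m"
  unfolding line_poly_def
  by (simp_all add: ring_morphism.insertion_mvar[OF ring_morphism_const_poly]
    ring_morphism.insertion_mconst[OF ring_morphism_const_poly]
    ring_morphism.insertion_single[OF ring_morphism_const_poly])

lemma poly_line_poly: "poly (line_poly x v F) t = mpoly_eval F (x + t *s v)"
  unfolding line_poly_def
  by (subst ring_morphism_insertion_comp[OF ring_morphism_poly ring_morphism_const_poly])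
    (simp add: mpoly_eval_insertion algebra_simps)

lemma coeff_0_line_poly [simp]: "coeff (line_poly x v F) 0 = mpoly_eval F x"
  using poly_line_poly[of x v F 0] by (simp add: poly_0_coeff_0)

lemma coeff_1_mult: "coeff (p * q) (Suc 0) = coeff p 0 * coeff q (Suc 0) + coeff p (Suc 0) * coeff q 0"
  by (simp add: coeff_mult atMost_Suc add.commute)

lemma coeff_0_prod: "coeff (\<Prod>i\<in>A. f i) 0 = (\<Prod>i\<in>A. coeff (f i) 0)"
  for f :: "_ \<Rightarrow> 'a::comm_ring_1 poly"
  by (simp flip: poly_0_coeff_0 add: poly_prod)

lemma coeff_1_prod:
  fixes f :: "'i \<Rightarrow> 'a::comm_ring_1 poly"
  assumes "finite A"
  shows "coeff (\<Prod>i\<in>A. f i) (Suc 0) =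
    (\<Sum>i\<in>A. coeff (f i) (Suc 0) * (\<Prod>j\<in>A - {i}. coeff (f j) 0))"
  using assms
proof induction
  case (insert a A)
  have "(\<Sum>i\<in>A. coeff (f i) (Suc 0) * (\<Prod>j\<in>insert a A - {i}. coeff (f j) 0)) =
    (\<Sum>i\<in>A. coeff (f a) 0 * (coeff (f i) (Suc 0) * (\<Prod>j\<in>A - {i}. coeff (f j) 0)))"
  proof (intro sum.cong refl)
    fix i assume "i \<in> A"
    then have "insert a A - {i} = insert a (A - {i})" using insert by auto
    then show "coeff (f i) (Suc 0) * (\<Prod>j\<in>insert a A - {i}. coeff (f j) 0) =
      coeff (f a) 0 * (coeff (f i) (Suc 0) * (\<Prod>j\<in>A - {i}. coeff (f j) 0))"
      using insert by (simp add: algebra_simps)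
  qed
  then show ?case using insert
    by (simp add: coeff_1_mult coeff_0_prod sum_distrib_left)
qed auto

lemma coeff_1_linear_power:
  "coeff ([:a, b:] ^ n) (Suc 0) = of_nat n * a ^ (n - 1) * (b :: 'a::comm_ring_1)"
proof (induction n)
  case (Suc n)
  then show ?case
    by (cases n) (simp_all add: coeff_1_mult algebra_simps flip: poly_0_coeff_0)
qed auto

lemma mpoly_eval_deriv_single:
  "mpoly_eval (mpoly_deriv i (Poly_Mapping.single m c)) x =
    c * of_nat (Poly_Mapping.lookup m i) * monom_val (\<lambda>i. x $ i) (m - Poly_Mapping.single i 1)"
  by (cases "c = 0") (simp_all add: mpoly_deriv_def)

lemma mpoly_deriv_superset:
  assumes "finite A" "Poly_Mapping.keys F \<subseteq> A"
  shows "mpoly_deriv i F = (\<Sum>m\<in>A. Poly_Mapping.single (m - Poly_Mapping.single i 1)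
        (of_nat (Poly_Mapping.lookup m i) * Poly_Mapping.lookup F m))"
  unfolding mpoly_deriv_def using assms
  by (intro sum.mono_neutral_left) (auto simp: in_keys_iff)

lemma mpoly_deriv_add: "mpoly_deriv i (F + G) = mpoly_deriv i F + mpoly_deriv i G"
proof -
  let ?A = "Poly_Mapping.keys F \<union> Poly_Mapping.keys G"
  have "finite ?A" by simp
  note * = mpoly_deriv_superset[OF this, where i = i]
  show ?thesis
    by (subst (1 2 3) *) (auto simp: keys_add lookup_add distrib_left sum.distrib single_add
        intro: subsetD[OF keys_add])
qed

lemma dir_deriv_add: "dir_deriv (F + G) x v = dir_deriv F x v + dir_deriv G x v"
  by (simp add: dir_deriv_def mpoly_deriv_add mpoly_eval.add distrib_right sum.distrib)

lemma dir_deriv_conv_line_poly: "dir_deriv F x v = coeff (line_poly x v F) 1"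
proof -
  have mono: "dir_deriv (Poly_Mapping.single m c) x v = coeff (line_poly x v (Poly_Mapping.single m c)) 1"
    for m c
  proof -
    have "coeff (monom_val (\<lambda>i. [:x $ i, v $ i:]) m) (Suc 0) =
      (\<Sum>i\<in>UNIV. of_nat (Poly_Mapping.lookup m i) * x $ i ^ (Poly_Mapping.lookup m i - 1) * v $ i *
        (\<Prod>j\<in>UNIV - {i}. x $ j ^ Poly_Mapping.lookup m j))"
      by (simp add: monom_val_def coeff_1_prod coeff_1_linear_power flip: poly_0_coeff_0)
    also have "\<dots> = (\<Sum>i\<in>UNIV. of_nat (Poly_Mapping.lookup m i) *
        monom_val (\<lambda>i. x $ i) (m - Poly_Mapping.single i 1) * v $ i)"
    proof (intro sum.cong refl)
      fix i
      \<comment> \<open>Subtraction truncates alike on both sides if \<open>i\<close> does not occur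
        in \<open>m\<close>; that summand carries the factor 0 anyway.\<close>
      have "monom_val (\<lambda>i. x $ i) (m - Poly_Mapping.single i 1) =
        x $ i ^ (Poly_Mapping.lookup m i - 1) * (\<Prod>j\<in>UNIV - {i}. x $ j ^ Poly_Mapping.lookup m j)"
        unfolding monom_val_def
        by (subst prod.remove[of _ i]) (auto simp: lookup_minus lookup_single when_def intro!: prod.cong)
      then show "of_nat (Poly_Mapping.lookup m i) * x $ i ^ (Poly_Mapping.lookup m i - 1) * v $ i *
        (\<Prod>j\<in>UNIV - {i}. x $ j ^ Poly_Mapping.lookup m j) =
        of_nat (Poly_Mapping.lookup m i) * monom_val (\<lambda>i. x $ i) (m - Poly_Mapping.single i 1) * v $ i"
        by (simp only: mult_ac)
    qed
    finally show ?thesis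
      by (simp add: dir_deriv_def mpoly_eval_deriv_single line_poly_single sum_distrib_left mult_ac)
  qed
  have "dir_deriv (\<Sum>m\<in>A. Poly_Mapping.single m (g m)) x v =
      coeff (line_poly x v (\<Sum>m\<in>A. Poly_Mapping.single m (g m))) 1" if "finite A" for A g
    using that
  proof induction
    case empty
    show ?case by (simp add: dir_deriv_def mpoly_deriv_def)
  next
    case (insert a A)
    then show ?case by (simp add: dir_deriv_add line_poly.add mono del: One_nat_def)
  qed
  then show ?thesis by (subst (1 2) mpoly_sum_monomials) auto
qed

lemma dir_deriv_mvar [simp]: "dir_deriv (mvar i) x v = v $ i"
  and dir_deriv_mconst [simp]: "dir_deriv (mconst c) x v = 0"
  and dir_deriv_mult:
    "dir_deriv (F * G) x v = mpoly_eval F x * dir_deriv G x v + dir_deriv F x v * mpoly_eval G x"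
  by (simp_all add: dir_deriv_conv_line_poly line_poly.mult coeff_1_mult)

lemma dir_deriv_diff: "dir_deriv (F - G) x v = dir_deriv F x v - dir_deriv G x v"
  by (simp add: dir_deriv_conv_line_poly line_poly.diff)

lemma dir_deriv_subst:
  "dir_deriv (mpoly_subst G F) x v =
     dir_deriv F (\<chi> j. mpoly_eval (G j) x) (\<chi> j. dir_deriv (G j) x v)"
proof (induction F rule: mpoly_ring_induct)
  case (add F1 F2)
  then show ?case by (simp add: mpoly_subst.add dir_deriv_add)
next
  case (mult F1 F2)
  then show ?case by (simp add: mpoly_subst.mult dir_deriv_mult mpoly_eval_subst)
qed auto

lemma dir_deriv_add_right: "dir_deriv F x (v + w) = dir_deriv F x v + dir_deriv F x w"
  and dir_deriv_scale_right: "dir_deriv F x (c *s v) = c * dir_deriv F x v"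
  by (simp_all add: dir_deriv_def distrib_left sum.distrib sum_distrib_left mult_ac)

section \<open>Elimination modulo a prime ideal\<close>

text \<open>Prime ideals of type-class rings; \<open>prime_ideal_iff_primeideal\<close> links them
  to the record-based notion used in the definition of varieties.\<close>

locale prime_ideal =
  fixes J :: "'r::comm_ring_1 set"
  assumes zero_mem [simp]: "0 \<in> J"
    and add_mem: "x \<in> J \<Longrightarrow> y \<in> J \<Longrightarrow> x + y \<in> J"
    and mult_mem: "x \<in> J \<Longrightarrow> r * x \<in> J"
    and one_notin [simp]: "1 \<notin> J"
    and mult_memD: "x * y \<in> J \<Longrightarrow> x \<in> J \<or> y \<in> J"
begin

lemma uminus_mem: "x \<in> J \<Longrightarrow> - x \<in> J"
  using mult_mem[of x "- 1"] by simp

lemma diff_mem: "x \<in> J \<Longrightarrow> y \<in> J \<Longrightarrow> x - y \<in> J"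
  using add_mem[of x "- y"] uminus_mem[of y] by simp

lemma mult_mem': "x \<in> J \<Longrightarrow> x * r \<in> J"
  using mult_mem[of x r] by (simp add: mult.commute)

lemma mult_mem_iff: "x * y \<in> J \<longleftrightarrow> x \<in> J \<or> y \<in> J"
  using mult_memD mult_mem mult_mem' by blast

lemma power_memD: "x ^ n \<in> J \<Longrightarrow> x \<in> J"
  by (induction n) (auto simp: mult_mem_iff)

lemma sum_mem: "(\<And>i. i \<in> A \<Longrightarrow> f i \<in> J) \<Longrightarrow> sum f A \<in> J"
  by (induction A rule: infinite_finite_induct) (auto intro: add_mem)

lemma prod_memD: "finite A \<Longrightarrow> prod f A \<in> J \<Longrightarrow> \<exists>i\<in>A. f i \<in> J"
  by (induction A rule: finite_induct) (auto simp: mult_mem_iff)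

lemma poly_mem: "(\<And>n. coeff p n \<in> J) \<Longrightarrow> poly p y \<in> J"
  unfolding poly_altdef by (intro sum_mem mult_mem') auto

lemma coeff_mult_mem: "(\<And>n. coeff p n \<in> J) \<Longrightarrow> coeff (p * q) n \<in> J"
  unfolding coeff_mult by (intro sum_mem mult_mem') auto

end

text \<open>The picture is the domain of residues modulo \<open>J\<close>, with a subring coming
  from \<open>S\<close> and one further element \<open>y\<close>. All arguments stay in the original
  ring: congruence modulo \<open>J\<close> replaces the quotient, and pseudo-division replaces the
  field of fractions. In the applications \<open>S\<close> consists of the polynomials in some of
  the variables and \<open>y\<close> is another variable.\<close>

locale elimination = prime_ideal J for J :: "'r::comm_ring_1 set" +
  fixes S :: "'r set" and y :: 'r
  assumes S_0 [simp]: "0 \<in> S" and S_1 [simp]: "1 \<in> S"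
    and S_add: "a \<in> S \<Longrightarrow> b \<in> S \<Longrightarrow> a + b \<in> S"
    and S_mult: "a \<in> S \<Longrightarrow> b \<in> S \<Longrightarrow> a * b \<in> S"
    and S_uminus: "a \<in> S \<Longrightarrow> - a \<in> S"
begin

definition polys :: "'r poly set" where
  "polys = {p. \<forall>n. coeff p n \<in> S}"

lemma S_sum: "(\<And>i. i \<in> A \<Longrightarrow> f i \<in> S) \<Longrightarrow> sum f A \<in> S"
  by (induction A rule: infinite_finite_induct) (auto intro: S_add)

lemma S_diff: "a \<in> S \<Longrightarrow> b \<in> S \<Longrightarrow> a - b \<in> S"
  using S_add[of a "- b"] S_uminus[of b] by simp

lemma S_power: "a \<in> S \<Longrightarrow> a ^ n \<in> S"
  by (induction n) (auto intro: S_mult)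

lemma polys_0 [simp]: "0 \<in> polys" and polys_1 [simp]: "1 \<in> polys"
  by (simp_all add: polys_def coeff_1)

lemma polys_add: "p \<in> polys \<Longrightarrow> q \<in> polys \<Longrightarrow> p + q \<in> polys"
  and polys_diff: "p \<in> polys \<Longrightarrow> q \<in> polys \<Longrightarrow> p - q \<in> polys"
  and polys_uminus: "p \<in> polys \<Longrightarrow> - p \<in> polys"
  and polys_smult: "a \<in> S \<Longrightarrow> p \<in> polys \<Longrightarrow> smult a p \<in> polys"
  and polys_monom: "a \<in> S \<Longrightarrow> monom a n \<in> polys"
  by (auto simp: polys_def intro: S_add S_diff S_uminus S_mult)

lemma polys_mult: "p \<in> polys \<Longrightarrow> q \<in> polys \<Longrightarrow> p * q \<in> polys"
  by (auto simp: polys_def coeff_mult intro!: S_sum S_mult)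

lemma polys_coeff: "p \<in> polys \<Longrightarrow> coeff p n \<in> S"
  by (auto simp: polys_def)

text \<open>Division with remainder without inverting the leading coefficient of \<open>h\<close>: a
  power of it multiplies \<open>f\<close> instead. The bound on \<open>degree q\<close> is what
  later brings a quotient under the minimality of \<open>P\<close> in
  \<open>eliminate\<close>.\<close>

lemma pseudo_division:
  assumes "f \<in> polys" "h \<in> polys" "degree h > 0"
  obtains k q r where "q \<in> polys" "r \<in> polys" "smult (lead_coeff h ^ k) f = q * h + r"
    "degree q \<le> degree f - degree h" "degree r < degree h"
proof -
  have "\<exists>k q r. q \<in> polys \<and> r \<in> polys \<and> smult (lead_coeff h ^ k) f = q * h + r \<and>
      degree q \<le> degree f - degree h \<and> degree r < degree h"
    using assms(1)
  proof (induction "degree f" arbitrary: f rule: less_induct)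
    case less
    show ?case
    proof (cases "degree f < degree h")
      case True
      then show ?thesis
        using less.prems by (intro exI[of _ 0] exI[of _ 0] exI[of _ f]) auto
    next
      case False
      define m where "m = monom (lead_coeff f) (degree f - degree h)"
      define f' where "f' = smult (lead_coeff h) f - m * h"
      have m: "m \<in> polys" "degree m \<le> degree f - degree h"
        using less.prems by (auto simp: m_def intro: polys_monom polys_coeff degree_monom_le)
      have f': "f' \<in> polys"
        using less.prems assms(2) m by (auto simp: f'_def intro!: polys_diff polys_smult polys_mult polys_coeff)
      have "degree (m * h) \<le> degree f"
        using degree_mult_le[of m h] m False by linarith
      then have "degree f' \<le> degree f"
        unfolding f'_def by (intro degree_diff_le) (auto intro: degree_smult_le)
      moreover have "coeff f' (degree f) = 0"
        using False by (simp add: f'_def m_def coeff_monom_mult)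
      ultimately have "degree f' < degree f"
        using assms(3) False eq_zero_or_degree_less[of f' "degree f"] by auto
      from less.hyps[OF this f'] obtain k q r where IH: "q \<in> polys" "r \<in> polys"
        "smult (lead_coeff h ^ k) f' = q * h + r" "degree q \<le> degree f' - degree h" "degree r < degree h"
        by blast
      have "smult (lead_coeff h ^ Suc k) f = (q + smult (lead_coeff h ^ k) m) * h + r"
        using IH(3) by (simp add: f'_def smult_diff_right algebra_simps)
      moreover have "degree (q + smult (lead_coeff h ^ k) m) \<le> degree f - degree h"
        using IH(4) \<open>degree f' < degree f\<close> m(2)
        by (intro degree_add_le order.trans[OF degree_smult_le]) auto
      moreover have "q + smult (lead_coeff h ^ k) m \<in> polys"
        using IH m assms by (intro polys_add polys_smult S_power polys_coeff)
      ultimately show ?thesis using IH by blast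
    qed
  qed
  then show ?thesis using that by blast
qed

lemma truncate:
  assumes "p \<in> polys" "coeff p n \<notin> J"
  obtains p' where "p' \<in> polys" "degree p' \<le> degree p" "lead_coeff p' \<notin> J"
    "poly p y - poly p' y \<in> J"
proof -
  have "\<exists>p'. p' \<in> polys \<and> degree p' \<le> degree p \<and> lead_coeff p' \<notin> J \<and> poly p y - poly p' y \<in> J"
    using assms
  proof (induction "degree p" arbitrary: p rule: less_induct)
    case less
    show ?case
    proof (cases "lead_coeff p \<in> J")
      case False
      then show ?thesis using less.prems by (intro exI[of _ p]) auto
    next
      case True
      define p1 where "p1 = p - monom (lead_coeff p) (degree p)"
      have p1: "p1 \<in> polys" using less.prems by (auto simp: p1_def intro!: polys_diff polys_monom polys_coeff)
      have "n \<noteq> degree p" using True less.prems by auto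
      then have c: "coeff p1 n \<notin> J" using less.prems by (simp add: p1_def)
      then have "p1 \<noteq> 0" by auto
      moreover have "degree p1 \<le> degree p"
        unfolding p1_def by (intro degree_diff_le degree_monom_le) auto
      moreover have "coeff p1 (degree p) = 0" by (simp add: p1_def)
      ultimately have "degree p1 < degree p"
        using eq_zero_or_degree_less[of p1 "degree p"] by auto
      from less.hyps[OF this p1 c] obtain p' where p': "p' \<in> polys" "degree p' \<le> degree p1"
        "lead_coeff p' \<notin> J" "poly p1 y - poly p' y \<in> J" by blast
      have "poly p y - poly p' y = (poly p1 y - poly p' y) + lead_coeff p * y ^ degree p"
        by (simp add: p1_def poly_monom)
      also have "\<dots> \<in> J" using p' True by (intro add_mem mult_mem')
      finally show ?thesis using p' \<open>degree p1 < degree p\<close> by (intro exI[of _ p']) auto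
    qed
  qed
  then show ?thesis using that by blast
qed

text \<open>\<open>P\<close> plays the role of the minimal polynomial of \<open>y\<close> over
  \<open>S\<close> modulo \<open>J\<close>. It is not constant, since its constant would lie both
  inside and outside \<open>J\<close>.\<close>

lemma minimal_poly:
  assumes "p \<in> polys" "poly p y \<in> J" "coeff p n \<notin> J"
  obtains P where "P \<in> polys" "poly P y \<in> J" "lead_coeff P \<notin> J" "degree P > 0"
    "\<And>q m. q \<in> polys \<Longrightarrow> poly q y \<in> J \<Longrightarrow> degree q < degree P \<Longrightarrow> coeff q m \<in> J"
proof -
  define A where "A = {q. q \<in> polys \<and> poly q y \<in> J \<and> lead_coeff q \<notin> J}"
  have tr: "\<exists>q'\<in>A. degree q' \<le> degree q"
    if q: "q \<in> polys" "poly q y \<in> J" "coeff q m \<notin> J" for q m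
  proof -
    obtain q' where q': "q' \<in> polys" "degree q' \<le> degree q" "lead_coeff q' \<notin> J"
      "poly q y - poly q' y \<in> J"
      using truncate q(1,3) by blast
    have eq: "poly q' y = poly q y - (poly q y - poly q' y)" by simp
    have "poly q' y \<in> J" by (subst eq) (intro diff_mem q q')
    then show ?thesis using q' by (auto simp: A_def)
  qed
  obtain P where P: "P \<in> A" "\<And>q. q \<in> A \<Longrightarrow> degree P \<le> degree q"
    using tr[OF assms] ex_has_least_nat[of "\<lambda>q. q \<in> A" _ degree] by blast
  show ?thesis
  proof
    show "P \<in> polys" "poly P y \<in> J" "lead_coeff P \<notin> J" using P by (auto simp: A_def)
    show "degree P > 0"
    proof (rule ccontr)
      assume "\<not> degree P > 0"
      then obtain c where "P = [:c:]" by (metis degree_eq_zeroE not_gr_zero)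
      then show False using P(1) by (auto simp: A_def split: if_splits)
    qed
    show "coeff q m \<in> J" if "q \<in> polys" "poly q y \<in> J" "degree q < degree P" for q m
      using tr[OF that(1,2), of m] P(2) that(3) by (meson leD order.strict_trans1)
  qed
qed

text \<open>In an algebraic extension of domains every nonzero element divides a nonzero element of
  the base, as it divides its norm. Here \<open>poly g y\<close> is the element, and
  \<open>c\<close>, free of \<open>y\<close>, is the multiple.\<close>

lemma eliminate:
  assumes P: "P \<in> polys" "poly P y \<in> J" "lead_coeff P \<notin> J" "degree P > 0"
    and min: "\<And>q m. q \<in> polys \<Longrightarrow> poly q y \<in> J \<Longrightarrow> degree q < degree P \<Longrightarrow> coeff q m \<in> J"
    and g: "g \<in> polys" "poly g y \<notin> J"
  obtains c a where "c \<in> S" "c \<notin> J" "a \<in> polys" "c - poly a y * poly g y \<in> J"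
proof -
  \<comment> \<open>An element of least degree in the ideal of \<^term>\<open>g\<close> modulo \<^term>\<open>J\<close> is constant: otherwise
    pseudo-dividing \<^term>\<open>P\<close> by it contradicts the minimality of \<^term>\<open>P\<close>.\<close>
  define B where "B = {h. h \<in> polys \<and> poly h y \<notin> J \<and> (\<exists>a\<in>polys. poly h y - poly a y * poly g y \<in> J)}"
  have "g \<in> B" using g by (auto simp: B_def intro!: bexI[of _ 1])
  then obtain h0 where h0: "h0 \<in> B" "\<And>q. q \<in> B \<Longrightarrow> degree h0 \<le> degree q"
    using ex_has_least_nat[of "\<lambda>q. q \<in> B" _ degree] by blast
  obtain n where "coeff h0 n \<notin> J"
    using h0(1) poly_mem[of h0 y] by (auto simp: B_def)
  then obtain h where h: "h \<in> polys" "degree h \<le> degree h0" "lead_coeff h \<notin> J"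
    "poly h0 y - poly h y \<in> J"
    using truncate h0(1) by (auto simp: B_def)
  obtain a where a: "a \<in> polys" "poly h0 y - poly a y * poly g y \<in> J"
    using h0 by (auto simp: B_def)
  have ha: "poly h y - poly a y * poly g y \<in> J"
    using diff_mem[OF a(2) h(4)] by simp
  have hJ: "poly h y \<notin> J"
    using add_mem[OF h(4), of "poly h y"] h0(1) by (auto simp: B_def)
  have hmin: "degree h \<le> degree q" if "q \<in> B" for q
    using h0(2)[OF that] h(2) by simp
  have "degree h = 0"
  proof (rule ccontr)
    assume "degree h \<noteq> 0"
    \<comment> \<open>Otherwise the remainder of \<open>h\<close> by \<open>P\<close> would be a
      smaller element of \<open>B\<close>. The bound is needed below, to apply the minimality of
      \<open>P\<close> to a remainder by \<open>h\<close>.\<close>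
    have less: "degree h < degree P"
    proof (rule ccontr)
      assume ge: "\<not> degree h < degree P"
      obtain k q r where d: "q \<in> polys" "r \<in> polys" "smult (lead_coeff P ^ k) h = q * P + r"
        "degree r < degree P"
        using pseudo_division[OF h(1) P(1) P(4)] by metis
      from d(3) have "poly (smult (lead_coeff P ^ k) h) y = poly (q * P + r) y" by simp
      then have e: "poly r y = lead_coeff P ^ k * poly h y - poly q y * poly P y"
        by (simp add: algebra_simps)
      have "poly r y \<notin> J"
      proof
        assume "poly r y \<in> J"
        then have "lead_coeff P ^ k * poly h y \<in> J"
          using add_mem[OF _ mult_mem[OF P(2), of "poly q y"], of "poly r y"] by (simp add: e)
        then show False using hJ P(3) power_memD mult_mem_iff by blast
      qed
      moreover have "poly r y - poly (smult (lead_coeff P ^ k) a) y * poly g y \<in> J"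
      proof -
        have "poly r y - poly (smult (lead_coeff P ^ k) a) y * poly g y =
          lead_coeff P ^ k * (poly h y - poly a y * poly g y) - poly q y * poly P y"
          by (simp add: e algebra_simps)
        then show ?thesis using ha P(2) by (simp add: diff_mem mult_mem)
      qed
      ultimately have "r \<in> B"
        using d a P(1) by (auto simp: B_def intro!: bexI[of _ "smult (lead_coeff P ^ k) a"]
          polys_smult S_power polys_coeff)
      then show False using hmin[of r] d ge by simp
    qed
    \<comment> \<open>The remainder of \<open>P\<close> by \<open>h\<close> is too small for
      \<open>B\<close>, so its value lies in \<open>J\<close>, and hence so does the value of
      \<open>q\<close>. By minimality all coefficients of \<open>q\<close> and \<open>r\<close> are
      in \<open>J\<close>, and then so is the leading coefficient of a multiple of \<open>P\<close>
      by a factor outside \<open>J\<close>.\<close>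
    obtain k q r where d: "q \<in> polys" "r \<in> polys" "smult (lead_coeff h ^ k) P = q * h + r"
        "degree q \<le> degree P - degree h" "degree r < degree h"
      using pseudo_division[OF P(1) h(1)] \<open>degree h \<noteq> 0\<close> by (metis bot_nat_0.not_eq_extremum)
    from d(3) have "poly (smult (lead_coeff h ^ k) P) y = poly (q * h + r) y" by simp
    then have e: "poly r y = lead_coeff h ^ k * poly P y - poly q y * poly h y"
      by (simp add: algebra_simps)
    have "r \<notin> B" using hmin[of r] d by auto
    moreover have "poly r y - poly (- q * a) y * poly g y \<in> J"
    proof -
      have "poly r y - poly (- q * a) y * poly g y =
        lead_coeff h ^ k * poly P y - poly q y * (poly h y - poly a y * poly g y)"
        by (simp add: e algebra_simps)
      then show ?thesis using ha P(2) by (simp add: diff_mem mult_mem)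
    qed
    ultimately have rJ: "poly r y \<in> J"
      using d(1,2) a(1) by (auto simp: B_def dest: bspec[of _ _ "- q * a"] intro!: polys_mult polys_uminus)
    have "poly q y * poly h y = lead_coeff h ^ k * poly P y - poly r y" by (simp add: e)
    then have "poly q y * poly h y \<in> J" using rJ P(2) by (simp add: diff_mem mult_mem)
    then have "poly q y \<in> J" using hJ mult_mem_iff by blast
    moreover have "degree q < degree P" using d(4) \<open>degree h \<noteq> 0\<close> P(4) by linarith
    ultimately have "coeff q m \<in> J" for m using min d(1) by blast
    then have "coeff (q * h) m \<in> J" for m by (rule coeff_mult_mem)
    moreover have "coeff r m \<in> J" for m using min[OF d(2) rJ] d(5) less by simp
    ultimately have "coeff (q * h + r) (degree P) \<in> J" by (simp add: add_mem)
    then have "lead_coeff h ^ k * lead_coeff P \<in> J" by (simp flip: d(3))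
    then show False using h(3) P(3) power_memD mult_mem_iff by blast
  qed
  then obtain c where "h = [:c:]" by (rule degree_eq_zeroE)
  then show ?thesis
    using that[of c a] polys_coeff[OF h(1), of 0] hJ a(1) ha by simp
qed

end


section \<open>The Nullstellensatz for prime ideals\<close>

definition mpolys_in :: "'i set \<Rightarrow> ('i::finite, 'a::comm_ring_1) mpoly set" where
  "mpolys_in A = {F. \<forall>m\<in>Poly_Mapping.keys F. \<forall>i. i \<notin> A \<longrightarrow> Poly_Mapping.lookup m i = 0}"

lemma mpolys_in_mconst [simp]: "mconst c \<in> mpolys_in A"
  by (simp add: mpolys_in_def mconst_def)

lemma mpolys_in_0 [simp]: "0 \<in> mpolys_in A" and mpolys_in_1 [simp]: "1 \<in> mpolys_in A"
  by (simp_all add: mpolys_in_def)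

lemma mpolys_in_add: "F \<in> mpolys_in A \<Longrightarrow> G \<in> mpolys_in A \<Longrightarrow> F + G \<in> mpolys_in A"
  using keys_add[of F G] by (fastforce simp: mpolys_in_def)

lemma mpolys_in_uminus: "F \<in> mpolys_in A \<Longrightarrow> - F \<in> mpolys_in A"
  by (auto simp: mpolys_in_def in_keys_iff)

lemma mpolys_in_mult: "F \<in> mpolys_in A \<Longrightarrow> G \<in> mpolys_in A \<Longrightarrow> F * G \<in> mpolys_in A"
  using keys_mult[of F G] by (fastforce simp: mpolys_in_def lookup_add)

lemma mpolys_in_UNIV [simp]: "F \<in> mpolys_in UNIV"
  by (simp add: mpolys_in_def)

lemma mpolys_in_empty:
  assumes "F \<in> mpolys_in {}"
  obtains c where "F = mconst c"
proof
  show "F = mconst (Poly_Mapping.lookup F 0)"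
    unfolding mconst_def
  proof (rule poly_mapping_eqI)
    fix m
    have "m = 0" if "m \<in> Poly_Mapping.keys F"
      using assms that by (intro poly_mapping_eqI) (auto simp: mpolys_in_def)
    then show "Poly_Mapping.lookup F m = Poly_Mapping.lookup (Poly_Mapping.single 0 (Poly_Mapping.lookup F 0)) m"
      by (cases "m = 0") (auto simp: lookup_single in_keys_iff)
  qed
qed

lemma mpoly_eval_cong:
  fixes x y :: "'a::comm_ring_1 ^ 'i::finite"
  assumes "F \<in> mpolys_in A" "\<And>i. i \<in> A \<Longrightarrow> x $ i = y $ i"
  shows "mpoly_eval F x = mpoly_eval F y"
proof -
  have "monom_val (\<lambda>i. x $ i) m = monom_val (\<lambda>i. y $ i) m" if "m \<in> Poly_Mapping.keys F" for m
    unfolding monom_val_def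
  proof (intro prod.cong refl)
    fix i
    show "x $ i ^ Poly_Mapping.lookup m i = y $ i ^ Poly_Mapping.lookup m i"
      using assms that by (cases "i \<in> A") (auto simp: mpolys_in_def)
  qed
  then show ?thesis by (simp add: mpoly_eval_insertion insertion_def)
qed

text \<open>The coefficients remain elements of the full polynomial ring, so that one ideal
  \<open>J\<close> serves at every stage of an induction on the set of variables.\<close>

lemma mpolys_in_insert:
  assumes "F \<in> mpolys_in (insert i A)" "i \<notin> A"
  obtains p where "\<And>n. coeff p n \<in> mpolys_in A" "F = poly p (mvar i)"
proof -
  define drop where "drop m = m - Poly_Mapping.single i (Poly_Mapping.lookup m i)" for m :: "'a \<Rightarrow>\<^sub>0 nat"
  define p where "p = (\<Sum>m\<in>Poly_Mapping.keys F.
    monom (Poly_Mapping.single (drop m) (Poly_Mapping.lookup F m)) (Poly_Mapping.lookup m i))"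
  have "coeff p n \<in> mpolys_in A" for n
  proof -
    have *: "Poly_Mapping.single (drop m) (Poly_Mapping.lookup F m) \<in> mpolys_in A"
      if "m \<in> Poly_Mapping.keys F" for m
      using assms that
      by (auto simp: mpolys_in_def drop_def lookup_minus lookup_single when_def)
    have "sum f B \<in> mpolys_in A" if "finite B" "\<And>m. m \<in> B \<Longrightarrow> f m \<in> mpolys_in A"
      for f :: "_ \<Rightarrow> ('a, 'b) mpoly" and B :: "('a \<Rightarrow>\<^sub>0 nat) set"
      using that by (induction rule: finite_induct) (auto intro: mpolys_in_add)
    then show ?thesis
      unfolding p_def coeff_sum coeff_monom using * by simp
  qed
  moreover have "F = poly p (mvar i)"
  proof -
    have "poly p (mvar i) = (\<Sum>m\<in>Poly_Mapping.keys F.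
      Poly_Mapping.single (drop m) (Poly_Mapping.lookup F m) * mvar i ^ Poly_Mapping.lookup m i)"
      by (simp add: p_def poly_sum poly_monom)
    also have "\<dots> = (\<Sum>m\<in>Poly_Mapping.keys F. Poly_Mapping.single m (Poly_Mapping.lookup F m))"
    proof (intro sum.cong refl)
      fix m
      have "drop m + Poly_Mapping.single i (Poly_Mapping.lookup m i) = m"
        by (rule poly_mapping_eqI) (auto simp: drop_def lookup_add lookup_minus lookup_single when_def)
      moreover have "mvar i ^ n = Poly_Mapping.single (Poly_Mapping.single i n) (1 :: 'b)" for n
        using monom_val_mvar[of "Poly_Mapping.single i n"] by simp
      ultimately show "Poly_Mapping.single (drop m) (Poly_Mapping.lookup F m) * mvar i ^ Poly_Mapping.lookup m i =
        Poly_Mapping.single m (Poly_Mapping.lookup F m)"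
        by (simp add: mult_single)
    qed
    finally show ?thesis by (simp flip: mpoly_sum_monomials)
  qed
  ultimately show ?thesis using that by blast
qed

text \<open>Over a finite field the product of all \<open>X - a\<close>, increased by 1, has no
  root.\<close>

lemma infinite_UNIV_alg_closed: "infinite (UNIV :: 'a::alg_closed_field set)"
proof
  assume fin: "finite (UNIV :: 'a set)"
  define p where "p = (\<Prod>a\<in>UNIV. [:- a, 1 :: 'a:]) + 1"
  have d: "degree (\<Prod>a\<in>UNIV. [:- a, 1 :: 'a:]) = card (UNIV :: 'a set)"
    by (subst degree_prod_eq_sum_degree) auto
  moreover have "card (UNIV :: 'a set) > 0" using fin by (simp add: card_gt_0_iff)
  ultimately have "degree p > 0" unfolding p_def by (subst degree_add_eq_left) auto
  then obtain z where "poly p z = 0" using alg_closed_imp_poly_has_root by blast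
  moreover have "poly (\<Prod>a\<in>UNIV. [:- a, 1 :: 'a:]) z = 0"
    using fin by (simp add: poly_prod prod_zero_iff)
  ultimately show False by (simp add: p_def)
qed

lemma poly_exists_nonzero:
  fixes p :: "'a::alg_closed_field poly"
  assumes "p \<noteq> 0"
  obtains t where "poly p t \<noteq> 0"
proof -
  have "{t. poly p t = 0} \<noteq> UNIV"
    using poly_roots_finite[OF assms] infinite_UNIV_alg_closed[where 'a='a] by auto
  then show ?thesis using that by blast
qed

text \<open>Extends a zero of \<open>J\<close> by one more coordinate \<open>t\<close> while keeping
  \<open>G\<close> nonzero. If the variable \<open>i\<close> is transcendental modulo
  \<open>J\<close>, \<open>t\<close> only has to avoid the roots of \<open>G\<close>; if it is
  algebraic, \<open>t\<close> must be a root of the minimal polynomial, and \<open>G\<close> stays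
  nonzero because it divides some \<open>c\<close> free of that variable.\<close>

lemma specialisation_step:
  fixes J :: "('i::finite, 'a::alg_closed_field) mpoly set"
  assumes J: "prime_ideal J" and i: "i \<notin> A"
    and IH: "\<And>G. G \<in> mpolys_in A \<Longrightarrow> G \<notin> J \<Longrightarrow>
      \<exists>x. mpoly_eval G x \<noteq> 0 \<and> (\<forall>H\<in>J \<inter> mpolys_in A. mpoly_eval H x = 0)"
    and G: "G \<in> mpolys_in (insert i A)" "G \<notin> J"
  shows "\<exists>x. mpoly_eval G x \<noteq> 0 \<and> (\<forall>H\<in>J \<inter> mpolys_in (insert i A). mpoly_eval H x = 0)"
proof -
  interpret elimination J "mpolys_in A" "mvar i"
    using J by (simp add: elimination_def elimination_axioms_def mpolys_in_add mpolys_in_mult mpolys_in_uminus)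
  define upd where "upd x t = (\<chi> j. if j = i then t else x $ j)" for x :: "'a ^ 'i" and t
  define ev where "ev x p = map_poly (\<lambda>F. mpoly_eval F x) p" for x :: "'a ^ 'i" and p
  have eval: "mpoly_eval (poly p (mvar i)) (upd x t) = poly (ev x p) t" if "p \<in> polys" for p x t
  proof -
    have "mpoly_eval (poly p (mvar i)) (upd x t) =
      (\<Sum>n\<le>degree p. mpoly_eval (coeff p n) (upd x t) * t ^ n)"
      by (simp add: poly_altdef mpoly_eval.sum mpoly_eval.mult mpoly_eval.power upd_def)
    also have "\<dots> = (\<Sum>n\<le>degree p. mpoly_eval (coeff p n) x * t ^ n)"
      using that i by (intro sum.cong refl arg_cong2[of _ _ _ _ "(*)"] mpoly_eval_cong)
        (auto simp: polys_def upd_def)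
    also have "\<dots> = (\<Sum>n\<le>degree p. coeff (ev x p) n * t ^ n)"
      by (simp add: ev_def coeff_map_poly)
    also have "\<dots> = poly (ev x p) t"
    proof -
      have "degree (ev x p) \<le> degree p" unfolding ev_def by (rule map_poly_degree_leq)
      then show ?thesis
        unfolding poly_altdef by (intro sum.mono_neutral_right) (auto simp: coeff_eq_0)
    qed
    finally show ?thesis .
  qed
  have repr: "\<exists>p\<in>polys. F = poly p (mvar i)" if F: "F \<in> mpolys_in (insert i A)" for F
  proof -
    obtain p where "\<And>n. coeff p n \<in> mpolys_in A" "F = poly p (mvar i)"
      by (rule mpolys_in_insert[OF F i]) (rule that)
    then show ?thesis by (auto simp: polys_def)
  qed
  obtain g where g: "g \<in> polys" "G = poly g (mvar i)" using repr[OF G(1)] by blast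
  show ?thesis
  proof (cases "\<exists>p n. p \<in> polys \<and> poly p (mvar i) \<in> J \<and> coeff p n \<notin> J")
    \<comment> \<open>The transcendental case: an element of \<open>J\<close> has all its
      coefficients in \<open>J\<close>, so it vanishes at \<open>x\<close> for every choice of
      \<open>t\<close>.\<close>
    case False
    obtain n where n: "coeff g n \<notin> J" using poly_mem[of g "mvar i"] G g by blast
    obtain x where x: "mpoly_eval (coeff g n) x \<noteq> 0" "\<forall>H\<in>J \<inter> mpolys_in A. mpoly_eval H x = 0"
      using IH[OF polys_coeff[OF g(1)] n] by blast
    have "coeff (ev x g) n \<noteq> 0" using x by (simp add: ev_def coeff_map_poly)
    then have "ev x g \<noteq> 0" by auto
    then obtain t where t: "poly (ev x g) t \<noteq> 0" by (rule poly_exists_nonzero)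
    show ?thesis
    proof (intro exI[of _ "upd x t"] conjI ballI)
      show "mpoly_eval G (upd x t) \<noteq> 0" using eval[OF g(1)] g t by simp
      fix H assume H: "H \<in> J \<inter> mpolys_in (insert i A)"
      then obtain h where h: "h \<in> polys" "H = poly h (mvar i)" using repr by blast
      have "coeff h m \<in> J \<inter> mpolys_in A" for m
        using False H h polys_coeff by blast
      then have "ev x h = 0" using x(2) by (intro poly_eqI) (simp add: ev_def coeff_map_poly)
      then show "mpoly_eval H (upd x t) = 0" using eval[OF h(1)] h by simp
    qed
  next
    case True
    then obtain P where P: "P \<in> polys" "poly P (mvar i) \<in> J" "lead_coeff P \<notin> J" "degree P > 0"
      and min: "\<And>q m. q \<in> polys \<Longrightarrow> poly q (mvar i) \<in> J \<Longrightarrow> degree q < degree P \<Longrightarrow> coeff q m \<in> J"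
      using minimal_poly by metis
    obtain c a where c: "c \<in> mpolys_in A" "c \<notin> J" and a: "a \<in> polys"
      and ca: "c - poly a (mvar i) * poly g (mvar i) \<in> J"
      using eliminate[OF P min g(1)] G g by blast
    \<comment> \<open>Besides \<open>c\<close>, the point must avoid the leading coefficient of
      \<open>P\<close>: then \<open>P\<close> keeps its positive degree and has a root, and the
      power of the leading coefficient in pseudo-division can be cancelled after evaluation.\<close>
    obtain x where x: "mpoly_eval (lead_coeff P * c) x \<noteq> 0" "\<forall>H\<in>J \<inter> mpolys_in A. mpoly_eval H x = 0"
      using IH[of "lead_coeff P * c"] c P polys_coeff[OF P(1)] mult_mem_iff
      by (auto intro: mpolys_in_mult)
    have lx: "mpoly_eval (lead_coeff P) x \<noteq> 0" and cx: "mpoly_eval c x \<noteq> 0"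
      using x(1) by (auto simp: mpoly_eval.mult)
    have "coeff (ev x P) (degree P) \<noteq> 0" using lx by (simp add: ev_def coeff_map_poly)
    then have "degree (ev x P) > 0" using P(4) le_degree[of "ev x P" "degree P"] by linarith
    then obtain t where t: "poly (ev x P) t = 0" using alg_closed_imp_poly_has_root by blast
    \<comment> \<open>The remainder of \<open>H\<close> by \<open>P\<close> has its coefficients in
      \<open>J\<close> by minimality, so it specialises to 0, and the multiple of \<open>P\<close>
      vanishes at the root \<open>t\<close>.\<close>
    have van: "mpoly_eval H (upd x t) = 0" if H: "H \<in> J" "H \<in> mpolys_in (insert i A)" for H
    proof -
      obtain h where h: "h \<in> polys" "H = poly h (mvar i)" using repr H by blast
      obtain k q r where d: "q \<in> polys" "r \<in> polys" "smult (lead_coeff P ^ k) h = q * P + r"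
        "degree r < degree P"
        using pseudo_division[OF h(1) P(1) P(4)] by metis
      from d(3) have "poly (smult (lead_coeff P ^ k) h) (mvar i) = poly (q * P + r) (mvar i)" by simp
      then have e: "lead_coeff P ^ k * H = poly q (mvar i) * poly P (mvar i) + poly r (mvar i)"
        using h by simp
      then have "poly r (mvar i) = lead_coeff P ^ k * H - poly q (mvar i) * poly P (mvar i)"
        by simp
      then have "poly r (mvar i) \<in> J" using H P by (simp add: diff_mem mult_mem)
      then have "coeff r m \<in> J \<inter> mpolys_in A" for m using min d polys_coeff by blast
      then have "ev x r = 0" using x(2) by (intro poly_eqI) (simp add: ev_def coeff_map_poly)
      moreover have "mpoly_eval (lead_coeff P) (upd x t) = mpoly_eval (lead_coeff P) x"
        using i by (intro mpoly_eval_cong[OF polys_coeff[OF P(1)]]) (auto simp: upd_def)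
      ultimately have "mpoly_eval (lead_coeff P) x ^ k * mpoly_eval H (upd x t) = 0"
        using arg_cong[OF e, of "\<lambda>F. mpoly_eval F (upd x t)"] eval d P t
        by (simp add: mpoly_eval.mult mpoly_eval.add mpoly_eval.power)
      then show ?thesis using lx by simp
    qed
    have "c - poly a (mvar i) * G \<in> mpolys_in (insert i A)"
    proof -
      have sub: "F \<in> mpolys_in (insert i A)" if "F \<in> mpolys_in A" for F
        using that by (auto simp: mpolys_in_def)
      have v: "mvar i \<in> mpolys_in (insert i A)"
        by (auto simp: mpolys_in_def mvar_def lookup_single when_def)
      have pw: "F ^ n \<in> mpolys_in B" if "F \<in> mpolys_in B" for F n and B :: "'i set"
        using that by (induction n) (auto intro: mpolys_in_mult)
      have sm: "sum f B \<in> mpolys_in C" if "\<And>m. m \<in> B \<Longrightarrow> f m \<in> mpolys_in C"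
        for f :: "_ \<Rightarrow> ('i, 'a) mpoly" and B :: "nat set" and C
        using that by (induction B rule: infinite_finite_induct) (auto intro: mpolys_in_add)
      have "poly a (mvar i) \<in> mpolys_in (insert i A)"
        unfolding poly_altdef using a by (intro sm mpolys_in_mult pw v sub polys_coeff)
      then show ?thesis
        unfolding diff_conv_add_uminus
        by (intro mpolys_in_add mpolys_in_uminus mpolys_in_mult sub[OF c(1)] G(1))
    qed
    then have "mpoly_eval (c - poly a (mvar i) * G) (upd x t) = 0"
      using van ca g by blast
    moreover have "mpoly_eval c (upd x t) = mpoly_eval c x"
      using i by (intro mpoly_eval_cong[OF c(1)]) (auto simp: upd_def)
    ultimately have "mpoly_eval G (upd x t) \<noteq> 0"
      using cx by (auto simp: mpoly_eval.diff mpoly_eval.mult)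
    then show ?thesis using van by blast
  qed
qed

theorem Nullstellensatz_prime:
  fixes J :: "('i::finite, 'a::alg_closed_field) mpoly set"
  assumes J: "prime_ideal J" and "G \<notin> J"
  obtains x where "mpoly_eval G x \<noteq> 0" "\<And>H. H \<in> J \<Longrightarrow> mpoly_eval H x = 0"
proof -
  interpret prime_ideal J by fact
  have "\<exists>x. mpoly_eval G x \<noteq> 0 \<and> (\<forall>H\<in>J \<inter> mpolys_in A. mpoly_eval H x = 0)"
    if "finite A" "G \<in> mpolys_in A" "G \<notin> J" for A :: "'i set" and G
    using that
  proof (induction A arbitrary: G rule: finite_induct)
    case empty
    have nz: "c = 0" if "mconst c \<in> J" for c
    proof (rule ccontr)
      assume "c \<noteq> 0"
      then have "mconst (inverse c) * mconst c = (1 :: ('i, 'a) mpoly)"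
        by (simp add: mconst_def mult_single)
      then show False using mult_mem[OF that, of "mconst (inverse c)"] by simp
    qed
    obtain c where c: "G = mconst c" by (rule mpolys_in_empty[OF empty(1)])
    have "c \<noteq> 0"
    proof
      assume "c = 0"
      then have "G = 0" by (simp add: c mconst_def)
      then show False using empty(2) by simp
    qed
    moreover have "mpoly_eval H 0 = 0" if H: "H \<in> J \<inter> mpolys_in {}" for H
    proof -
      obtain d where d: "H = mconst d" using H by (auto elim: mpolys_in_empty)
      then show ?thesis using nz[of d] H by simp
    qed
    ultimately show ?case by (intro exI[of _ 0]) (simp add: c)
  next
    case (insert i A)
    show ?case
      by (rule specialisation_step[OF J insert(2) insert(3)]) (use insert in auto)
  qed
  from this[of UNIV G] obtain x where "mpoly_eval G x \<noteq> 0"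
    "\<forall>H\<in>J \<inter> mpolys_in UNIV. mpoly_eval H x = 0"
    using assms(2) by auto
  then show ?thesis using that[of x] by simp
qed

section \<open>Homogeneous polynomials\<close>

lemma mdeg_0 [simp]: "mdeg 0 = 0"
  and mdeg_add: "mdeg (m + n) = mdeg m + mdeg n"
  and mdeg_single [simp]: "mdeg (Poly_Mapping.single i k) = k"
  by (simp_all add: mdeg_def lookup_add sum.distrib lookup_single when_def sum.delta)

lemma homogeneous_iff: "homogeneous d F \<longleftrightarrow> (\<forall>m. Poly_Mapping.lookup F m \<noteq> 0 \<longrightarrow> mdeg m = d)"
  by (auto simp: homogeneous_def in_keys_iff)

lemma homogeneous_0 [simp]: "homogeneous d 0"
  by (simp add: homogeneous_iff)

lemma homogeneous_add: "homogeneous d F \<Longrightarrow> homogeneous d G \<Longrightarrow> homogeneous d (F + G)"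
  by (simp add: homogeneous_iff lookup_add) (metis add_0)

lemma homogeneous_uminus: "homogeneous d F \<Longrightarrow> homogeneous d (- F)"
  by (auto simp: homogeneous_iff)

lemma homogeneous_diff: "homogeneous d F \<Longrightarrow> homogeneous d G \<Longrightarrow> homogeneous d (F - G)"
  using homogeneous_add[of d F "- G"] homogeneous_uminus by auto

lemma homogeneous_sum: "(\<And>i. i \<in> A \<Longrightarrow> homogeneous d (f i)) \<Longrightarrow> homogeneous d (sum f A)"
  by (induction A rule: infinite_finite_induct) (auto intro: homogeneous_add)

lemma homogeneous_mult:
  assumes "homogeneous d F" "homogeneous e G"
  shows "homogeneous (d + e) (F * G)"
  unfolding homogeneous_def
proof
  fix m assume "m \<in> Poly_Mapping.keys (F * G)"
  then obtain a b where "m = a + b" "a \<in> Poly_Mapping.keys F" "b \<in> Poly_Mapping.keys G"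
    using keys_mult[of F G] by blast
  then show "mdeg m = d + e" using assms by (simp add: homogeneous_def mdeg_add)
qed

lemma homogeneous_single: "mdeg m = d \<Longrightarrow> homogeneous d (Poly_Mapping.single m c)"
  by (auto simp: homogeneous_iff lookup_single when_def)

lemma homogeneous_mvar: "homogeneous 1 (mvar i)"
  unfolding mvar_def by (rule homogeneous_single) simp

lemma homogeneous_mconst: "homogeneous 0 (mconst c)"
  unfolding mconst_def by (rule homogeneous_single) simp

lemma homogeneous_1: "homogeneous 0 1"
  using homogeneous_mconst[of 1] by (simp add: mconst_def)

lemma homogeneous_power: "homogeneous d F \<Longrightarrow> homogeneous (n * d) (F ^ n)"
  by (induction n) (auto intro: homogeneous_1 homogeneous_mult)

lemma homogeneous_prod:
  "(\<And>i. i \<in> A \<Longrightarrow> homogeneous (d i) (f i)) \<Longrightarrow> homogeneous (\<Sum>i\<in>A. d i) (\<Prod>i\<in>A. f i)"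
  by (induction A rule: infinite_finite_induct) (auto intro: homogeneous_mult homogeneous_1)

lemma homogeneous_monom_val:
  assumes "\<And>i. homogeneous e (G i)"
  shows "homogeneous (mdeg m * e) (monom_val G m)"
  unfolding monom_val_def mdeg_def sum_distrib_right
  by (intro homogeneous_prod homogeneous_power assms)

lemma homogeneous_subst:
  assumes "homogeneous d F" "\<And>j. homogeneous e (G j)"
  shows "homogeneous (d * e) (mpoly_subst G F)"
proof -
  have "mpoly_subst G F =
    (\<Sum>m\<in>Poly_Mapping.keys F. mconst (Poly_Mapping.lookup F m) * monom_val G m)"
    by (simp add: mpoly_subst_def insertion_def)
  also have "homogeneous (d * e) \<dots>"
  proof (intro homogeneous_sum)
    fix m assume "m \<in> Poly_Mapping.keys F"
    then have "mdeg m = d" using assms by (simp add: homogeneous_def)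
    then show "homogeneous (d * e) (mconst (Poly_Mapping.lookup F m) * monom_val G m)"
      using homogeneous_mult[OF homogeneous_mconst homogeneous_monom_val[where m = m, OF assms(2)]] by simp
  qed
  finally show ?thesis .
qed

lemma mpoly_eval_scale:
  assumes "homogeneous d F"
  shows "mpoly_eval F (s *s x) = s ^ d * mpoly_eval F x"
proof -
  have "mpoly_eval F (s *s x) = (\<Sum>m\<in>Poly_Mapping.keys F.
      Poly_Mapping.lookup F m * (s ^ mdeg m * monom_val (\<lambda>i. x $ i) m))"
    by (simp add: mpoly_eval_insertion insertion_def monom_val_scale)
  also have "\<dots> = (\<Sum>m\<in>Poly_Mapping.keys F.
      s ^ d * (Poly_Mapping.lookup F m * monom_val (\<lambda>i. x $ i) m))"
    using assms by (intro sum.cong) (auto simp: homogeneous_def)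
  finally show ?thesis
    by (simp add: mpoly_eval_insertion insertion_def sum_distrib_left)
qed

lemma lookup_homogeneous_component:
  "Poly_Mapping.lookup (homogeneous_component d F) m = (Poly_Mapping.lookup F m when mdeg m = d)"
proof -
  have "Poly_Mapping.lookup (homogeneous_component d F) m =
    (\<Sum>n\<in>{n \<in> Poly_Mapping.keys F. mdeg n = d}. if n = m then Poly_Mapping.lookup F m else 0)"
    unfolding homogeneous_component_def lookup_sum
    by (intro sum.cong) (auto simp: lookup_single when_def)
  then show ?thesis by (auto simp: sum.delta in_keys_iff when_def)
qed

lemma homogeneous_component: "homogeneous d (homogeneous_component d F)"
  by (auto simp: homogeneous_iff lookup_homogeneous_component when_def)

lemma homogeneous_component_same: "homogeneous d F \<Longrightarrow> homogeneous_component d F = F"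
  by (rule poly_mapping_eqI) (auto simp: lookup_homogeneous_component when_def homogeneous_iff)

lemma homogeneous_component_other:
  "homogeneous e F \<Longrightarrow> e \<noteq> d \<Longrightarrow> homogeneous_component d F = 0"
  by (rule poly_mapping_eqI) (auto simp: lookup_homogeneous_component when_def homogeneous_iff)

lemma homogeneous_component_add:
  "homogeneous_component d (F + G) = homogeneous_component d F + homogeneous_component d G"
  by (rule poly_mapping_eqI) (auto simp: lookup_homogeneous_component lookup_add when_def)

lemma homogeneous_component_sum:
  "homogeneous_component d (sum f A) = (\<Sum>i\<in>A. homogeneous_component d (f i))"
proof (induction A rule: infinite_finite_induct)
  case (insert x F)
  then show ?case by (simp add: homogeneous_component_add)
qed (auto intro!: homogeneous_component_other[of "Suc d"])

text \<open>Substituting \<open>t x_i\<close> for \<open>x_i\<close> collects the homogeneous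
  components as the coefficients of a polynomial in \<open>t\<close>. Multiplicativity then gives
  the behaviour of components and of the total degree under products.\<close>

definition grade_poly :: "('i::finite, 'a::comm_ring_1) mpoly \<Rightarrow> ('i, 'a) mpoly poly" where
  "grade_poly = insertion (\<lambda>c. [:mconst c:]) (\<lambda>i. [:0, mvar i:])"

lemma ring_morphism_const_mconst: "ring_morphism (\<lambda>c. [:mconst c:])"
  by (rule ring_morphism_comp[OF ring_morphism_const_poly ring_morphism_mconst])

interpretation grade_poly: ring_morphism grade_poly
  unfolding grade_poly_def
  by (rule ring_morphism.ring_morphism_insertion[OF ring_morphism_const_mconst])

lemma grade_poly_single:
  fixes m :: "'i::finite \<Rightarrow>\<^sub>0 nat" and c :: "'a::comm_ring_1"
  shows "grade_poly (Poly_Mapping.single m c) = monom (Poly_Mapping.single m c) (mdeg m)"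
proof -
  have "(\<lambda>i. [:0, mvar i:]) = (\<lambda>i::'i. [:0, 1:] * [:mvar i :: ('i, 'a) mpoly:])"
    by auto
  moreover have "monom_val (\<lambda>i. [:mvar i :: ('i, 'a) mpoly:]) m = [:monom_val mvar m:]"
    by (rule ring_morphism.monom_val[OF ring_morphism_const_poly, symmetric])
  ultimately have "monom_val (\<lambda>i. [:0, mvar i :: ('i, 'a) mpoly:]) m = [:0, 1:] ^ mdeg m * [:monom_val mvar m:]"
    by (simp only: monom_val_scale)
  then show ?thesis
    unfolding grade_poly_def ring_morphism.insertion_single[OF ring_morphism_const_mconst]
    by (simp add: single_conv_mvar[of m c] monom_altdef mult_ac)
qed

lemma coeff_grade_poly:
  fixes F :: "('i::finite, 'a::comm_ring_1) mpoly"
  shows "coeff (grade_poly F) d = homogeneous_component d F"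
proof -
  have "coeff (grade_poly F) d = (\<Sum>m\<in>Poly_Mapping.keys F.
      coeff (grade_poly (Poly_Mapping.single m (Poly_Mapping.lookup F m))) d)"
    by (subst mpoly_sum_monomials) (simp add: grade_poly.sum coeff_sum)
  also have "\<dots> = (\<Sum>m\<in>Poly_Mapping.keys F.
      homogeneous_component d (Poly_Mapping.single m (Poly_Mapping.lookup F m)))"
  proof (intro sum.cong refl)
    fix m :: "'i \<Rightarrow>\<^sub>0 nat" and c :: 'a
    show "coeff (grade_poly (Poly_Mapping.single m c)) d = homogeneous_component d (Poly_Mapping.single m c)"
      using homogeneous_single[of m _ c]
      by (cases "mdeg m = d")
        (simp_all add: grade_poly_single homogeneous_component_same homogeneous_component_other)
  qed
  also have "\<dots> = homogeneous_component d F"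
    by (subst (2) mpoly_sum_monomials) (simp add: homogeneous_component_sum)
  finally show ?thesis .
qed

lemma poly_grade_poly_1: "poly (grade_poly F) 1 = F"
  unfolding grade_poly_def
  by (subst ring_morphism_insertion_comp[OF ring_morphism_poly ring_morphism_const_mconst])
    (simp add: insertion_mvar_self)

lemma grade_poly_eq_0_iff [simp]: "grade_poly F = 0 \<longleftrightarrow> F = 0"
  using poly_grade_poly_1[of F] by auto

lemma sum_homogeneous_components:
  "F = (\<Sum>d\<le>degree (grade_poly F). homogeneous_component d F)"
  by (subst poly_grade_poly_1[symmetric]) (simp add: poly_altdef coeff_grade_poly)

lemma grade_poly_homogeneous: "homogeneous d F \<Longrightarrow> grade_poly F = monom F d"
  by (rule poly_eqI)
    (auto simp: coeff_grade_poly homogeneous_component_same homogeneous_component_other)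

lemma coeff_line_poly_0: "coeff (line_poly 0 x F) d = mpoly_eval (homogeneous_component d F) x"
proof -
  have "line_poly 0 x F = map_poly (\<lambda>G. mpoly_eval G x) (grade_poly F)"
  proof (induction F rule: mpoly_ring_induct)
    case (const c)
    have "grade_poly (mconst c) = [:mconst c :: ('b, 'a) mpoly:]"
      using grade_poly_homogeneous[OF homogeneous_mconst] by (simp add: monom_0)
    then show ?case by (simp add: map_poly_pCons)
  next
    case (var i)
    have "grade_poly (mvar i) = [:0, mvar i :: ('b, 'a) mpoly:]"
      using grade_poly_homogeneous[OF homogeneous_mvar] by (simp add: monom_altdef)
    then show ?case by (simp add: map_poly_pCons)
  next
    case (add F G)
    then show ?case
      by (intro poly_eqI) (simp add: line_poly.add grade_poly.add coeff_map_poly mpoly_eval.add)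
  next
    case (mult F G)
    then show ?case
      by (intro poly_eqI) (simp add: line_poly.mult grade_poly.mult coeff_map_poly mpoly_eval.sum
        coeff_mult mpoly_eval.mult)
  qed
  then show ?thesis by (simp add: coeff_map_poly coeff_grade_poly)
qed

lemma homogeneous_component_vanishes:
  fixes x :: "'a::idom ^ 'i::finite"
  assumes "infinite (UNIV :: 'a set)" "\<And>s. mpoly_eval F (s *s x) = 0"
  shows "mpoly_eval (homogeneous_component d F) x = 0"
proof -
  have "poly (line_poly 0 x F) s = 0" for s
    using assms(2) by (simp add: poly_line_poly)
  then have "{s. poly (line_poly 0 x F) s = 0} = UNIV" by simp
  then have "line_poly 0 x F = 0"
    using poly_roots_finite[of "line_poly 0 x F"] assms(1) by auto
  then show ?thesis by (simp flip: coeff_line_poly_0)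
qed


section \<open>Unique factorisation in three variables\<close>

lemma ring_morphism_eval_poly:
  assumes "ring_morphism h"
  shows "ring_morphism (\<lambda>p. poly (map_poly h p) c)"
proof -
  interpret h: ring_morphism h by fact
  have "map_poly h (p + q) = map_poly h p + map_poly h q" for p q
    by (intro poly_eqI) (simp add: coeff_map_poly h.add)
  moreover have "map_poly h (p * q) = map_poly h p * map_poly h q" for p q
    by (intro poly_eqI) (simp add: coeff_map_poly coeff_mult h.sum h.mult)
  ultimately show ?thesis
    by unfold_locales (simp_all add: map_poly_1)
qed

lemma ring_morphism_poly_eqI:
  assumes "ring_morphism f" "ring_morphism g" "\<And>c. f [:c:] = g [:c:]" "f [:0, 1:] = g [:0, 1:]"
  shows "f p = g p"
proof (induction p)
  case 0
  show ?case using assms(1,2) by (simp add: ring_morphism.zero)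
next
  case (pCons a p)
  have "pCons a p = [:a:] + [:0, 1:] * p" by simp
  then show ?case
    using assms pCons by (simp only: ring_morphism.add ring_morphism.mult)
qed

text \<open>Unique factorisation passes from a ring to its univariate polynomials by type-class
  instances; nesting three times carries it to three variables. Variable 1 is innermost and variable
  3 outermost.\<close>

definition nested_poly :: "(3, 'a::comm_ring_1) mpoly \<Rightarrow> 'a poly poly poly" where
  "nested_poly = insertion (\<lambda>c. [:[:[:c:]:]:])
     (\<lambda>i. if i = 1 then [:[:[:0, 1:]:]:] else if i = 2 then [:[:0, 1:]:] else [:0, 1:])"

definition unnest1 :: "'a::comm_ring_1 poly \<Rightarrow> (3, 'a) mpoly" where
  "unnest1 p = poly (map_poly mconst p) (mvar 1)"

definition unnest2 :: "'a::comm_ring_1 poly poly \<Rightarrow> (3, 'a) mpoly" where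
  "unnest2 p = poly (map_poly unnest1 p) (mvar 2)"

definition unnest3 :: "'a::comm_ring_1 poly poly poly \<Rightarrow> (3, 'a) mpoly" where
  "unnest3 p = poly (map_poly unnest2 p) (mvar 3)"

lemma ring_morphism_unnest1: "ring_morphism unnest1"
  unfolding unnest1_def by (rule ring_morphism_eval_poly[OF ring_morphism_mconst])

lemma ring_morphism_unnest2: "ring_morphism unnest2"
  unfolding unnest2_def by (rule ring_morphism_eval_poly[OF ring_morphism_unnest1])

lemma ring_morphism_unnest3: "ring_morphism unnest3"
  unfolding unnest3_def by (rule ring_morphism_eval_poly[OF ring_morphism_unnest2])

lemma ring_morphism_const_poly3: "ring_morphism (\<lambda>c. [:[:[:c:]:]:])"
  by (intro ring_morphism_comp[OF ring_morphism_const_poly] ring_morphism_const_poly)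

lemma ring_morphism_nested_poly: "ring_morphism nested_poly"
  unfolding nested_poly_def
  by (rule ring_morphism.ring_morphism_insertion[OF ring_morphism_const_poly3])

lemma nested_poly_mvar: "nested_poly (mvar i) =
    (if i = 1 then [:[:[:0, 1:]:]:] else if i = 2 then [:[:0, 1:]:] else [:0, 1:])"
  and nested_poly_mconst: "nested_poly (mconst c) = [:[:[:c:]:]:]"
  unfolding nested_poly_def
  by (simp_all add: ring_morphism.insertion_mvar[OF ring_morphism_const_poly3]
    ring_morphism.insertion_mconst[OF ring_morphism_const_poly3])

lemma unnest_const [simp]:
  "unnest1 [:c:] = mconst c" "unnest2 [:p:] = unnest1 p" "unnest3 [:q:] = unnest2 q"
  by (simp_all add: unnest1_def unnest2_def unnest3_def map_poly_pCons mconst_def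
    ring_morphism.zero[OF ring_morphism_unnest1] ring_morphism.zero[OF ring_morphism_unnest2])

lemma unnest_X [simp]:
  "unnest1 [:0, 1:] = mvar 1" "unnest2 [:0, 1:] = mvar 2" "unnest3 [:0, 1:] = mvar 3"
  by (simp_all add: unnest1_def[of "[:0, 1:]"] unnest2_def[of "[:0, 1:]"] unnest3_def[of "[:0, 1:]"]
    map_poly_pCons mconst_def
    ring_morphism.zero[OF ring_morphism_unnest1] ring_morphism.zero[OF ring_morphism_unnest2]
    ring_morphism.one[OF ring_morphism_unnest1] ring_morphism.one[OF ring_morphism_unnest2])

lemma unnest3_nested_poly: "unnest3 (nested_poly F) = F"
proof -
  note m = ring_morphism_comp[OF ring_morphism_unnest3 ring_morphism_nested_poly]
  show ?thesis
  proof (induction F rule: mpoly_ring_induct)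
    case (var i)
    have "i = 1 \<or> i = 2 \<or> i = 3" by (rule exhaust_3)
    then show ?case by (auto simp: nested_poly_mvar)
  next
    case (add F G)
    then show ?case by (simp add: ring_morphism.add[OF m])
  next
    case (mult F G)
    then show ?case by (simp add: ring_morphism.mult[OF m])
  qed (simp add: nested_poly_mconst)
qed

lemma nested_poly_unnest3: "nested_poly (unnest3 p) = p"
proof -
  note nc = ring_morphism_comp[OF ring_morphism_nested_poly]
  note cp = ring_morphism_const_poly
  have 1: "nested_poly (unnest1 r) = [:[:r:]:]" for r :: "'a poly"
    by (rule ring_morphism_poly_eqI[OF nc[OF ring_morphism_unnest1] ring_morphism_comp[OF cp cp]])
      (simp_all add: nested_poly_mconst nested_poly_mvar)
  have 2: "nested_poly (unnest2 r) = [:r:]" for r :: "'a poly poly"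
    by (rule ring_morphism_poly_eqI[OF nc[OF ring_morphism_unnest2] cp])
      (simp_all add: 1 nested_poly_mvar)
  show ?thesis
    by (rule ring_morphism_poly_eqI[OF nc[OF ring_morphism_unnest3] ring_morphism_id])
      (simp_all add: 2 nested_poly_mvar)
qed

text \<open>\<open>nested_poly\<close> is a ring isomorphism, so divisibility, units and
  irreducibility can be moved to the nested polynomials, which form a factorial ring under the given
  sort.\<close>

lemma mpoly3_irreducible_imp_prime:
  fixes F :: "(3, 'a::{factorial_ring_gcd, semiring_gcd_mult_normalize}) mpoly"
  assumes "irreducible F"
  shows "prime_elem F"
proof -
  interpret n: ring_morphism "nested_poly :: (3, 'a) mpoly \<Rightarrow> _" by (rule ring_morphism_nested_poly)
  interpret u: ring_morphism "unnest3 :: _ \<Rightarrow> (3, 'a) mpoly" by (rule ring_morphism_unnest3)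
  have dvd: "nested_poly A dvd nested_poly B \<longleftrightarrow> A dvd B" for A B :: "(3, 'a) mpoly"
    by (metis dvd_def n.mult u.mult unnest3_nested_poly)
  have unit: "(nested_poly A) dvd 1 \<longleftrightarrow> A dvd 1" for A :: "(3, 'a) mpoly"
    using dvd[of A 1] by simp
  have z: "nested_poly A = 0 \<longleftrightarrow> A = 0" for A :: "(3, 'a) mpoly"
    by (metis n.zero u.zero unnest3_nested_poly)
  have "irreducible (nested_poly F)"
  proof (rule irreducibleI)
    show "nested_poly F \<noteq> 0" "\<not> (nested_poly F) dvd 1"
      using assms by (auto simp: z unit dest: irreducible_not_unit)
    fix a b assume "nested_poly F = a * b"
    then have "F = unnest3 a * unnest3 b" by (metis u.mult unnest3_nested_poly)
    then have "(unnest3 a) dvd 1 \<or> (unnest3 b) dvd 1" using assms irreducibleD by blast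
    then show "a dvd 1 \<or> b dvd 1" by (metis unit nested_poly_unnest3)
  qed
  then have p: "prime_elem (nested_poly F)" by (rule irreducible_imp_prime_elem)
  show ?thesis
  proof (rule prime_elemI)
    show "F \<noteq> 0" "\<not> F dvd 1" using assms by (auto dest: irreducible_not_unit)
    fix A B assume "F dvd A * B"
    then have "nested_poly F dvd nested_poly A * nested_poly B" by (simp flip: n.mult add: dvd)
    then show "F dvd A \<or> F dvd B" using p by (auto simp: prime_elem_dvd_mult_iff dvd)
  qed
qed

section \<open>Projective varieties\<close>

lemma prime_ideal_iff_primeideal:
  fixes I :: "'r::comm_ring_1 set"
  shows "prime_ideal I \<longleftrightarrow> primeideal I ring_of_type_algebra"
proof
  assume "prime_ideal I"
  then interpret prime_ideal I .
  show "primeideal I ring_of_type_algebra"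
  proof (rule primeidealI)
    show "ideal I ring_of_type_algebra"
    proof (rule idealI[OF ring_from_type_algebra])
      interpret R: ring "ring_of_type_algebra :: 'r ring" by (rule ring_from_type_algebra)
      have inv: "inv\<^bsub>add_monoid ring_of_type_algebra\<^esub> a = - a" for a :: 'r
        using R.minus_equality[of "- a" a]
        by (simp add: a_inv_def ring_of_type_algebra_def)
      show "subgroup I (add_monoid (ring_of_type_algebra :: 'r ring))"
      proof (rule subgroup.intro)
        fix x assume "x \<in> I"
        then show "inv\<^bsub>add_monoid ring_of_type_algebra\<^esub> x \<in> I" by (simp only: inv uminus_mem)
      qed (auto simp: ring_of_type_algebra_def add_mem)
    qed (auto simp: ring_of_type_algebra_def mult_mem mult_mem')
    show "carrier ring_of_type_algebra \<noteq> I"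
    proof -
      have "I \<noteq> UNIV" by (metis UNIV_I one_notin)
      then show ?thesis by (auto simp: ring_of_type_algebra_def)
    qed
    show "cring (ring_of_type_algebra :: 'r ring)" by (rule cring_from_type_algebra)
  qed (auto simp: ring_of_type_algebra_def mult_mem_iff)
next
  assume "primeideal I ring_of_type_algebra"
  then interpret primeideal I ring_of_type_algebra .
  show "prime_ideal I"
  proof
    show "1 \<notin> I" using I_notcarr one_imp_carrier by (auto simp: ring_of_type_algebra_def)
    show "x * y \<in> I \<Longrightarrow> x \<in> I \<or> y \<in> I" for x y
      using I_prime[of x y] by (simp add: ring_of_type_algebra_def)
    show "0 \<in> I" using additive_subgroup.zero_closed[OF additive_subgroup_axioms]
      by (simp add: ring_of_type_algebra_def)
    show "x \<in> I \<Longrightarrow> y \<in> I \<Longrightarrow> x + y \<in> I" for x y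
      using additive_subgroup.a_closed[OF additive_subgroup_axioms, of x y]
      by (simp add: ring_of_type_algebra_def)
    show "x \<in> I \<Longrightarrow> r * x \<in> I" for x r
      using I_l_closed[of x r] by (simp add: ring_of_type_algebra_def)
  qed
qed

lemma homogeneous_prime_ideal_iff:
  "homogeneous_prime_ideal I \<longleftrightarrow> prime_ideal I \<and> (\<forall>F\<in>I. \<forall>d. homogeneous_component d F \<in> I)"
  by (simp add: homogeneous_prime_ideal_def prime_ideal_iff_primeideal)

lemma vec_span_singleton: "vec.span {x} = range (\<lambda>s. s *s x)"
  by (rule vec.span_singleton)

lemma projective_space_iff: "L \<in> projective_space \<longleftrightarrow> (\<exists>x. x \<noteq> 0 \<and> L = vec.span {x})"
proof
  assume "L \<in> projective_space"
  then have L: "vec.subspace L" "vec.dim L = 1" by (auto simp: projective_space_def)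
  obtain B where B: "B \<subseteq> L" "vec.independent B" "L \<subseteq> vec.span B" "card B = vec.dim L"
    using vec.basis_exists by blast
  then obtain x where "B = {x}" using L card_1_singletonE by metis
  then show "\<exists>x. x \<noteq> 0 \<and> L = vec.span {x}"
    using B L vec.span_minimal[of B L] vec.dependent_zero by (intro exI[of _ x]) auto
next
  assume "\<exists>x. x \<noteq> 0 \<and> L = vec.span {x}"
  then show "L \<in> projective_space"
    by (auto simp: projective_space_def vec.dim_span vec.dim_singleton vec.subspace_span)
qed

lemma span_in_projective_space: "x \<noteq> 0 \<Longrightarrow> vec.span {x} \<in> projective_space"
  by (auto simp: projective_space_iff)

lemma span_eqI:
  assumes "L \<in> projective_space" "x \<in> L" "x \<noteq> 0"
  shows "L = vec.span {x}"
proof -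
  obtain a where a: "a \<noteq> 0" "L = vec.span {a}" using assms(1) by (auto simp: projective_space_iff)
  obtain s where s: "x = s *s a" using assms(2) a by (auto simp: vec_span_singleton)
  have "s \<noteq> 0" using s assms(3) by auto
  then have "t *s a \<in> range (\<lambda>s. s *s x)" for t
    by (intro range_eqI[of _ _ "t / s"]) (simp add: s vector_smult_assoc)
  moreover have "t *s x \<in> range (\<lambda>s. s *s a)" for t
    by (intro range_eqI[of _ _ "t * s"]) (simp add: s vector_smult_assoc)
  ultimately show ?thesis unfolding a vec_span_singleton by blast
qed

lemma projective_pointE:
  assumes "L \<in> projective_space"
  obtains x where "x \<in> L" "x \<noteq> 0"
  using assms by (auto simp: projective_space_iff intro: vec.span_base)

text \<open>Two nonzero vectors with vanishing 2 by 2 minors are proportional; this is how equality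
  of points is drawn from polynomial identities.\<close>

lemma span_eq_of_minors:
  fixes x y :: "'a::field ^ 'i::finite"
  assumes "x \<noteq> 0" "y \<noteq> 0" "\<And>j k. x $ j * y $ k = x $ k * y $ j"
  shows "vec.span {x} = vec.span {y}"
proof -
  obtain j where j: "x $ j \<noteq> 0" using assms(1) by (auto simp: vec_eq_iff)
  have "y = (y $ j / x $ j) *s x"
  proof (rule vec_eq_iff[THEN iffD2], rule allI)
    fix k show "y $ k = ((y $ j / x $ j) *s x) $ k"
      using assms(3)[of j k] j by (simp add: field_simps)
  qed
  then have "y \<in> vec.span {x}" by (metis vec_span_singleton rangeI)
  then show ?thesis using span_eqI[OF span_in_projective_space] assms by blast
qed

lemma vanishing_idealI: "(\<And>L x. L \<in> X \<Longrightarrow> x \<in> L \<Longrightarrow> mpoly_eval F x = 0) \<Longrightarrow> F \<in> vanishing_ideal X"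
  by (simp add: vanishing_ideal_def)

lemma vanishing_idealD: "F \<in> vanishing_ideal X \<Longrightarrow> L \<in> X \<Longrightarrow> x \<in> L \<Longrightarrow> mpoly_eval F x = 0"
  by (simp add: vanishing_ideal_def)

lemma vanishing_ideal_add: "F \<in> vanishing_ideal X \<Longrightarrow> G \<in> vanishing_ideal X \<Longrightarrow> F + G \<in> vanishing_ideal X"
  and vanishing_ideal_mult: "F \<in> vanishing_ideal X \<Longrightarrow> G * F \<in> vanishing_ideal X"
  by (auto simp: vanishing_ideal_def mpoly_eval.add mpoly_eval.mult)

lemma scale_in_projective:
  "L \<in> projective_space \<Longrightarrow> x \<in> L \<Longrightarrow> s *s x \<in> L"
  by (auto simp: projective_space_def vec.subspace_scale)

lemma vanishing_ideal_component:
  fixes X :: "('a::alg_closed_field ^ 'i::finite) set set"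
  assumes "X \<subseteq> projective_space" "F \<in> vanishing_ideal X"
  shows "homogeneous_component d F \<in> vanishing_ideal X"
proof (rule vanishing_idealI)
  fix L x assume "L \<in> X" "x \<in> L"
  then have "mpoly_eval F (s *s x) = 0" for s
    using assms scale_in_projective by (blast intro: vanishing_idealD)
  then show "mpoly_eval (homogeneous_component d F) x = 0"
    by (rule homogeneous_component_vanishes[OF infinite_UNIV_alg_closed])
qed

lemma vanishing_set_subset: "vanishing_set I \<subseteq> projective_space"
  by (auto simp: vanishing_set_def)

lemma projective_variety_subset: "projective_variety X \<Longrightarrow> X \<subseteq> projective_space"
  using vanishing_set_subset by (auto simp: projective_variety_def)

lemma span_in_vanishing_set:
  fixes I :: "('i::finite, 'a::field) mpoly set"
  assumes "\<And>F d. F \<in> I \<Longrightarrow> homogeneous_component d F \<in> I" "\<And>F. F \<in> I \<Longrightarrow> mpoly_eval F x = 0" "x \<noteq> 0"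
  shows "vec.span {x} \<in> vanishing_set I"
proof -
  have "mpoly_eval F (s *s x) = 0" if "F \<in> I" for F s
  proof -
    have "mpoly_eval F (s *s x) =
        (\<Sum>d\<le>degree (grade_poly F). mpoly_eval (homogeneous_component d F) (s *s x))"
      by (subst (1) sum_homogeneous_components[of F]) (simp add: mpoly_eval.sum)
    also have "\<dots> = 0"
      using assms(2)[OF assms(1)[OF that]]
      by (intro sum.neutral) (simp add: mpoly_eval_scale[OF homogeneous_component])
    finally show ?thesis .
  qed
  then show ?thesis
    using assms(3) span_in_projective_space by (auto simp: vanishing_set_def vec_span_singleton)
qed

text \<open>The affine theorem could return the zero vector, which is no projective point. As the
  vanishing set is nonempty, some variable lies outside \<open>I\<close>; multiplying
  \<open>G\<close> by it forces the zero that is found to be a nonzero vector.\<close>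

theorem projective_Nullstellensatz:
  fixes I :: "('i::finite, 'a::alg_closed_field) mpoly set"
  assumes I: "homogeneous_prime_ideal I" and "vanishing_set I \<noteq> {}"
  shows "vanishing_ideal (vanishing_set I) = I"
proof
  show "I \<subseteq> vanishing_ideal (vanishing_set I)"
    by (auto simp: vanishing_ideal_def vanishing_set_def)
  interpret prime_ideal I using I by (simp add: homogeneous_prime_ideal_iff)
  show "vanishing_ideal (vanishing_set I) \<subseteq> I"
  proof
    fix G assume G: "G \<in> vanishing_ideal (vanishing_set I)"
    obtain L a where L: "L \<in> vanishing_set I" "a \<in> L" "a \<noteq> 0"
      using assms(2) vanishing_set_subset projective_pointE by blast
    obtain i where i: "a $ i \<noteq> 0" using L by (auto simp: vec_eq_iff)
    have "mvar i \<notin> I" using L i by (auto simp: vanishing_set_def)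
    show "G \<in> I"
    proof (rule ccontr)
      assume "G \<notin> I"
      then have "mvar i * G \<notin> I" using \<open>mvar i \<notin> I\<close> by (simp add: mult_mem_iff)
      then obtain x where x: "mpoly_eval (mvar i * G) x \<noteq> 0" "\<And>H. H \<in> I \<Longrightarrow> mpoly_eval H x = 0"
        using Nullstellensatz_prime prime_ideal_axioms by blast
      then have "x \<noteq> 0" by (auto simp: mpoly_eval.mult)
      then have "vec.span {x} \<in> vanishing_set I"
        using I x(2) by (intro span_in_vanishing_set) (auto simp: homogeneous_prime_ideal_iff)
      then have "mpoly_eval G x = 0" using G by (auto intro: vanishing_idealD vec.span_base)
      then show False using x by (simp add: mpoly_eval.mult)
    qed
  qed
qed

lemma projective_variety_vanishing_ideal:
  fixes Z :: "('a::alg_closed_field ^ 'i::finite) set set"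
  assumes "projective_variety Z" "Z \<noteq> {}"
  shows "homogeneous_prime_ideal (vanishing_ideal Z)" "vanishing_set (vanishing_ideal Z) = Z"
proof -
  obtain I where I: "homogeneous_prime_ideal I" "Z = vanishing_set I"
    using assms(1) by (auto simp: projective_variety_def)
  then have "vanishing_ideal Z = I" using assms(2) projective_Nullstellensatz by blast
  then show "homogeneous_prime_ideal (vanishing_ideal Z)" "vanishing_set (vanishing_ideal Z) = Z"
    using I by simp_all
qed

text \<open>
  Irreducibility, tested only against finite unions of hyperplanes. This weak form is inherited by
  preimages under the Veronese embedding, since the cube of a linear form in three variables is a
  linear form in the cubic monomials.
\<close>

definition linearly_irreducible :: "('a::field ^ 'i::finite) set set \<Rightarrow> bool" where
  "linearly_irreducible Z \<longleftrightarrow> (\<forall>A. finite A \<longrightarrow> (\<forall>l\<in>A. homogeneous 1 l) \<longrightarrow>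
     (\<forall>L\<in>Z. \<forall>x\<in>L. \<exists>l\<in>A. mpoly_eval l x = 0) \<longrightarrow> (\<exists>l\<in>A. l \<in> vanishing_ideal Z))"

lemma projective_variety_linearly_irreducible:
  fixes Z :: "('a::alg_closed_field ^ 'i::finite) set set"
  assumes "projective_variety Z" "Z \<noteq> {}"
  shows "linearly_irreducible Z"
  unfolding linearly_irreducible_def
proof (intro allI impI)
  fix A :: "('i, 'a) mpoly set"
  assume A: "finite A" "\<forall>L\<in>Z. \<forall>x\<in>L. \<exists>l\<in>A. mpoly_eval l x = 0"
  interpret prime_ideal "vanishing_ideal Z"
    using projective_variety_vanishing_ideal[OF assms] by (simp add: homogeneous_prime_ideal_iff)
  have "\<Prod>A \<in> vanishing_ideal Z"
    using A by (intro vanishing_idealI) (simp add: mpoly_eval.prod prod_zero_iff)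
  then show "\<exists>l\<in>A. l \<in> vanishing_ideal Z" using prod_memD[OF A(1)] by auto
qed

text \<open>The ideal of a point is the kernel of restriction to the corresponding line through the
  origin, a morphism into the domain of univariate polynomials, hence prime. The linear forms given
  by the 2 by 2 minors with \<open>a\<close> cut the point out.\<close>

lemma projective_variety_point:
  fixes L :: "('a::alg_closed_field ^ 'i::finite) set"
  assumes "L \<in> projective_space"
  shows "projective_variety {L}"
  unfolding projective_variety_def
proof (intro exI conjI)
  obtain a where a: "a \<in> L" "a \<noteq> 0" by (rule projective_pointE[OF assms])
  have L: "L = vec.span {a}" by (rule span_eqI[OF assms a])
  have mem: "F \<in> vanishing_ideal {L} \<longleftrightarrow> line_poly 0 a F = 0" for F
  proof
    assume "F \<in> vanishing_ideal {L}"
    then have "poly (line_poly 0 a F) s = 0" for s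
      by (auto simp: poly_line_poly vanishing_ideal_def L vec_span_singleton)
    then show "line_poly 0 a F = 0" using poly_exists_nonzero by metis
  next
    assume "line_poly 0 a F = 0"
    then have "mpoly_eval F (s *s a) = 0" for s using poly_line_poly[of 0 a F s] by simp
    then show "F \<in> vanishing_ideal {L}" by (auto simp: vanishing_ideal_def L vec_span_singleton)
  qed
  have "prime_ideal (vanishing_ideal {L})"
    by unfold_locales (auto simp: mem line_poly.add line_poly.mult)
  then show "homogeneous_prime_ideal (vanishing_ideal {L})"
    using assms by (auto simp: homogeneous_prime_ideal_iff intro: vanishing_ideal_component)
  show "{L} = vanishing_set (vanishing_ideal {L})"
  proof
    show "{L} \<subseteq> vanishing_set (vanishing_ideal {L})"
      using assms by (auto simp: vanishing_set_def vanishing_ideal_def)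
    show "vanishing_set (vanishing_ideal {L}) \<subseteq> {L}"
    proof
      fix M assume M: "M \<in> vanishing_set (vanishing_ideal {L})"
      then have MP: "M \<in> projective_space" using vanishing_set_subset by blast
      obtain b where b: "b \<in> M" "b \<noteq> 0" by (rule projective_pointE[OF MP])
      have "a $ j * b $ k = a $ k * b $ j" for j k
      proof -
        have "mconst (a $ j) * mvar k - mconst (a $ k) * mvar j \<in> vanishing_ideal {L}"
          by (rule vanishing_idealI)
            (auto simp: L vec_span_singleton mpoly_eval.diff mpoly_eval.mult mult_ac)
        then have "mpoly_eval (mconst (a $ j) * mvar k - mconst (a $ k) * mvar j) b = 0"
          using M b by (auto simp: vanishing_set_def)
        then show ?thesis by (simp add: mpoly_eval.diff mpoly_eval.mult)
      qed
      then have "vec.span {a} = vec.span {b}" using a b by (intro span_eq_of_minors)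
      then show "M \<in> {L}" using span_eqI[OF MP b] L by simp
    qed
  qed
qed

section \<open>Krull dimension zero and one\<close>

lemma variety_dim_le:
  fixes S :: "('a::field ^ 'i::finite) set set"
  assumes "\<And>n Z. (\<And>i. i \<le> n \<Longrightarrow> projective_variety (Z i)) \<Longrightarrow> (\<And>i. i \<le> n \<Longrightarrow> Z i \<noteq> {}) \<Longrightarrow>
    (\<And>i. i < n \<Longrightarrow> Z i \<subset> Z (Suc i)) \<Longrightarrow> Z n \<subseteq> S \<Longrightarrow> enat n \<le> e"
  shows "variety_dim S \<le> e"
  unfolding variety_dim_def
proof (rule SUP_least, elim CollectE exE conjE)
  fix n and Z :: "nat \<Rightarrow> ('a ^ 'i) set set"
  assume *: "\<forall>i\<le>n. projective_variety (Z i) \<and> Z i \<noteq> {}" "\<forall>i<n. Z i \<subset> Z (Suc i)" "Z n \<subseteq> S"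
  show "enat n \<le> e" by (rule assms[of n Z]) (use * in auto)
qed

text \<open>Used in contraposition: a variety of dimension one has two distinct points.\<close>

lemma variety_dim_0:
  assumes "\<And>L M. L \<in> S \<Longrightarrow> M \<in> S \<Longrightarrow> L = M"
  shows "variety_dim S = 0"
proof -
  have "variety_dim S \<le> 0"
  proof (rule variety_dim_le, rule ccontr)
    fix n Z
    assume Z: "\<And>i. i \<le> n \<Longrightarrow> Z i \<noteq> {}" "\<And>i. i < n \<Longrightarrow> Z i \<subset> Z (Suc i)" "Z n \<subseteq> S"
      and pos: "\<not> enat n \<le> 0"
    from pos obtain m where m: "n = Suc m" by (cases n) (auto simp: zero_enat_def)
    obtain L where "L \<in> Z m" using Z(1)[of m] m by auto
    moreover obtain M where "M \<in> Z n" "M \<notin> Z m" using Z(2)[of m] m by blast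
    ultimately show False using Z(2)[of m] Z(3) assms[of L M] m by blast
  qed
  then show ?thesis by simp
qed

text \<open>A point inside \<open>S\<close> gives a chain of length one. In a chain of length two
  the middle member would be a proper subvariety with two points.\<close>

lemma variety_dim_1:
  fixes S :: "('a::alg_closed_field ^ 'i::finite) set set"
  assumes S: "projective_variety S" and LM: "L \<in> S" "M \<in> S" "L \<noteq> M"
    and sub: "\<And>Z L M. projective_variety Z \<Longrightarrow> Z \<subset> S \<Longrightarrow> L \<in> Z \<Longrightarrow> M \<in> Z \<Longrightarrow> L = M"
  shows "variety_dim S = 1"
proof (rule antisym)
  show "variety_dim S \<le> 1"
  proof (rule variety_dim_le, rule ccontr)
    fix n Z
    assume Z: "\<And>i. i \<le> n \<Longrightarrow> projective_variety (Z i)" "\<And>i. i \<le> n \<Longrightarrow> Z i \<noteq> {}"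
      "\<And>i. i < n \<Longrightarrow> Z i \<subset> Z (Suc i)" "Z n \<subseteq> S" and big: "\<not> enat n \<le> 1"
    from big have "n > 1" by (simp add: one_enat_def)
    then obtain m where m: "n = Suc (Suc m)"
      by (cases n rule: nat.exhaust; cases "n - 1") auto
    have step: "Z m \<subset> Z (Suc m)" "Z (Suc m) \<subset> Z n" using Z(3)[of m] Z(3)[of "Suc m"] m by simp_all
    obtain L where L: "L \<in> Z m" using Z(2)[of m] m by auto
    obtain M where M: "M \<in> Z (Suc m)" "M \<notin> Z m" using step by blast
    have "Z (Suc m) \<subset> S" using step Z(4) by blast
    moreover have "projective_variety (Z (Suc m))" using Z(1)[of "Suc m"] m by auto
    moreover have "L \<in> Z (Suc m)" using step L by blast
    ultimately have "L = M" using sub M(1) by blast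
    then show False using L M by simp
  qed
  define Y where "Y i = (if i = (0 :: nat) then {L} else S)" for i
  have "projective_variety (Y i)" "Y i \<noteq> {}" for i
    using S LM projective_variety_subset[OF S] by (auto simp: Y_def intro: projective_variety_point)
  moreover have "Y i \<subset> Y (Suc i)" if "i < 1" for i
    using that LM by (auto simp: Y_def)
  moreover have "Y 1 \<subseteq> S" by (simp add: Y_def)
  ultimately have "enat 1 \<le> variety_dim S"
    unfolding variety_dim_def by (intro SUP_upper CollectI exI[of _ Y]) blast
  then show "1 \<le> variety_dim S" by (simp add: one_enat_def)
qed

section \<open>Plane curves\<close>

lemma mdeg_eq_0_iff [simp]: "mdeg m = 0 \<longleftrightarrow> m = 0"
  by (auto simp: mdeg_def intro!: poly_mapping_eqI)

lemma homogeneous_0_mconst: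
  assumes "homogeneous 0 F"
  obtains c where "F = mconst c"
proof
  show "F = mconst (Poly_Mapping.lookup F 0)"
    using assms by (intro poly_mapping_eqI)
      (auto simp: mconst_def lookup_single when_def homogeneous_iff)
qed

text \<open>Graded, \<open>F\<close> becomes a single monomial in \<open>t\<close>, so only the
  component of degree \<open>e - d\<close> of the cofactor contributes to \<open>G\<close>.\<close>

lemma homogeneous_dvd:
  assumes "homogeneous d F" "homogeneous e G" "F dvd G" "G \<noteq> 0"
  obtains A where "homogeneous (e - d) A" "G = F * A" "d \<le> e"
proof -
  obtain B where B: "G = F * B" using assms(3) by blast
  have "G = homogeneous_component e (F * B)"
    using homogeneous_component_same[OF assms(2)] B by simp
  also have "\<dots> = coeff (monom F d * grade_poly B) e"
    using assms(1) by (simp add: grade_poly_homogeneous grade_poly.mult flip: coeff_grade_poly)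
  finally have G: "G = (if e < d then 0 else F * homogeneous_component (e - d) B)"
    by (simp add: coeff_monom_mult coeff_grade_poly)
  show ?thesis
    by (rule that[of "homogeneous_component (e - d) B"])
      (use G assms(4) in \<open>auto split: if_splits intro: homogeneous_component\<close>)
qed

lemma mvar_neq_0: "mvar i \<noteq> (0 :: ('i::finite, 'a::comm_ring_1) mpoly)"
proof
  assume "mvar i = (0 :: ('i, 'a) mpoly)"
  then have "mpoly_eval (mvar i) (axis i (1 :: 'a)) = mpoly_eval 0 (axis i 1)" by simp
  then show False by simp
qed

text \<open>The cofactor of a factor of positive degree in a nonzero linear form is constant, so
  both forms are multiples of \<open>F\<close> by constants.\<close>

lemma linear_forms_dvd:
  fixes F :: "('i::finite, 'a::field) mpoly"
  assumes "homogeneous d F" "d > 0" "homogeneous 1 k" "homogeneous 1 l" "F dvd k" "F dvd l" "k \<noteq> 0"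
  obtains c where "l = mconst c * k"
proof -
  have *: "\<exists>a. h = mconst a * F" if h: "homogeneous 1 h" "F dvd h" for h
  proof (cases "h = 0")
    case True
    then show ?thesis by (intro exI[of _ 0]) (simp add: mconst_def)
  next
    case False
    then obtain A where A: "homogeneous (1 - d) A" "h = F * A"
      using homogeneous_dvd[OF assms(1) h] by metis
    moreover have "1 - d = 0" using assms(2) by simp
    ultimately obtain a where "A = mconst a" by (metis homogeneous_0_mconst)
    then show ?thesis using A by (auto simp: mult.commute)
  qed
  obtain a b where ab: "k = mconst a * F" "l = mconst b * F" using * assms by metis
  have "a \<noteq> 0" using ab assms(7) by (auto simp: mconst_def)
  then have "l = mconst (b / a) * k"
    by (simp add: ab mconst_def mult_single flip: mult.assoc)
  then show ?thesis using that by blast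
qed

lemma prime_elem_prime_ideal: "prime_elem F \<Longrightarrow> prime_ideal {G. F dvd G}"
  by unfold_locales (auto simp: prime_elem_def)

lemma dvd_homogeneous_component:
  assumes "homogeneous e F" "F dvd G"
  shows "F dvd homogeneous_component d G"
proof -
  obtain B where B: "G = F * B" using assms(2) by blast
  have "homogeneous_component d G = coeff (monom F e * grade_poly B) d"
    using assms(1) B by (simp add: grade_poly_homogeneous grade_poly.mult flip: coeff_grade_poly)
  then show ?thesis by (simp add: coeff_monom_mult)
qed

lemma mpoly_exists_nonzero:
  fixes F :: "('i::{finite, linorder}, 'a::alg_closed_field) mpoly"
  assumes "F \<noteq> 0"
  obtains x where "mpoly_eval F x \<noteq> 0"
proof -
  have "prime_ideal {0 :: ('i, 'a) mpoly}" by unfold_locales auto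
  then show ?thesis using Nullstellensatz_prime[of "{0}" F] assms that by auto
qed

lemma other_indices_3:
  fixes i :: 3
  obtains j k where "i \<noteq> j" "i \<noteq> k" "j \<noteq> k" "UNIV = {i, j, k}"
proof -
  have "i = 1 \<or> i = 2 \<or> i = 3" by (rule exhaust_3)
  then show ?thesis
    using that[of 2 3] that[of 1 3] that[of 1 2] UNIV_3 by (auto simp: insert_commute)
qed

section \<open>Points, elimination and subvarieties on a plane curve\<close>

locale plane_curve =
  fixes F :: "(3, 'a::alg_closed_field) mpoly" and d :: nat
  assumes prime: "prime_elem F" and hom: "homogeneous d F" and pos: "d > 0"
begin

definition curve :: "('a ^ 3) set set" where
  "curve = vanishing_set {G. F dvd G}"

lemma homogeneous_prime_ideal: "homogeneous_prime_ideal {G. F dvd G}"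
  using prime hom by (auto simp: homogeneous_prime_ideal_iff prime_elem_prime_ideal
    intro: dvd_homogeneous_component)

lemma projective_variety_curve: "projective_variety curve"
  using homogeneous_prime_ideal by (auto simp: projective_variety_def curve_def)

lemma mem_curve_iff: "L \<in> curve \<longleftrightarrow> L \<in> projective_space \<and> (\<forall>x\<in>L. mpoly_eval F x = 0)"
  by (auto simp: curve_def vanishing_set_def mpoly_eval.mult elim!: dvdE)

lemma span_mem_curve: "x \<noteq> 0 \<Longrightarrow> mpoly_eval F x = 0 \<Longrightarrow> vec.span {x} \<in> curve"
  using hom span_in_projective_space
  by (auto simp: mem_curve_iff vec_span_singleton mpoly_eval_scale)

text \<open>If all zeros of \<open>F\<close> lay on the line of \<open>a\<close>, every linear form
  vanishing at \<open>a\<close> would be divisible by \<open>F\<close> by the Nullstellensatz. In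
  three variables there are two independent such forms, but a common factor of positive degree makes
  them proportional.\<close>

lemma not_in_line: "\<exists>x. mpoly_eval F x = 0 \<and> x \<notin> vec.span {a}" if "a \<noteq> 0"
proof (rule ccontr)
  assume "\<nexists>x. mpoly_eval F x = 0 \<and> x \<notin> vec.span {a}"
  then have sub: "x \<in> vec.span {a}" if "mpoly_eval F x = 0" for x using that by blast
  obtain i where i: "a $ i \<noteq> 0" using \<open>a \<noteq> 0\<close> by (auto simp: vec_eq_iff)
  define l where "l j = mconst (a $ i) * mvar j - mconst (a $ j) * mvar i" for j
  have hl: "homogeneous 1 (l j)" for j
    unfolding l_def
    using homogeneous_mult[OF homogeneous_mconst homogeneous_mvar] by (intro homogeneous_diff) auto
  have dvd: "F dvd l j" for j
  proof (rule ccontr)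
    assume "\<not> F dvd l j"
    then obtain x where x: "mpoly_eval (l j) x \<noteq> 0" "\<And>H. F dvd H \<Longrightarrow> mpoly_eval H x = 0"
      using Nullstellensatz_prime[OF prime_elem_prime_ideal[OF prime], of "l j"] by auto
    then show False
      using sub[of x] by (auto simp: l_def vec_span_singleton mpoly_eval.diff mpoly_eval.mult)
  qed
  obtain j k where jk: "i \<noteq> j" "i \<noteq> k" "j \<noteq> k" by (rule other_indices_3[of i])
  have ev: "mpoly_eval (l m) (axis n 1) = a $ i * (if m = n then 1 else 0) - a $ m * (if i = n then 1 else 0)"
    for m n
    by (simp add: l_def mpoly_eval.diff mpoly_eval.mult axis_def)
  have "l j \<noteq> 0" using ev[of j j] jk i by auto
  then obtain c where "l k = mconst c * l j"
    using linear_forms_dvd[OF hom pos hl hl dvd dvd] by blast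
  then have "mpoly_eval (l k) (axis k 1) = c * mpoly_eval (l j) (axis k 1)"
    by (simp add: mpoly_eval.mult)
  then show False using jk i by (simp add: ev)
qed

lemma two_points: obtains L M where "L \<in> curve" "M \<in> curve" "L \<noteq> M"
proof -
  \<comment> \<open>The starting vector is arbitrary and need not lie on the curve; it only serves
    to produce a nonzero zero of \<open>F\<close>.\<close>
  have "(axis 1 1 :: 'a ^ 3) \<noteq> 0" by (simp add: axis_eq_0_iff)
  then obtain x where x: "mpoly_eval F x = 0" "x \<notin> vec.span {axis 1 1}"
    using not_in_line by blast
  have "x \<noteq> 0" using x(2) vec.span_zero by auto
  then obtain y where y: "mpoly_eval F y = 0" "y \<notin> vec.span {x}" using not_in_line by blast
  have "y \<noteq> 0" using y(2) vec.span_zero by auto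
  have "vec.span {x} \<noteq> vec.span {y}" using y(2) vec.span_base[of y "{y}"] by auto
  then show ?thesis using that span_mem_curve \<open>x \<noteq> 0\<close> \<open>y \<noteq> 0\<close> x y by blast
qed

lemma vanishing_ideal_curve: "vanishing_ideal curve = {G. F dvd G}"
  unfolding curve_def
  using two_points by (intro projective_Nullstellensatz homogeneous_prime_ideal) (auto simp: curve_def)

text \<open>Geometrically, the common zeros of \<open>F\<close> and \<open>G\<close> are projected
  away from a coordinate point. The prime ideal is the one generated by \<open>F\<close>, and the
  relation that makes the variable \<open>i\<close> algebraic modulo it is \<open>F\<close>
  itself.\<close>

lemma eliminate_variable:
  assumes G: "\<not> F dvd G" and ij: "i \<notin> B" "UNIV = insert i B"
  obtains H where "H \<noteq> 0" "H \<in> mpolys_in B" "\<And>Z. Z \<subseteq> curve \<Longrightarrow> G \<in> vanishing_ideal Z \<Longrightarrow> H \<in> vanishing_ideal Z"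
proof -
  interpret elimination "{G. F dvd G}" "mpolys_in B" "mvar i"
    using prime_elem_prime_ideal[OF prime]
    by (simp add: elimination_def elimination_axioms_def mpolys_in_add mpolys_in_mult mpolys_in_uminus)
  have van: "H \<in> vanishing_ideal Z" if "F dvd H" "Z \<subseteq> curve" for H Z
    using that by (intro vanishing_idealI) (auto simp: mem_curve_iff mpoly_eval.mult elim!: dvdE)
  have repr: "\<exists>p\<in>polys. H = poly p (mvar i)" for H
  proof -
    have "H \<in> mpolys_in (insert i B)" using ij(2) by (metis mpolys_in_UNIV)
    then obtain p where "\<And>n. coeff p n \<in> mpolys_in B" "H = poly p (mvar i)"
      by (rule mpolys_in_insert[OF _ ij(1)]) blast
    then show ?thesis by (auto simp: polys_def)
  qed
  obtain p where p: "p \<in> polys" "F = poly p (mvar i)" using repr by blast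
  show ?thesis
  proof (cases "\<exists>n. \<not> F dvd coeff p n")
    \<comment> \<open>If \<open>F\<close> divides all its coefficients with respect to the variable
      \<open>i\<close>, its leading coefficient is already a nonzero multiple of \<open>F\<close>
      free of that variable.\<close>
    case False
    have "p \<noteq> 0" using p prime by (auto simp: prime_elem_def)
    then have "lead_coeff p \<noteq> 0" by simp
    then show ?thesis using that[OF _ polys_coeff[OF p(1)] van] False by blast
  next
    case True
    then obtain n where n: "coeff p n \<notin> {G. F dvd G}" by auto
    have pJ: "poly p (mvar i) \<in> {G. F dvd G}" using p by simp
    obtain g where g: "g \<in> polys" "G = poly g (mvar i)" using repr by blast
    from minimal_poly[OF p(1) pJ n] obtain P where P: "P \<in> polys" "poly P (mvar i) \<in> {G. F dvd G}"
      "lead_coeff P \<notin> {G. F dvd G}" "degree P > 0"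
      and min: "\<And>q m. q \<in> polys \<Longrightarrow> poly q (mvar i) \<in> {G. F dvd G} \<Longrightarrow> degree q < degree P \<Longrightarrow>
         coeff q m \<in> {G. F dvd G}" by blast
    have "poly g (mvar i) \<notin> {G. F dvd G}" using G g by simp
    from eliminate[OF P min g(1) this] obtain c a where c: "c \<in> mpolys_in B" "c \<notin> {G. F dvd G}"
      and ca: "c - poly a (mvar i) * G \<in> {G. F dvd G}" unfolding g(2) by blast
    show ?thesis
    proof (rule that[OF _ c(1)])
      show "c \<noteq> 0" using c(2) by auto
      fix Z assume "Z \<subseteq> curve" "G \<in> vanishing_ideal Z"
      moreover from this have "c - poly a (mvar i) * G \<in> vanishing_ideal Z"
        using ca by (intro van) auto
      ultimately have "(c - poly a (mvar i) * G) + poly a (mvar i) * G \<in> vanishing_ideal Z"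
        by (intro vanishing_ideal_add vanishing_ideal_mult)
      then show "c \<in> vanishing_ideal Z" by simp
    qed
  qed
qed

end

text \<open>A form in two variables vanishes only on finitely many lines, given by the roots of its
  dehomogenisation. On each line the ratio of the coordinates \<open>j\<close> and \<open>k\<close>
  is fixed, which is what the last property records.\<close>

lemma binary_form_zeros:
  fixes H :: "(3, 'a::alg_closed_field) mpoly"
  assumes jk: "j \<noteq> k" and H: "H \<in> mpolys_in {j, k}" "homogeneous e H" "H \<noteq> 0"
  obtains A where "finite A" "\<And>l. l \<in> A \<Longrightarrow> homogeneous 1 l"
    "\<And>x. mpoly_eval H x = 0 \<Longrightarrow> \<exists>l\<in>A. mpoly_eval l x = 0"
    "\<And>l x y. l \<in> A \<Longrightarrow> mpoly_eval l x = 0 \<Longrightarrow> mpoly_eval l y = 0 \<Longrightarrow> x $ j * y $ k = x $ k * y $ j"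
proof -
  define h where "h = line_poly (axis j 1) (axis k 1) H"
  have *: "mpoly_eval H x = x $ j ^ e * poly h (x $ k / x $ j)" if "x $ j \<noteq> 0" for x
  proof -
    have "mpoly_eval H x = mpoly_eval H (x $ j *s (axis j 1 + (x $ k / x $ j) *s axis k 1))"
      using that jk by (intro mpoly_eval_cong[OF H(1)]) (auto simp: axis_def)
    then show ?thesis by (simp add: mpoly_eval_scale[OF H(2)] h_def poly_line_poly)
  qed
  \<comment> \<open>The extra factor provides a point with \<open>x $ j\<close> and the value of
    \<open>H\<close> both nonzero, so that the dehomogenisation \<open>h\<close> is not the zero
    polynomial.\<close>
  have "mvar j * H \<noteq> 0" using H(3) by (simp add: mvar_neq_0)
  then obtain x where "mpoly_eval (mvar j * H) x \<noteq> 0" by (rule mpoly_exists_nonzero)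
  then have "h \<noteq> 0" using *[of x] by (auto simp: mpoly_eval.mult)
  \<comment> \<open>The line \<open>x_j = 0\<close> is invisible to \<open>h\<close> and is added in
    any case.\<close>
  define A where "A = insert (mvar j) ((\<lambda>t. mvar k - mconst t * mvar j) ` {t. poly h t = 0})"
  show ?thesis
  proof (rule that[of A])
    show "finite A" using poly_roots_finite[OF \<open>h \<noteq> 0\<close>] by (simp add: A_def)
    show "homogeneous 1 l" if "l \<in> A" for l
      using that homogeneous_mult[OF homogeneous_mconst homogeneous_mvar]
      by (auto simp: A_def intro!: homogeneous_diff homogeneous_mvar[simplified])
    show "\<exists>l\<in>A. mpoly_eval l x = 0" if x: "mpoly_eval H x = 0" for x
    proof (cases "x $ j = 0")
      case True
      then show ?thesis by (auto simp: A_def)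
    next
      case False
      then have "poly h (x $ k / x $ j) = 0" using * x by simp
      then show ?thesis using False by (auto simp: A_def mpoly_eval.diff mpoly_eval.mult intro!: exI[of _ "x $ k / x $ j"])
    qed
    show "x $ j * y $ k = x $ k * y $ j" if "l \<in> A" "mpoly_eval l x = 0" "mpoly_eval l y = 0" for l x y
      using that by (auto simp: A_def mpoly_eval.diff mpoly_eval.mult)
  qed
qed

context plane_curve
begin

text \<open>For each pair \<open>j\<close>, \<open>k\<close>, eliminating the third variable gives a
  form in two variables vanishing on \<open>Z\<close>. Its zeros lie on finitely many lines, so
  \<open>Z\<close> lies on one of them, and the minor with indices \<open>j\<close>,
  \<open>k\<close> of any two points vanishes. All minors together identify the points.\<close>

lemma linearly_irreducible_subset:
  assumes Z: "Z \<subseteq> curve" "linearly_irreducible Z" and G: "G \<in> vanishing_ideal Z" "\<not> F dvd G"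
    and LM: "L \<in> Z" "M \<in> Z"
  shows "L = M"
proof -
  have PS: "Z \<subseteq> projective_space" using Z by (auto simp: mem_curve_iff)
  obtain x where x: "x \<in> L" "x \<noteq> 0" using LM PS by (meson projective_pointE subsetD)
  obtain y where y: "y \<in> M" "y \<noteq> 0" using LM PS by (meson projective_pointE subsetD)
  have minor: "x $ j * y $ k = x $ k * y $ j" if jk: "j \<noteq> k" for j k
  proof -
    obtain i where i: "i \<notin> {j, k}" "UNIV = {i, j, k}"
      using jk exhaust_3[of j] exhaust_3[of k] UNIV_3 that[of 1] that[of 2] that[of 3]
      by (elim disjE) (auto simp: insert_commute)
    obtain H0 where H0: "H0 \<noteq> 0" "H0 \<in> mpolys_in {j, k}" "H0 \<in> vanishing_ideal Z"
      using eliminate_variable[OF G(2) i] Z(1) G(1) by metis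
    then obtain e where e: "homogeneous_component e H0 \<noteq> 0"
      using sum_homogeneous_components[of H0] by (metis (no_types, lifting) sum.neutral)
    let ?H = "homogeneous_component e H0"
    have "?H \<in> mpolys_in {j, k}"
      using H0(2) by (auto simp: mpolys_in_def in_keys_iff lookup_homogeneous_component)
    then obtain A where A: "finite A" "\<And>l. l \<in> A \<Longrightarrow> homogeneous 1 l"
      "\<And>x. mpoly_eval ?H x = 0 \<Longrightarrow> \<exists>l\<in>A. mpoly_eval l x = 0"
      "\<And>l x y. l \<in> A \<Longrightarrow> mpoly_eval l x = 0 \<Longrightarrow> mpoly_eval l y = 0 \<Longrightarrow> x $ j * y $ k = x $ k * y $ j"
      using binary_form_zeros[OF jk _ homogeneous_component e] by metis
    have "?H \<in> vanishing_ideal Z" by (rule vanishing_ideal_component[OF PS H0(3)])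
    then have "\<forall>L\<in>Z. \<forall>x\<in>L. \<exists>l\<in>A. mpoly_eval l x = 0" using A(3) vanishing_idealD by blast
    then obtain l where "l \<in> A" "l \<in> vanishing_ideal Z"
      using Z(2) A(1,2) unfolding linearly_irreducible_def by blast
    then show ?thesis using A(4) LM x y vanishing_idealD by blast
  qed
  have "x $ j * y $ k = x $ k * y $ j" for j k by (cases "j = k") (auto intro: minor)
  then have "vec.span {x} = vec.span {y}" using x y by (intro span_eq_of_minors)
  then show ?thesis using span_eqI PS LM x y by blast
qed

lemma proper_subvariety:
  assumes Z: "projective_variety Z" "Z \<subset> curve" "L \<in> Z" "M \<in> Z"
  shows "L = M"
proof -
  have ne: "Z \<noteq> {}" using Z by auto
  have "\<exists>G\<in>vanishing_ideal Z. \<not> F dvd G"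
  proof (rule ccontr)
    assume "\<not> ?thesis"
    then have "curve \<subseteq> vanishing_set (vanishing_ideal Z)"
      unfolding curve_def vanishing_set_def by blast
    then show False using Z projective_variety_vanishing_ideal(2)[OF Z(1) ne] by auto
  qed
  then show ?thesis
    using linearly_irreducible_subset Z projective_variety_linearly_irreducible[OF Z(1) ne] by blast
qed

lemma variety_dim_curve: "variety_dim curve = 1"
  using two_points proper_subvariety
  by (metis variety_dim_1[OF projective_variety_curve])

end

section \<open>Hilbert polynomials of plane curves\<close>

text \<open>The first two exponents determine the third. The count is doubled to avoid division of
  natural numbers.\<close>

lemma two_card_monomials: "finite {m :: 3 \<Rightarrow>\<^sub>0 nat. mdeg m = n}"
  "2 * card {m :: 3 \<Rightarrow>\<^sub>0 nat. mdeg m = n} = (n + 1) * (n + 2)"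
proof -
  let ?f = "\<lambda>(a, b). Poly_Mapping.single (1 :: 3) a + Poly_Mapping.single 2 b +
    Poly_Mapping.single 3 (n - a - b :: nat)"
  have bij: "bij_betw ?f (SIGMA a:{..n}. {..n - a}) {m. mdeg m = n}"
  proof (rule bij_betwI[where g = "\<lambda>m. (Poly_Mapping.lookup m 1, Poly_Mapping.lookup m 2)"])
    show "?f \<in> (SIGMA a:{..n}. {..n - a}) \<rightarrow> {m. mdeg m = n}"
      by (auto simp: mdeg_add)
    show "(\<lambda>m. (Poly_Mapping.lookup m 1, Poly_Mapping.lookup m 2)) \<in>
        {m :: 3 \<Rightarrow>\<^sub>0 nat. mdeg m = n} \<rightarrow> (SIGMA a:{..n}. {..n - a})"
      by (auto simp: mdeg_def sum_3)
    show "(Poly_Mapping.lookup (?f x) 1, Poly_Mapping.lookup (?f x) 2) = x"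
      if "x \<in> (SIGMA a:{..n}. {..n - a})" for x
      by (cases x) (simp add: lookup_add lookup_single when_def)
    show "?f (Poly_Mapping.lookup m 1, Poly_Mapping.lookup m 2) = m" if "m \<in> {m. mdeg m = n}" for m
    proof (rule poly_mapping_eqI)
      fix i :: 3
      show "Poly_Mapping.lookup (?f (Poly_Mapping.lookup m 1, Poly_Mapping.lookup m 2)) i =
        Poly_Mapping.lookup m i"
        using that exhaust_3[of i] by (auto simp: lookup_add lookup_single when_def mdeg_def sum_3)
    qed
  qed
  show "finite {m :: 3 \<Rightarrow>\<^sub>0 nat. mdeg m = n}"
    using bij_betw_finite[OF bij] by auto
  have "card {m :: 3 \<Rightarrow>\<^sub>0 nat. mdeg m = n} = (\<Sum>a\<le>n. n - a + 1)"
    using bij_betw_same_card[OF bij] by simp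
  also have "\<dots> = (\<Sum>a\<le>n. a + 1)"
    by (rule sum.reindex_bij_witness[of _ "\<lambda>a. n - a" "\<lambda>a. n - a"]) auto
  finally have c: "card {m :: 3 \<Rightarrow>\<^sub>0 nat. mdeg m = n} = (\<Sum>a\<le>n. a + 1)" .
  have "2 * (\<Sum>a\<le>n. a + 1) = (n + 1) * (n + 2)" by (induction n) auto
  then show "2 * card {m :: 3 \<Rightarrow>\<^sub>0 nat. mdeg m = n} = (n + 1) * (n + 2)" by (simp add: c)
qed

text \<open>Multiplication by a nonzero polynomial is injective and maps the basis of monomials to a
  basis. \<open>H = 1\<close> counts all forms; the equation of a curve counts those in its
  ideal.\<close>

lemma dim_mult_homogeneous:
  fixes H :: "(3, 'a::field) mpoly"
  assumes "H \<noteq> 0"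
  shows "mpoly.dim ((*) H ` {G. homogeneous n G}) = card {m :: 3 \<Rightarrow>\<^sub>0 nat. mdeg m = n}"
proof (rule mpoly.dim_unique)
  let ?M = "{m :: 3 \<Rightarrow>\<^sub>0 nat. mdeg m = n}"
  let ?b = "\<lambda>m. H * Poly_Mapping.single m (1 :: 'a)"
  have fin: "finite ?M" by (rule two_card_monomials)
  have inj: "inj_on ?b ?M"
  proof (rule inj_onI)
    fix m m' assume "?b m = ?b m'"
    then have "Poly_Mapping.single m (1 :: 'a) = Poly_Mapping.single m' 1" using assms by simp
    then show "m = m'" by (metis keys_single one_neq_zero singleton_inject)
  qed
  have comb: "(\<Sum>m\<in>?M. mpoly_scale (g m) (?b m)) = H * (\<Sum>m\<in>?M. Poly_Mapping.single m (g m))" for g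
    by (simp add: mpoly_scale_def sum_distrib_left mult_single mult.left_commute)
  show "?b ` ?M \<subseteq> (*) H ` {G. homogeneous n G}"
    by (auto intro: homogeneous_single)
  show "(*) H ` {G. homogeneous n G} \<subseteq> mpoly.span (?b ` ?M)"
  proof safe
    fix G :: "(3, 'a) mpoly" assume "homogeneous n G"
    then have "Poly_Mapping.keys G \<subseteq> ?M" by (auto simp: homogeneous_def)
    then have "G = (\<Sum>m\<in>?M. Poly_Mapping.single m (Poly_Mapping.lookup G m))"
      using fin by (subst mpoly_sum_monomials) (auto intro!: sum.mono_neutral_left simp: in_keys_iff)
    then have "H * G = (\<Sum>m\<in>?M. mpoly_scale (Poly_Mapping.lookup G m) (?b m))"
      using comb by metis
    also have "\<dots> \<in> mpoly.span (?b ` ?M)"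
      by (intro mpoly.span_sum mpoly.span_scale mpoly.span_base) auto
    finally show "H * G \<in> mpoly.span (?b ` ?M)" .
  qed
  show "mpoly.independent (?b ` ?M)"
  proof (rule mpoly.independent_if_scalars_zero)
    show "finite (?b ` ?M)" using fin by simp
    fix f x assume "(\<Sum>x\<in>?b ` ?M. mpoly_scale (f x) x) = 0" and x: "x \<in> ?b ` ?M"
    then have "H * (\<Sum>m\<in>?M. Poly_Mapping.single m (f (?b m))) = 0"
      using comb[of "\<lambda>m. f (?b m)"] inj by (simp add: sum.reindex)
    then have *: "(\<Sum>m\<in>?M. Poly_Mapping.single m (f (?b m))) = 0" using assms by simp
    obtain m where m: "m \<in> ?M" "x = ?b m" using x by auto
    have "Poly_Mapping.lookup (\<Sum>m\<in>?M. Poly_Mapping.single m (f (?b m))) m = f x"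
      using m fin by (simp add: lookup_sum lookup_single when_def sum.delta)
    then show "f x = 0" using * by simp
  qed
  show "card (?b ` ?M) = card ?M" using inj by (rule card_image)
qed

lemma dim_homogeneous:
  "mpoly.dim {G :: (3, 'a::field) mpoly. homogeneous n G} = card {m :: 3 \<Rightarrow>\<^sub>0 nat. mdeg m = n}"
  using dim_mult_homogeneous[of "1 :: (3, 'a) mpoly" n] by simp

lemma hilbert_polynomial_eqI:
  assumes "\<And>n. n \<ge> N \<Longrightarrow> poly P (of_nat n) = of_nat (hilbert_function X n)"
  shows "hilbert_polynomial X = P"
  unfolding hilbert_polynomial_def
proof (rule the_equality)
  show "\<forall>\<^sub>F d in sequentially. poly P (of_nat d) = of_nat (hilbert_function X d)"
    using assms by (auto simp: eventually_sequentially)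
  fix Q :: "rat poly"
  assume "\<forall>\<^sub>F d in sequentially. poly Q (of_nat d) = of_nat (hilbert_function X d)"
  then obtain M where M: "\<And>n. n \<ge> M \<Longrightarrow> poly Q (of_nat n) = of_nat (hilbert_function X n)"
    by (auto simp: eventually_sequentially)
  show "Q = P"
  proof (rule ccontr)
    assume "Q \<noteq> P"
    then have "finite {x. poly (Q - P) x = 0}" by (intro poly_roots_finite) simp
    moreover have "of_nat ` {max M N..} \<subseteq> {x. poly (Q - P) x = 0}" using M assms by auto
    ultimately have "finite ((of_nat :: nat \<Rightarrow> rat) ` {max M N..})" by (rule finite_subset[rotated])
    then have "finite {max M N..}" by (rule finite_imageD) (auto intro: inj_onI)
    then show False using infinite_Ici[of "max M N"] by blast
  qed
qed

text \<open>For the whole plane the Hilbert polynomial is \<open>(n + 1) (n + 2) / 2\<close>, with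
  constant term 1. An elliptic curve therefore satisfies some nontrivial equation.\<close>

lemma curve_genus_0:
  assumes "vanishing_ideal X = {0}"
  shows "curve_genus X = 0"
proof -
  have "mpoly.dim {F \<in> vanishing_ideal X. homogeneous n F} = 0" for n
  proof -
    have "{F \<in> vanishing_ideal X. homogeneous n F} = {0}" using assms by auto
    then show ?thesis using mpoly.dim_unique[of "{}" "{0}" 0] by (simp add: mpoly.independent_empty)
  qed
  then have h: "hilbert_function X n = card {m :: 3 \<Rightarrow>\<^sub>0 nat. mdeg m = n}" for n
    by (simp add: hilbert_function_def dim_homogeneous)
  have "hilbert_polynomial X = [:1, 3 / 2, 1 / 2:]"
  proof (rule hilbert_polynomial_eqI)
    fix n
    have "(of_nat (2 * hilbert_function X n) :: rat) = of_nat ((n + 1) * (n + 2))"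
      unfolding h two_card_monomials(2) ..
    then show "poly [:1, 3 / 2, 1 / 2:] (of_nat n) = (of_nat (hilbert_function X n) :: rat)"
      by (simp add: field_simps)
  qed
  then show ?thesis by (simp add: curve_genus_def)
qed

context plane_curve
begin

text \<open>The part of degree \<open>n\<close> of the ideal is \<open>F\<close> times the forms of
  degree \<open>n - d\<close>. The difference of the two monomial counts is
  \<open>d n + (3 d - d^2) / 2\<close>, and the genus is \<open>(d - 1) (d - 2) / 2\<close> in
  expanded form.\<close>

lemma curve_genus: "curve_genus curve = 1 - (3 * of_nat d - of_nat d ^ 2) / 2"
proof -
  have h: "hilbert_function curve n =
      card {m :: 3 \<Rightarrow>\<^sub>0 nat. mdeg m = n} - card {m :: 3 \<Rightarrow>\<^sub>0 nat. mdeg m = n - d}" if "n \<ge> d" for n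
  proof -
    have "{G \<in> vanishing_ideal curve. homogeneous n G} = (*) F ` {G. homogeneous (n - d) G}"
    proof safe
      fix G assume G: "G \<in> vanishing_ideal curve" "homogeneous n G"
      show "G \<in> (*) F ` {G. homogeneous (n - d) G}"
      proof (cases "G = 0")
        case True
        then show ?thesis by (intro image_eqI[of _ _ 0]) auto
      next
        case False
        then show ?thesis
          using homogeneous_dvd[OF hom G(2)] G(1) vanishing_ideal_curve by blast
      qed
    next
      fix G :: "(3, 'a) mpoly" assume "homogeneous (n - d) G"
      then show "homogeneous n (F * G)" using homogeneous_mult[OF hom] that by fastforce
    qed (simp add: vanishing_ideal_curve)
    moreover have "F \<noteq> 0" using prime by auto
    ultimately show ?thesis
      by (simp add: hilbert_function_def dim_homogeneous dim_mult_homogeneous)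
  qed
  have "hilbert_polynomial curve = [:(3 * of_nat d - of_nat d ^ 2) / 2, of_nat d:]"
  proof (rule hilbert_polynomial_eqI)
    fix n assume n: "d \<le> n"
    define a b where "a = card {m :: 3 \<Rightarrow>\<^sub>0 nat. mdeg m = n}"
      and "b = card {m :: 3 \<Rightarrow>\<^sub>0 nat. mdeg m = n - d}"
    have ab: "2 * a = (n + 1) * (n + 2)" "2 * b = (n - d + 1) * (n - d + 2)"
      unfolding a_def b_def by (rule two_card_monomials)+
    \<comment> \<open>Ensures that the subtraction of natural numbers in the Hilbert function does
      not truncate.\<close>
    have "(n - d + 1) * (n - d + 2) \<le> (n + 1) * (n + 2)" by (intro mult_mono) auto
    then have "b \<le> a" using ab by linarith
    then have "of_nat (hilbert_function curve n) = (of_nat a - of_nat b :: rat)"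
      by (simp add: h n a_def b_def)
    moreover have "2 * (of_nat a :: rat) = (of_nat n + 1) * (of_nat n + 2)"
      using arg_cong[OF ab(1), of "of_nat :: nat \<Rightarrow> rat"] by (simp add: algebra_simps)
    moreover have "2 * (of_nat b :: rat) = (of_nat n - of_nat d + 1) * (of_nat n - of_nat d + 2)"
    proof -
      have "(of_nat (2 * b) :: rat) = of_nat (n - d + 1) * of_nat (n - d + 2)"
        unfolding ab(2) by (rule of_nat_mult)
      then show ?thesis using n by (simp add: of_nat_diff add.commute)
    qed
    ultimately show "poly [:(3 * of_nat d - of_nat d ^ 2) / 2, of_nat d:] (of_nat n) =
        (of_nat (hilbert_function curve n) :: rat)"
      by (simp add: field_simps power2_eq_square)
  qed
  then show ?thesis by (simp add: curve_genus_def)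
qed

end

text \<open>A nonzero form of least degree in \<open>I\<close> is irreducible: one factor lies in
  the prime ideal \<open>I\<close> and so has at least the same degree, which leaves a constant for
  the other. Irreducible elements are prime here by unique factorisation.\<close>

lemma prime_ideal_principal_form:
  fixes I :: "(3, 'a::{alg_closed_field, factorial_ring_gcd, semiring_gcd_mult_normalize}) mpoly set"
  assumes I: "homogeneous_prime_ideal I" and "I \<noteq> {0}"
  obtains F n where "F \<in> I" "plane_curve F n"
proof -
  interpret prime_ideal I using I by (simp add: homogeneous_prime_ideal_iff)
  have comp: "homogeneous_component e G \<in> I" if "G \<in> I" for G e
    using I that by (simp add: homogeneous_prime_ideal_iff)
  define Q where "Q n \<longleftrightarrow> (\<exists>F\<in>I. homogeneous n F \<and> F \<noteq> 0)" for n
  obtain G where "G \<in> I" "G \<noteq> 0" using assms(2) zero_mem by blast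
  then obtain e where "homogeneous_component e G \<noteq> 0"
    using sum_homogeneous_components[of G] by (metis (no_types, lifting) sum.neutral)
  then have "Q e" unfolding Q_def using comp \<open>G \<in> I\<close> homogeneous_component by blast
  define n where "n = (LEAST n. Q n)"
  have "Q n" unfolding n_def by (rule LeastI) fact
  have least: "n \<le> m" if "Q m" for m unfolding n_def by (rule Least_le) fact
  obtain F where F: "F \<in> I" "homogeneous n F" "F \<noteq> 0" using \<open>Q n\<close> by (auto simp: Q_def)
  have not_unit: "\<not> F dvd 1"
    using F(1) mult_mem' one_notin by (metis dvdE)
  have const_unit: "G dvd 1" if "homogeneous 0 G" "G \<noteq> 0" for G :: "(3, 'a) mpoly"
  proof -
    obtain c where c: "G = mconst c" using homogeneous_0_mconst[OF \<open>homogeneous 0 G\<close>] by metis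
    then have "c \<noteq> 0" using \<open>G \<noteq> 0\<close> by (auto simp: mconst_def)
    then have "G * mconst (inverse c) = 1" by (simp add: c mconst_def mult_single)
    then show ?thesis by (metis dvd_triv_left)
  qed
  have n: "n > 0" using const_unit F not_unit by (metis gr0I)
  have unit: "B dvd 1" if AB: "F = A * B" "A \<in> I" for A B
  proof -
    have nz: "A \<noteq> 0" "B \<noteq> 0" using AB F by auto
    \<comment> \<open>The factor \<open>A\<close> need not be a form, but its top component is a
      nonzero form in \<open>I\<close>, so the minimality of \<open>n\<close> applies to it.\<close>
    have "homogeneous_component (degree (grade_poly A)) A \<noteq> 0"
      using nz by (simp flip: coeff_grade_poly)
    then have "Q (degree (grade_poly A))"
      unfolding Q_def using comp AB(2) homogeneous_component by blast
    then have "n \<le> degree (grade_poly A)" by (rule least)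
    moreover have "degree (grade_poly A) + degree (grade_poly B) = n"
    proof -
      have "grade_poly A * grade_poly B = monom F n"
        using AB(1) grade_poly_homogeneous[OF F(2)] by (simp flip: grade_poly.mult)
      then show ?thesis using nz F(3)
        by (metis degree_mult_eq degree_monom_eq grade_poly_eq_0_iff)
    qed
    ultimately have "degree (grade_poly B) = 0" by simp
    then have "B = homogeneous_component 0 B"
      using sum_homogeneous_components[of B] by simp
    then have "homogeneous 0 B" using homogeneous_component[of 0 B] by simp
    then show ?thesis using const_unit nz by blast
  qed
  have "irreducible F"
  proof (rule irreducibleI)
    fix A B assume "F = A * B"
    then show "A dvd 1 \<or> B dvd 1"
      using unit[of A B] unit[of B A] F(1) mult_mem_iff by (auto simp: mult.commute)
  qed (use F not_unit in auto)
  then have "plane_curve F n"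
    using F(2) n by (simp add: plane_curve_def mpoly3_irreducible_imp_prime)
  then show ?thesis using that F(1) by blast
qed

text \<open>\<open>X\<close> lies on the curve of some prime form in its ideal and has two points,
  so it is not a proper subvariety and equals that curve. Genus one then reads
  \<open>n (3 - n) = 0\<close> with \<open>n > 0\<close>.\<close>

lemma elliptic_curve_iff:
  fixes X :: "('a::{alg_closed_field, factorial_ring_gcd, semiring_gcd_mult_normalize} ^ 3) set set"
  shows "elliptic_curve X \<longleftrightarrow> (\<exists>F. plane_curve F 3 \<and> X = plane_curve.curve F) \<and> smooth X"
proof (intro iffI conjI)
  assume X: "elliptic_curve X"
  then show "smooth X" by (simp add: elliptic_curve_def)
  have v: "projective_variety X" "variety_dim X = 1" and g: "curve_genus X = 1"
    using X by (auto simp: elliptic_curve_def projective_curve_def)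
  have two: "\<exists>L\<in>X. \<exists>M\<in>X. L \<noteq> M"
    using variety_dim_0[of X] v(2) by (metis zero_neq_one)
  then have ne: "X \<noteq> {}" by auto
  note I = projective_variety_vanishing_ideal[OF v(1) ne]
  have "vanishing_ideal X \<noteq> {0}" using curve_genus_0 g by force
  then obtain F n where F: "F \<in> vanishing_ideal X" "plane_curve F n"
    using prime_ideal_principal_form[OF I(1)] by metis
  interpret plane_curve F n by fact
  have "X \<subseteq> curve"
    using F(1) projective_variety_subset[OF v(1)] by (auto simp: mem_curve_iff vanishing_ideal_def)
  then have "X = curve" using proper_subvariety[OF v(1)] two by blast
  then have "(3 * of_nat n - of_nat n ^ 2 :: rat) = 0" using g curve_genus by simp
  then have "(of_nat n :: rat) * (3 - of_nat n) = 0" by (simp add: algebra_simps power2_eq_square)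
  then have "(of_nat n :: rat) = of_nat 3" using pos by simp
  then have "n = 3" by (simp only: of_nat_eq_iff)
  then show "\<exists>F. plane_curve F 3 \<and> X = plane_curve.curve F" using F \<open>X = curve\<close> by blast
next
  assume "(\<exists>F. plane_curve F 3 \<and> X = plane_curve.curve F) \<and> smooth X"
  then obtain F where F: "plane_curve F 3" "X = plane_curve.curve F" "smooth X" by blast
  interpret plane_curve F 3 by fact
  show "elliptic_curve X"
    using F projective_variety_curve variety_dim_curve curve_genus
    by (simp add: elliptic_curve_def projective_curve_def)
qed

section \<open>Cubic forms and their coefficient vectors\<close>

lemma homogeneous_cubic: "homogeneous 3 (cubic c)"
  unfolding cubic_def
proof (intro homogeneous_sum homogeneous_single)
  fix m :: "3 mexp"
  show "mdeg (Rep_mexp m) = 3" using Rep_mexp[of m] by simp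
qed

lemma homogeneous_3_cubic:
  assumes "homogeneous 3 F"
  obtains c where "F = cubic c"
proof
  define c where "c = (\<chi> m :: 3 mexp. Poly_Mapping.lookup F (Rep_mexp m))"
  have "range (Rep_mexp :: 3 mexp \<Rightarrow> _) = {m. mdeg m = 3}"
    using type_definition.Rep_range[OF type_definition_mexp[where 'd = 3]] by simp
  moreover have "inj (Rep_mexp :: 3 mexp \<Rightarrow> _)" by (auto intro: injI simp: Rep_mexp_inject)
  ultimately have "cubic c = (\<Sum>m\<in>{m. mdeg m = 3}. Poly_Mapping.single m (Poly_Mapping.lookup F m))"
    by (simp add: cubic_def c_def sum.reindex flip: \<open>range Rep_mexp = _\<close>)
  also have "\<dots> = (\<Sum>m\<in>Poly_Mapping.keys F. Poly_Mapping.single m (Poly_Mapping.lookup F m))"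
    using assms two_card_monomials(1)
    by (intro sum.mono_neutral_right) (auto simp: homogeneous_def in_keys_iff)
  finally show "F = cubic c" by (simp flip: mpoly_sum_monomials)
qed

section \<open>The Veronese embedding\<close>

text \<open>The exponent of \<open>x_i x_j x_k\<close>. By \<open>mexp3_exhaust\<close> every
  coordinate of the Veronese space has such an index, and the symmetry in the three letters is what
  the rank-one argument and the explicit equations exploit.\<close>

definition mexp3 :: "3 \<Rightarrow> 3 \<Rightarrow> 3 \<Rightarrow> 3 mexp" where
  "mexp3 i j k =
     Abs_mexp (Poly_Mapping.single i 1 + Poly_Mapping.single j 1 + Poly_Mapping.single k 1)"

definition mexp2 :: "3 \<Rightarrow> 3 \<Rightarrow> 2 mexp" where
  "mexp2 i j = Abs_mexp (Poly_Mapping.single i 1 + Poly_Mapping.single j 1)"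

lemma Rep_mexp3:
  "Rep_mexp (mexp3 i j k) = Poly_Mapping.single i 1 + Poly_Mapping.single j 1 + Poly_Mapping.single k 1"
  unfolding mexp3_def by (rule Abs_mexp_inverse) (simp add: mdeg_add)

lemma Rep_mexp2: "Rep_mexp (mexp2 i j) = Poly_Mapping.single i 1 + Poly_Mapping.single j 1"
  unfolding mexp2_def by (rule Abs_mexp_inverse) (simp add: mdeg_add)

lemma mexp_shift_mexp2: "mexp_shift i (mexp2 j k) = mexp3 i j k"
  by (simp add: Rep_mexp_inject[symmetric] Rep_mexp_shift Rep_mexp2 Rep_mexp3 add_ac)

lemma mexp3_commute: "mexp3 i j k = mexp3 j i k" "mexp3 i j k = mexp3 i k j"
  by (simp_all add: mexp3_def add_ac)

lemma mdeg_SucE: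
  assumes "mdeg m = Suc n"
  obtains i m' where "m = m' + Poly_Mapping.single i 1" "mdeg m' = n"
proof -
  have "m \<noteq> 0" using assms by auto
  then obtain i where i: "Poly_Mapping.lookup m i \<noteq> 0" by (metis lookup_zero poly_mapping_eqI)
  define m' where "m' = m - Poly_Mapping.single i 1"
  have m: "m = m' + Poly_Mapping.single i 1"
    using i by (intro poly_mapping_eqI) (auto simp: m'_def lookup_add lookup_minus lookup_single when_def)
  then have "mdeg m' = n" using assms by (simp add: mdeg_add)
  then show ?thesis using that m by blast
qed

lemma mexp3_exhaust: obtains i j k where "m = mexp3 i j k"
proof -
  have "mdeg (Rep_mexp m) = Suc (Suc (Suc 0))" using Rep_mexp[of m] by simp
  then obtain i m' where 1: "Rep_mexp m = m' + Poly_Mapping.single i 1" "mdeg m' = Suc (Suc 0)"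
    by (rule mdeg_SucE)
  obtain j m'' where 2: "m' = m'' + Poly_Mapping.single j 1" "mdeg m'' = Suc 0"
    using 1(2) by (rule mdeg_SucE)
  obtain k m3 where 3: "m'' = m3 + Poly_Mapping.single k 1" "mdeg m3 = 0"
    using 2(2) by (rule mdeg_SucE)
  have "Rep_mexp m = Rep_mexp (mexp3 i j k)"
    using 1 2 3 by (simp add: Rep_mexp3 add_ac)
  then show ?thesis using that by (simp add: Rep_mexp_inject)
qed

lemma mexp2_exhaust: obtains j k where "n = mexp2 j k"
proof -
  have "mdeg (Rep_mexp n) = Suc (Suc 0)" using Rep_mexp[of n] by simp
  then obtain i m' where 1: "Rep_mexp n = m' + Poly_Mapping.single i 1" "mdeg m' = Suc 0"
    by (rule mdeg_SucE)
  obtain j m'' where 2: "m' = m'' + Poly_Mapping.single j 1" "mdeg m'' = 0"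
    using 1(2) by (rule mdeg_SucE)
  have "Rep_mexp n = Rep_mexp (mexp2 i j)"
    using 1 2 by (simp add: Rep_mexp2 add_ac)
  then show ?thesis using that by (simp add: Rep_mexp_inject)
qed

definition ver_poly :: "3 mexp \<Rightarrow> (3, 'a::comm_ring_1) mpoly" where
  "ver_poly m = Poly_Mapping.single (Rep_mexp m) 1"

definition ver :: "'a::comm_ring_1 ^ 3 \<Rightarrow> 'a ^ 3 mexp" where
  "ver a = (\<chi> m. mpoly_eval (ver_poly m) a)"

definition unver_poly :: "3 \<Rightarrow> 3 \<Rightarrow> (3 mexp, 'a::comm_ring_1) mpoly" where
  "unver_poly i j = mvar (mexp3 i i j)"

text \<open>Chart \<open>i\<close> of the inverse of the Veronese map: on \<open>ver a\<close> it
  gives \<open>a\<close> times the square of \<open>a $ i\<close>, so it is usable where that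
  coordinate is nonzero.\<close>

definition unver :: "3 \<Rightarrow> 'a::comm_ring_1 ^ 3 mexp \<Rightarrow> 'a ^ 3" where
  "unver i y = (\<chi> j. y $ mexp3 i i j)"

lemma homogeneous_ver_poly: "homogeneous 3 (ver_poly m)"
  unfolding ver_poly_def using Rep_mexp[of m] by (intro homogeneous_single) simp

lemma ver_poly_mexp3: "ver_poly (mexp3 i j k) = mvar i * mvar j * mvar k"
  by (simp add: ver_poly_def Rep_mexp3 mvar_def mult_single)

lemma ver_mexp3 [simp]: "ver a $ mexp3 i j k = a $ i * a $ j * a $ k"
  by (simp add: ver_def ver_poly_mexp3 mpoly_eval.mult)

lemma mpoly_eval_subst_ver: "mpoly_eval (mpoly_subst ver_poly G) a = mpoly_eval G (ver a)"
  by (simp add: mpoly_eval_subst ver_def)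

lemma mpoly_eval_subst_unver: "mpoly_eval (mpoly_subst (unver_poly i) H) y = mpoly_eval H (unver i y)"
  by (simp add: mpoly_eval_subst unver_poly_def unver_def)

lemma unver_ver: "unver i (ver a) = (a $ i)\<^sup>2 *s a"
  by (simp add: unver_def vec_eq_iff power2_eq_square)

lemma unver_scale: "unver i (s *s y) = s *s unver i y"
  by (simp add: unver_def vec_eq_iff)

lemma ver_scale: "ver (s *s a) = s ^ 3 *s ver a"
  by (simp add: ver_def vec_eq_iff mpoly_eval_scale[OF homogeneous_ver_poly])

lemma ver_eq_0_iff [simp]: "ver a = 0 \<longleftrightarrow> a = (0 :: 'a::field ^ 3)"
proof
  assume *: "ver a = 0"
  have "a $ i = 0" for i
    using arg_cong[OF *, of "\<lambda>y. y $ mexp3 i i i"] by simp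
  then show "a = 0" by (simp add: vec_eq_iff)
next
  assume "a = 0"
  then show "ver a = 0" using ver_scale[of 0 a] by simp
qed

lemma mpoly_eval_cubic: "mpoly_eval (cubic c) a = (\<Sum>m\<in>UNIV. c $ m * ver a $ m)"
  by (simp add: cubic_def ver_def ver_poly_def mpoly_eval.sum)

text \<open>Since \<open>ver\<close> has degree three, the image of a line is visibly closed only
  under scaling by cubes, hence the span. Over an algebraically closed field the two agree by
  \<open>veronese_eq_image\<close>.\<close>

definition veronese :: "('a::field ^ 3) set \<Rightarrow> ('a ^ 3 mexp) set" where
  "veronese L = vec.span (ver ` L)"

lemma veronese_span: "veronese (vec.span {a}) = vec.span {ver a}"
proof
  have "ver ` vec.span {a} \<subseteq> vec.span {ver a}" by (auto simp: vec_span_singleton ver_scale)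
  then show "veronese (vec.span {a}) \<subseteq> vec.span {ver a}"
    unfolding veronese_def by (rule vec.span_minimal[OF _ vec.subspace_span])
  have "a \<in> vec.span {a}" by (simp add: vec.span_base)
  then show "vec.span {ver a} \<subseteq> veronese (vec.span {a})"
    unfolding veronese_def by (intro vec.span_mono) auto
qed

lemma veronese_in_projective_space:
  assumes "L \<in> projective_space"
  shows "veronese L \<in> projective_space"
proof -
  obtain a where "a \<noteq> 0" "L = vec.span {a}" using assms by (auto simp: projective_space_iff)
  then show ?thesis by (simp add: veronese_span span_in_projective_space)
qed

lemma ver_in_veronese: "x \<in> L \<Longrightarrow> ver x \<in> veronese L"
  by (simp add: veronese_def vec.span_base)

lemma mem_veroneseE:
  assumes "L \<in> projective_space" "y \<in> veronese L"
  obtains s x where "x \<in> L" "x \<noteq> 0" "y = s *s ver x" "L = vec.span {x}"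
proof -
  obtain x where x: "x \<in> L" "x \<noteq> 0" by (rule projective_pointE[OF assms(1)])
  have L: "L = vec.span {x}" by (rule span_eqI[OF assms(1) x])
  have "y \<in> vec.span {ver x}" using assms(2) by (simp add: L veronese_span)
  then obtain s where "y = s *s ver x" by (auto simp: vec_span_singleton)
  then show ?thesis using that x L by blast
qed

lemma unver_in: "L \<in> projective_space \<Longrightarrow> y \<in> veronese L \<Longrightarrow> unver i y \<in> L"
  by (metis mem_veroneseE scale_in_projective unver_scale unver_ver)

lemma unver_nonzero:
  assumes "L \<in> projective_space" "y \<in> veronese L" "y \<noteq> 0"
  obtains i where "unver i y \<noteq> 0"
proof -
  obtain s x where x: "x \<noteq> 0" "y = s *s ver x" using assms mem_veroneseE by metis
  then obtain i where "x $ i \<noteq> 0" by (auto simp: vec_eq_iff)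
  moreover have "s \<noteq> 0" using x assms(3) by auto
  ultimately have "unver i y \<noteq> 0" using x by (simp add: unver_scale unver_ver)
  then show ?thesis using that by blast
qed

lemma veronese_inj:
  assumes "L \<in> projective_space" "M \<in> projective_space" "veronese L = veronese M"
  shows "L = M"
proof -
  obtain x where x: "x \<in> L" "x \<noteq> 0" by (rule projective_pointE[OF assms(1)])
  have "ver x \<in> veronese L" by (rule ver_in_veronese[OF x(1)])
  moreover have "ver x \<noteq> 0" using x by simp
  ultimately obtain i where "unver i (ver x) \<noteq> 0" using unver_nonzero[OF assms(1)] by blast
  moreover have "unver i (ver x) \<in> L" "unver i (ver x) \<in> M"
    using unver_in assms \<open>ver x \<in> veronese L\<close> by metis+
  ultimately show ?thesis using span_eqI assms by metis
qed

lemma veronese_inj_on: "inj_on veronese projective_space"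
  by (rule inj_onI) (rule veronese_inj)


section \<open>The quiver Grassmannian as a Veronese image\<close>

text \<open>The hypothesis says that the 3 by 6 matrix of the vectors \<open>phi_i(y)\<close> is the
  product of the column \<open>\<alpha>\<close> and the row \<open>b\<close>. As \<open>y\<close> is
  symmetric in its three letters, \<open>b\<close> must be proportional to the quadratic monomials
  in \<open>\<alpha>\<close>, so \<open>y\<close> is proportional to the cubic ones.\<close>

lemma rank_one_ver:
  fixes y :: "'a::field ^ 3 mexp"
  assumes y: "y \<noteq> 0" and b: "\<And>i n. y $ mexp_shift i n = \<alpha> i * b $ n"
  obtains a where "a \<noteq> 0" "vec.span {y} = vec.span {ver a}"
proof -
  have y3: "y $ mexp3 i j k = \<alpha> i * b $ mexp2 j k" for i j k
    using b[of i "mexp2 j k"] by (simp add: mexp_shift_mexp2)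
  have sym1: "\<alpha> i * b $ mexp2 j k = \<alpha> j * b $ mexp2 i k" for i j k
    using y3 mexp3_commute(1) by metis
  have sym2: "b $ mexp2 j k = b $ mexp2 k j" for j k
    by (simp add: mexp2_def add.commute)
  obtain m where "y $ m \<noteq> 0" using y by (auto simp: vec_eq_iff)
  moreover obtain i j k where "m = mexp3 i j k" by (rule mexp3_exhaust)
  ultimately have i: "\<alpha> i \<noteq> 0" using y3 by auto
  define a where "a = (\<chi> i. \<alpha> i)"
  \<comment> \<open>The scalar comes from exchanging letters twice, which turns an arbitrary entry
    of \<open>b\<close> into the entry with index \<open>i i\<close>.\<close>
  have eq: "y = (b $ mexp2 i i / (\<alpha> i)\<^sup>2) *s ver a"
  proof (rule vec_eq_iff[THEN iffD2], rule allI)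
    fix m
    obtain p q r where m: "m = mexp3 p q r" by (rule mexp3_exhaust)
    have "(\<alpha> i)\<^sup>2 * (\<alpha> p * b $ mexp2 q r) = \<alpha> i * \<alpha> p * (\<alpha> i * b $ mexp2 q r)"
      by (simp add: power2_eq_square)
    also have "\<dots> = \<alpha> i * \<alpha> p * (\<alpha> q * b $ mexp2 r i)"
      using sym1[of i q r] sym2[of i r] by simp
    also have "\<dots> = \<alpha> p * \<alpha> q * (\<alpha> i * b $ mexp2 r i)" by simp
    also have "\<dots> = \<alpha> p * \<alpha> q * (\<alpha> r * b $ mexp2 i i)" using sym1[of i r i] by simp
    finally show "y $ m = ((b $ mexp2 i i / (\<alpha> i)\<^sup>2) *s ver a) $ m"
      using i by (simp add: m y3 a_def field_simps)
  qed
  then have s: "b $ mexp2 i i / (\<alpha> i)\<^sup>2 \<noteq> 0" using y by auto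
  have "a \<noteq> 0" using i by (auto simp: a_def vec_eq_iff)
  moreover have "vec.span {y} = vec.span {ver a}"
  proof (rule sym, rule span_eqI[OF span_in_projective_space])
    show "y \<in> vec.span {ver a}" using eq by (metis rangeI vec_span_singleton)
  qed (use y \<open>a \<noteq> 0\<close> in auto)
  ultimately show ?thesis using that by blast
qed

text \<open>Dimension 0 at vertex 1 says that the linear form kills the line, so the cubic vanishes
  at its preimage. Dimension 1 at vertex 3 says that the vectors \<open>phi_i(y)\<close> are
  multiples of one vector, which is the rank-one condition.\<close>

lemma Gr_V3_veronese:
  "Gr_V3 c = veronese ` {L \<in> projective_space. \<forall>x\<in>L. mpoly_eval (cubic c) x = 0}"
proof (intro equalityI subsetI)
  fix U2 assume "U2 \<in> Gr_V3 c"
  then obtain U1 U3 where sub: "vec.subspace U2" "vec.subspace U3" "arrow21 (V3 c) ` U2 \<subseteq> U1"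
    "\<And>i. arrow23 (V3 c) i ` U2 \<subseteq> U3" and dim: "vec.dim U1 = 0" "vec.dim U2 = 1" "vec.dim U3 = 1"
    by (auto simp: Gr_V3_def quiver_Grassmannian_def subrepresentation_def)
  have P: "U2 \<in> projective_space" "U3 \<in> projective_space"
    using sub dim by (auto simp: projective_space_def)
  obtain y where y: "y \<in> U2" "y \<noteq> 0" by (rule projective_pointE[OF P(1)])
  obtain b where b: "U3 = vec.span {b}" using P(2) by (auto simp: projective_space_iff)
  have "\<exists>s. arrow23 (V3 c) i y = s *s b" for i
    using sub(4)[of i] y by (auto simp: b vec_span_singleton)
  then obtain \<alpha> where "\<And>i. arrow23 (V3 c) i y = \<alpha> i *s b" by metis
  then have "y $ mexp_shift i n = \<alpha> i * b $ n" for i n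
    by (simp add: V3_def vec_eq_iff)
  then obtain a where a: "a \<noteq> 0" "vec.span {y} = vec.span {ver a}" by (rule rank_one_ver[OF y(2)])
  have U2: "U2 = vec.span {ver a}" using span_eqI[OF P(1) y] a by simp
  have "arrow21 (V3 c) (ver a) \<in> U1" using sub(3) by (auto simp: U2 vec.span_base)
  moreover have "U1 \<subseteq> {0}" using dim(1) vec.dim_eq_0 by blast
  ultimately have "(\<Sum>m\<in>UNIV. c $ m * ver a $ m) = 0" by (auto simp: V3_def vec_eq_iff)
  then have "mpoly_eval (cubic c) a = 0" by (simp add: mpoly_eval_cubic)
  then have "mpoly_eval (cubic c) (s *s a) = 0" for s
    by (simp add: mpoly_eval_scale[OF homogeneous_cubic])
  then have "vec.span {a} \<in> {L \<in> projective_space. \<forall>x\<in>L. mpoly_eval (cubic c) x = 0}"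
    using span_in_projective_space[OF a(1)] by (auto simp: vec_span_singleton)
  then show "U2 \<in> veronese ` {L \<in> projective_space. \<forall>x\<in>L. mpoly_eval (cubic c) x = 0}"
    unfolding U2 veronese_span[symmetric] by (rule imageI)
next
  fix U2 assume "U2 \<in> veronese ` {L \<in> projective_space. \<forall>x\<in>L. mpoly_eval (cubic c) x = 0}"
  then obtain a where a: "a \<noteq> 0" "U2 = vec.span {ver a}" "\<forall>x\<in>vec.span {a}. mpoly_eval (cubic c) x = 0"
    by (auto simp: projective_space_iff veronese_span)
  have "(\<Sum>m\<in>UNIV. c $ m * ver a $ m) = 0"
    using a(3) by (simp add: mpoly_eval_cubic vec.span_base flip: mpoly_eval_cubic)
  then have f: "arrow21 (V3 c) (s *s ver a) = 0" for s
    by (simp add: V3_def vec_eq_iff mult.left_commute flip: sum_distrib_left)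
  \<comment> \<open>The vector of quadratic monomials of \<open>a\<close> spans the space at vertex
    3.\<close>
  define b where "b = (\<chi> n :: 2 mexp. monom_val (\<lambda>i. a $ i) (Rep_mexp n))"
  have b2: "b $ mexp2 i j = a $ i * a $ j" for i j
    by (simp add: b_def Rep_mexp2 monom_val_add)
  have arr: "arrow23 (V3 c) i (s *s ver a) = (s * a $ i) *s b" for i s
  proof (rule vec_eq_iff[THEN iffD2], rule allI)
    fix n
    obtain j k where "n = mexp2 j k" by (rule mexp2_exhaust)
    then show "arrow23 (V3 c) i (s *s ver a) $ n = ((s * a $ i) *s b) $ n"
      by (simp add: V3_def mexp_shift_mexp2 b2)
  qed
  obtain i where "a $ i \<noteq> 0" using a(1) by (auto simp: vec_eq_iff)
  then have "b \<noteq> 0" using b2[of i i] by auto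
  then have "vec.span {b} \<in> projective_space" by (rule span_in_projective_space)
  moreover have "U2 \<in> projective_space" using a by (simp add: span_in_projective_space)
  ultimately have "({0}, U2, vec.span {b}) \<in> quiver_Grassmannian (0, 1, 1) (V3 c)"
    using f arr by (auto simp: quiver_Grassmannian_def subrepresentation_def projective_space_def
      a(2) vec_span_singleton vec.dim_eq_0)
  then show "U2 \<in> Gr_V3 c" unfolding Gr_V3_def by force
qed


section \<open>Varieties under the Veronese embedding\<close>

lemma (in prime_ideal) vimage:
  assumes "ring_morphism h"
  shows "prime_ideal {x. h x \<in> J}"
proof -
  interpret h: ring_morphism h by fact
  show ?thesis by unfold_locales (auto simp: h.add h.mult mult_mem_iff intro: add_mem)
qed

text \<open>A scalar in front of \<open>ver x\<close> is absorbed into \<open>x\<close> through a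
  cube root.\<close>

lemma veronese_eq_image:
  fixes L :: "('a::alg_closed_field ^ 3) set"
  assumes "L \<in> projective_space"
  shows "veronese L = ver ` L"
proof
  show "ver ` L \<subseteq> veronese L" by (auto intro: ver_in_veronese)
  show "veronese L \<subseteq> ver ` L"
  proof
    fix y assume "y \<in> veronese L"
    then obtain s x where x: "x \<in> L" "y = s *s ver x" using assms mem_veroneseE by metis
    obtain t where "t ^ 3 = s" using nth_root_exists[of 3 s] by auto
    then have "y = ver (t *s x)" using x by (simp add: ver_scale)
    then show "y \<in> ver ` L" using scale_in_projective[OF assms x(1)] by blast
  qed
qed

lemma vanishing_ideal_veronese:
  fixes X :: "('a::alg_closed_field ^ 3) set set"
  assumes "X \<subseteq> projective_space"
  shows "G \<in> vanishing_ideal (veronese ` X) \<longleftrightarrow> mpoly_subst ver_poly G \<in> vanishing_ideal X"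
proof -
  have "veronese L = ver ` L" if "L \<in> X" for L using veronese_eq_image that assms by blast
  then show ?thesis by (simp add: vanishing_ideal_def mpoly_eval_subst_ver)
qed

lemma unver_vanishing_ideal:
  fixes X :: "('a::field ^ 3) set set"
  assumes "X \<subseteq> projective_space" "H \<in> vanishing_ideal X"
  shows "mpoly_subst (unver_poly i) H \<in> vanishing_ideal (veronese ` X)"
  using assms by (intro vanishing_idealI)
    (auto simp: mpoly_eval_subst_unver intro!: vanishing_idealD[of H X] unver_in)

text \<open>The image is closed: explicit binomial equations force a point to be of the form
  \<open>ver a\<close> up to scaling, with \<open>a\<close> read off by a chart, and the equations
  of \<open>X\<close> pulled back along that chart put the line of \<open>a\<close> into
  \<open>X\<close>.\<close>

lemma vanishing_set_veronese:
  fixes X :: "('a::alg_closed_field ^ 3) set set"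
  assumes X: "X \<subseteq> projective_space" "vanishing_set (vanishing_ideal X) = X"
  shows "vanishing_set (vanishing_ideal (veronese ` X)) = veronese ` X"
proof
  show "veronese ` X \<subseteq> vanishing_set (vanishing_ideal (veronese ` X))"
    using X(1) by (auto simp: vanishing_set_def vanishing_ideal_def intro: veronese_in_projective_space)
  show "vanishing_set (vanishing_ideal (veronese ` X)) \<subseteq> veronese ` X"
  proof
    fix M assume M: "M \<in> vanishing_set (vanishing_ideal (veronese ` X))"
    then have P: "M \<in> projective_space" using vanishing_set_subset by blast
    obtain y where y: "y \<in> M" "y \<noteq> 0" by (rule projective_pointE[OF P])
    have van: "mpoly_eval G z = 0" if "\<And>x. mpoly_eval G (ver x) = 0" "z \<in> M" for G z
    proof -
      have "G \<in> vanishing_ideal (veronese ` X)"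
        using that(1) unfolding vanishing_ideal_veronese[OF X(1)]
        by (intro vanishing_idealI) (simp add: mpoly_eval_subst_ver)
      then show ?thesis using M that(2) by (auto simp: vanishing_set_def)
    qed
    obtain m where "y $ m \<noteq> 0" using y by (auto simp: vec_eq_iff)
    moreover obtain i j k where "m = mexp3 i j k" by (rule mexp3_exhaust)
    \<comment> \<open>A nonzero coordinate of a point makes a pure cube coordinate nonzero, so some
      chart is available.\<close>
    moreover have "mpoly_eval (mvar (mexp3 i j k) ^ 3 -
        mvar (mexp3 i i i) * mvar (mexp3 j j j) * mvar (mexp3 k k k)) y = 0"
      by (rule van[OF _ y(1)])
        (simp add: mpoly_eval.diff mpoly_eval.mult mpoly_eval.power power3_eq_cube)
    ultimately have i: "y $ mexp3 i i i \<noteq> 0"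
      by (auto simp: mpoly_eval.diff mpoly_eval.mult mpoly_eval.power)
    \<comment> \<open>On the image both sides are \<open>x_i^6 x_p x_q x_r\<close>. The relation
      recovers \<open>y\<close> from \<open>unver i y\<close> up to a nonzero factor.\<close>
    have rel: "(y $ mexp3 i i i)\<^sup>2 * y $ m = ver (unver i y) $ m" for m
    proof -
      obtain p q r where m: "m = mexp3 p q r" by (rule mexp3_exhaust)
      have "mpoly_eval (mvar (mexp3 i i i) ^ 2 * mvar (mexp3 p q r) -
          mvar (mexp3 i i p) * mvar (mexp3 i i q) * mvar (mexp3 i i r)) y = 0"
        by (rule van[OF _ y(1)])
          (simp add: mpoly_eval.diff mpoly_eval.mult mpoly_eval.power power2_eq_square)
      then show ?thesis
        by (simp add: m unver_def mpoly_eval.diff mpoly_eval.mult mpoly_eval.power)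
    qed
    define a where "a = unver i y"
    have "a $ i \<noteq> 0" using i by (simp add: a_def unver_def)
    then have "a \<noteq> 0" by auto
    have "ver a = (y $ mexp3 i i i)\<^sup>2 *s y" using rel by (simp add: vec_eq_iff a_def)
    then have "ver a \<in> M" using y scale_in_projective[OF P] by simp
    then have M_eq: "M = veronese (vec.span {a})"
      using span_eqI[OF P] \<open>a \<noteq> 0\<close> by (simp add: veronese_span)
    have "mpoly_eval H (s *s a) = 0" if "H \<in> vanishing_ideal X" for H s
    proof -
      have "mpoly_eval (mpoly_subst (unver_poly i) H) (s *s y) = 0"
        using M unver_vanishing_ideal[OF X(1) that] scale_in_projective[OF P y(1)]
        by (auto simp: vanishing_set_def)
      then show ?thesis by (simp add: mpoly_eval_subst_unver unver_scale a_def)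
    qed
    then have "vec.span {a} \<in> vanishing_set (vanishing_ideal X)"
      using span_in_projective_space[OF \<open>a \<noteq> 0\<close>] by (auto simp: vanishing_set_def vec_span_singleton)
    then show "M \<in> veronese ` X" using X(2) M_eq by blast
  qed
qed

lemma veronese_subset_projective_space:
  "X \<subseteq> projective_space \<Longrightarrow> veronese ` X \<subseteq> projective_space"
  using veronese_in_projective_space by blast

text \<open>The ideal of the image is the preimage of a prime ideal under substitution of the cubic
  monomials.\<close>

lemma homogeneous_prime_ideal_veronese:
  fixes X :: "('a::alg_closed_field ^ 3) set set"
  assumes X: "X \<subseteq> projective_space" "homogeneous_prime_ideal (vanishing_ideal X)"
  shows "homogeneous_prime_ideal (vanishing_ideal (veronese ` X))"
proof -
  interpret prime_ideal "vanishing_ideal X" using X(2) by (simp add: homogeneous_prime_ideal_iff)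
  have "vanishing_ideal (veronese ` X) = {G. mpoly_subst ver_poly G \<in> vanishing_ideal X}"
    using vanishing_ideal_veronese[OF X(1)] by blast
  then have "prime_ideal (vanishing_ideal (veronese ` X))"
    using vimage[OF mpoly_subst.ring_morphism_axioms] by simp
  then show ?thesis
    using vanishing_ideal_component[OF veronese_subset_projective_space[OF X(1)]]
    by (simp add: homogeneous_prime_ideal_iff)
qed

lemma linearly_irreducible_veronese:
  fixes Z :: "('a::alg_closed_field ^ 3) set set"
  assumes Z: "Z \<subseteq> projective_space" and irr: "linearly_irreducible (veronese ` Z)"
  shows "linearly_irreducible Z"
  unfolding linearly_irreducible_def
proof (intro allI impI)
  fix A :: "(3, 'a) mpoly set"
  assume A: "finite A" "\<forall>l\<in>A. homogeneous 1 l" "\<forall>L\<in>Z. \<forall>x\<in>L. \<exists>l\<in>A. mpoly_eval l x = 0"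
  have "\<exists>k. homogeneous 1 k \<and> mpoly_subst ver_poly k = l ^ 3" if "l \<in> A" for l
  proof -
    have "homogeneous (3 * 1) (l ^ 3)" using A(2) that by (intro homogeneous_power) auto
    then obtain c where c: "l ^ 3 = cubic c" by (auto elim: homogeneous_3_cubic)
    define k where "k = (\<Sum>m\<in>UNIV. mconst (c $ m) * mvar m)"
    have "homogeneous 1 k"
      unfolding k_def using homogeneous_mult[OF homogeneous_mconst homogeneous_mvar]
      by (intro homogeneous_sum) auto
    moreover have "mpoly_subst ver_poly k = l ^ 3"
    proof -
      have "mpoly_subst ver_poly k = (\<Sum>m\<in>UNIV. mconst (c $ m) * ver_poly m)"
        by (simp add: k_def mpoly_subst.sum mpoly_subst.mult)
      then show ?thesis by (simp add: c cubic_def ver_poly_def mconst_def mult_single)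
    qed
    ultimately show ?thesis by blast
  qed
  then obtain k where k: "\<And>l. l \<in> A \<Longrightarrow> homogeneous 1 (k l)"
    "\<And>l. l \<in> A \<Longrightarrow> mpoly_subst ver_poly (k l) = l ^ 3" by metis
  have ev: "mpoly_eval (k l) (ver x) = mpoly_eval l x ^ 3" if "l \<in> A" for l x
    using k(2)[OF that] by (simp add: mpoly_eval.power flip: mpoly_eval_subst_ver)
  have "\<exists>l\<in>k ` A. l \<in> vanishing_ideal (veronese ` Z)"
  proof (rule irr[unfolded linearly_irreducible_def, rule_format])
    fix M y assume "M \<in> veronese ` Z" "y \<in> M"
    then obtain L x where "L \<in> Z" "x \<in> L" "y = ver x" using veronese_eq_image Z by blast
    then show "\<exists>l\<in>k ` A. mpoly_eval l y = 0" using A(3) ev by (auto simp: image_iff)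
  qed (use A(1) k in auto)
  then obtain l where l: "l \<in> A" "k l \<in> vanishing_ideal (veronese ` Z)" by blast
  have "l \<in> vanishing_ideal Z"
  proof (rule vanishing_idealI)
    fix L x assume "L \<in> Z" "x \<in> L"
    then have "mpoly_eval (k l) (ver x) = 0"
      using l(2) ver_in_veronese by (blast intro: vanishing_idealD)
    then show "mpoly_eval l x = 0" using ev[OF l(1)] by simp
  qed
  then show "\<exists>l\<in>A. l \<in> vanishing_ideal Z" using l(1) by blast
qed

context plane_curve
begin

lemma curve_subset: "curve \<subseteq> projective_space"
  by (auto simp: mem_curve_iff)

lemma vanishing_set_ideal_curve: "vanishing_set (vanishing_ideal curve) = curve"
  unfolding vanishing_ideal_curve by (simp add: curve_def)

lemma homogeneous_prime_ideal_curve: "homogeneous_prime_ideal (vanishing_ideal curve)"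
  unfolding vanishing_ideal_curve by (rule homogeneous_prime_ideal)

text \<open>The preimage \<open>Z\<close> of a proper subvariety enters only as a linearly
  irreducible subset of the curve. An equation of the subvariety that does not hold on the whole
  image becomes, after substitution, a polynomial not divisible by \<open>F\<close>, so
  \<open>Z\<close> has at most one point.\<close>

lemma variety_dim_veronese_curve: "variety_dim (veronese ` curve) = 1"
proof -
  let ?V = "veronese ` curve"
  note VI = vanishing_set_veronese[OF curve_subset vanishing_set_ideal_curve]
    homogeneous_prime_ideal_veronese[OF curve_subset homogeneous_prime_ideal_curve]
  obtain L M where LM: "L \<in> curve" "M \<in> curve" "L \<noteq> M" by (rule two_points)
  show ?thesis
  proof (rule variety_dim_1)
    show "projective_variety ?V" unfolding projective_variety_def using VI by metis
    show "veronese L \<in> ?V" "veronese M \<in> ?V" using LM by auto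
    show "veronese L \<noteq> veronese M" using LM veronese_inj curve_subset by blast
    fix Z' L' M'
    assume Z': "projective_variety Z'" "Z' \<subset> ?V" "L' \<in> Z'" "M' \<in> Z'"
    define Z where "Z = {L \<in> curve. veronese L \<in> Z'}"
    have img: "Z' = veronese ` Z" using Z'(2) by (auto simp: Z_def)
    have Z: "Z \<subseteq> curve" "Z \<subseteq> projective_space" using curve_subset by (auto simp: Z_def)
    have ne: "Z' \<noteq> {}" using Z' by auto
    have irr: "linearly_irreducible Z"
      using projective_variety_linearly_irreducible[OF Z'(1) ne] unfolding img
      by (rule linearly_irreducible_veronese[OF Z(2)])
    have "\<exists>G\<in>vanishing_ideal Z'. G \<notin> vanishing_ideal ?V"
    proof (rule ccontr)
      assume "\<not> ?thesis"
      then have "vanishing_set (vanishing_ideal ?V) \<subseteq> vanishing_set (vanishing_ideal Z')"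
        unfolding vanishing_set_def by blast
      then show False using VI(1) projective_variety_vanishing_ideal(2)[OF Z'(1) ne] Z'(2) by blast
    qed
    then obtain G where "G \<in> vanishing_ideal Z'" "G \<notin> vanishing_ideal ?V" by blast
    then have "mpoly_subst ver_poly G \<in> vanishing_ideal Z" "\<not> F dvd mpoly_subst ver_poly G"
      using vanishing_ideal_veronese[OF Z(2)] vanishing_ideal_veronese[OF curve_subset]
      by (simp_all add: img vanishing_ideal_curve)
    then show "L' = M'"
      using linearly_irreducible_subset[OF Z(1) irr] Z'(3,4) unfolding img by blast
  qed
qed

end

section \<open>Tangent spaces under the Veronese embedding\<close>

text \<open>The definition imposes its condition at every vector of the line; one spanning vector
  suffices. For a nonzero multiple this follows by rescaling the variables, which preserves the
  vanishing ideal, and the chain rule; at the zero vector it follows by polynomial continuation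
  along the line.\<close>

lemma cone_tangent_space_iff:
  fixes X :: "('a::alg_closed_field ^ 'i::finite) set set"
  assumes X: "X \<subseteq> projective_space"
  shows "v \<in> cone_tangent_space X (vec.span {a}) \<longleftrightarrow> (\<forall>F\<in>vanishing_ideal X. dir_deriv F a v = 0)"
proof
  assume "v \<in> cone_tangent_space X (vec.span {a})"
  then show "\<forall>F\<in>vanishing_ideal X. dir_deriv F a v = 0"
    by (auto simp: cone_tangent_space_def dir_deriv_def vec.span_base)
next
  assume *: "\<forall>F\<in>vanishing_ideal X. dir_deriv F a v = 0"
  have "dir_deriv F (s *s a) v = 0" if F: "F \<in> vanishing_ideal X" for F s
  proof -
    define G where "G = (\<Sum>i\<in>UNIV. mpoly_deriv i F * mconst (v $ i))"
    have G: "dir_deriv F x v = mpoly_eval G x" for x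
      by (simp add: G_def dir_deriv_def mpoly_eval.sum mpoly_eval.mult)
    have nz: "mpoly_eval G (s *s a) = 0" if "s \<noteq> 0" for s
    proof -
      let ?S = "\<lambda>i. mconst s * mvar i"
      have S: "(\<chi> j. mpoly_eval (?S j) x) = s *s x" for x
        by (simp add: vec_eq_iff mpoly_eval.mult)
      have dS: "(\<chi> j. dir_deriv (?S j) a v) = s *s v"
        by (simp add: vec_eq_iff dir_deriv_mult)
      have "mpoly_subst ?S F \<in> vanishing_ideal X"
        using X by (intro vanishing_idealI) (auto simp: mpoly_eval_subst S
          intro!: vanishing_idealD[OF F] scale_in_projective)
      then have "dir_deriv (mpoly_subst ?S F) a v = 0" using * by blast
      then have "s * dir_deriv F (s *s a) v = 0"
        by (simp add: dir_deriv_subst S dS dir_deriv_scale_right)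
      then show ?thesis using that by (simp add: G)
    qed
    \<comment> \<open>The factor \<open>monom 1 1\<close> covers \<open>s = 0\<close>, where nothing
      is known yet; it is cancelled afterwards.\<close>
    have "poly (monom 1 1 * line_poly 0 a G) s = 0" for s
      using nz[of s] by (cases "s = 0") (simp_all add: poly_monom poly_line_poly)
    then have "monom 1 1 * line_poly 0 a G = 0" by (metis poly_exists_nonzero)
    then have "line_poly 0 a G = 0" by simp
    then show ?thesis using poly_line_poly[of 0 a G s] by (simp add: G)
  qed
  then show "v \<in> cone_tangent_space X (vec.span {a})"
    by (auto simp: cone_tangent_space_def vec_span_singleton dir_deriv_def[symmetric])
qed

text \<open>
  Euler's identity, in the form that the cone over a variety contains its lines; it is not derived
  from the degree of the equations, which may vanish in the field.
\<close>

lemma dir_deriv_radial: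
  fixes X :: "('a::alg_closed_field ^ 'i::finite) set set"
  assumes "X \<subseteq> projective_space" "F \<in> vanishing_ideal X" "L \<in> X" "a \<in> L"
  shows "dir_deriv F a a = 0"
proof -
  have "poly (line_poly a a F) t = 0" for t
  proof -
    have "a + t *s a = (1 + t) *s a" by (simp add: vec_eq_iff algebra_simps)
    then show ?thesis
      using assms vanishing_idealD scale_in_projective by (metis poly_line_poly subsetD)
  qed
  then have "line_poly a a F = 0" by (metis poly_exists_nonzero)
  then show ?thesis by (simp add: dir_deriv_conv_line_poly)
qed

lemma linear_unver: "Vector_Spaces.linear (*s) (*s) (unver i :: 'a::field ^ 3 mexp \<Rightarrow> 'a ^ 3)"
  by unfold_locales (auto simp: unver_def vec_eq_iff)

text \<open>
  On the tangent spaces the linear map \<^term>\<open>unver i\<close> is an isomorphism. Its inverse is the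
  differential of \<^term>\<open>ver\<close> corrected by a radial term: the differential itself is not injective
  in characteristic 3, where it kills the radial direction.
\<close>

lemma tangent_dim_veronese:
  fixes X :: "('a::alg_closed_field ^ 3) set set"
  assumes X: "X \<subseteq> projective_space" and L: "L \<in> X"
  shows "tangent_dim (veronese ` X) (veronese L) = tangent_dim X L"
proof -
  have P: "L \<in> projective_space" using X L by blast
  obtain a0 where a0: "a0 \<in> L" "a0 \<noteq> 0" by (rule projective_pointE[OF P])
  then obtain i where i: "a0 $ i \<noteq> 0" by (auto simp: vec_eq_iff)
  \<comment> \<open>Normalised to have coordinate \<open>i\<close> equal to 1, so that
    \<open>unver i\<close> sends \<open>ver a\<close> exactly to \<open>a\<close>.\<close>
  define a where "a = inverse (a0 $ i) *s a0"
  have ai: "a $ i = 1" using i by (simp add: a_def)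
  have aL: "a \<in> L" using a0 scale_in_projective[OF P] by (simp add: a_def)
  have "a \<noteq> 0" using ai by auto
  have La: "L = vec.span {a}" by (rule span_eqI[OF P aL \<open>a \<noteq> 0\<close>])
  have unver_a: "unver i (ver a) = a" by (simp add: unver_ver ai)
  let ?V = "veronese ` X"
  have VP: "?V \<subseteq> projective_space" by (rule veronese_subset_projective_space[OF X])
  define T where "T = cone_tangent_space X L"
  define T' where "T' = cone_tangent_space ?V (veronese L)"
  have T: "w \<in> T \<longleftrightarrow> (\<forall>F\<in>vanishing_ideal X. dir_deriv F a w = 0)" for w
    unfolding T_def La by (rule cone_tangent_space_iff[OF X])
  have T': "v \<in> T' \<longleftrightarrow> (\<forall>F\<in>vanishing_ideal ?V. dir_deriv F (ver a) v = 0)" for v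
    unfolding T'_def La veronese_span by (rule cone_tangent_space_iff[OF VP])
  have sub: "vec.subspace T'"
  proof -
    have "dir_deriv F x 0 = 0" for F :: "(3 mexp, 'a) mpoly" and x by (simp add: dir_deriv_def)
    then show ?thesis
      by (auto simp: vec.subspace_def T' dir_deriv_add_right dir_deriv_scale_right)
  qed
  have into: "unver i v \<in> T" if "v \<in> T'" for v
    unfolding T
  proof
    fix H assume "H \<in> vanishing_ideal X"
    then have "dir_deriv (mpoly_subst (unver_poly i) H) (ver a) v = 0"
      using that unver_vanishing_ideal[OF X] T' by blast
    moreover have "(\<chi> j. mpoly_eval (unver_poly i j) y) = unver i y"
      "(\<chi> j. dir_deriv (unver_poly i j) y v) = unver i v" for y :: "'a ^ 3 mexp"
      by (simp_all add: unver_poly_def unver_def)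
    ultimately show "dir_deriv H a (unver i v) = 0" by (simp add: dir_deriv_subst unver_a)
  qed
  have inj: "v = 0" if v: "v \<in> T'" "unver i v = 0" for v
  proof -
    have z: "v $ mexp3 i i j = 0" for j
      using arg_cong[OF v(2), of "\<lambda>w. w $ j"] by (simp add: unver_def)
    have "v $ m = 0" for m
    proof -
      obtain p q r where m: "m = mexp3 p q r" by (rule mexp3_exhaust)
      \<comment> \<open>The same relation as in the proof that the image is closed. Its differential
        at \<open>ver a\<close> expresses each coordinate of a tangent vector through the
        coordinates with index \<open>i i j\<close>, which are zero here.\<close>
      define R :: "(3 mexp, 'a) mpoly" where "R = mvar (mexp3 i i i) * mvar (mexp3 i i i) * mvar (mexp3 p q r) -
          mvar (mexp3 i i p) * mvar (mexp3 i i q) * mvar (mexp3 i i r)"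
      have "mpoly_eval R (ver x) = 0" for x
        by (simp add: R_def mpoly_eval.diff mpoly_eval.mult)
      then have "R \<in> vanishing_ideal ?V"
        unfolding vanishing_ideal_veronese[OF X]
        by (intro vanishing_idealI) (simp add: mpoly_eval_subst_ver)
      then have "dir_deriv R (ver a) v = 0" using v T' by blast
      then show ?thesis
        by (simp add: R_def dir_deriv_diff dir_deriv_mult mpoly_eval.mult z m ai)
    qed
    then show ?thesis by (simp add: vec_eq_iff)
  qed
  have onto: "w \<in> unver i ` T'" if w: "w \<in> T" for w
  proof
    \<comment> \<open>Coordinate \<open>i i j\<close> of the differential is the derivative of
      \<open>x_i^2 x_j\<close> along \<open>w\<close>, that is \<open>w_j + 2 w_i a_j\<close> since
      \<open>a_i = 1\<close>. The radial term removes the second summand.\<close>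
    define v where "v = (\<chi> m. dir_deriv (ver_poly m) a w) + (- 2 * w $ i) *s ver a"
    have "dir_deriv G (ver a) v = 0" if G: "G \<in> vanishing_ideal ?V" for G
    proof -
      have "dir_deriv G (ver a) (ver a) = 0"
        using dir_deriv_radial[OF VP G] L ver_in_veronese[OF aL] by blast
      moreover have "dir_deriv (mpoly_subst ver_poly G) a w = 0"
        using w G T vanishing_ideal_veronese[OF X] by blast
      then have "dir_deriv G (ver a) (\<chi> m. dir_deriv (ver_poly m) a w) = 0"
        by (simp add: dir_deriv_subst flip: ver_def)
      ultimately show ?thesis unfolding v_def dir_deriv_add_right dir_deriv_scale_right by simp
    qed
    then show "v \<in> T'" by (simp add: T')
    show "w = unver i v"
      by (simp add: vec_eq_iff unver_def v_def ver_poly_mexp3 dir_deriv_mult mpoly_eval.mult ai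
        algebra_simps)
  qed
  have "vec.dim (unver i ` T') = vec.dim T'"
  proof (rule vec.dim_image_eq[OF linear_unver])
    interpret u: Vector_Spaces.linear "(*s)" "(*s)" "unver i :: 'a ^ 3 mexp \<Rightarrow> 'a ^ 3"
      by (rule linear_unver)
    show "inj_on (unver i) (vec.span T')"
      using inj sub by (simp add: u.inj_on_iff_eq_0 vec.span_eq_iff[THEN iffD2])
  qed
  moreover have "unver i ` T' = T" using into onto by blast
  ultimately show ?thesis by (simp add: tangent_dim_def T_def T'_def)
qed

lemma (in plane_curve) smooth_veronese_curve: "smooth (veronese ` curve) \<longleftrightarrow> smooth curve"
  by (simp add: smooth_def variety_dim_veronese_curve variety_dim_curve
    tangent_dim_veronese[OF curve_subset])

section \<open>Morphisms as locally polynomial maps\<close>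

definition tuple_value :: "('j \<Rightarrow> ('i::finite, 'a::field) mpoly) \<Rightarrow> 'a ^ 'i \<Rightarrow> 'a ^ 'j::finite" where
  "tuple_value F x = (\<chi> j. mpoly_eval (F j) x)"

definition represents ::
    "('a::field ^ 'i::finite) set set \<Rightarrow> ('j::finite \<Rightarrow> ('i, 'a) mpoly) \<Rightarrow>
     (('a ^ 'i) set \<Rightarrow> ('a ^ 'j) set) \<Rightarrow> bool" where
  "represents X F \<phi> \<longleftrightarrow> (\<exists>e. \<forall>j. homogeneous e (F j)) \<and>
     (\<forall>M\<in>X. \<forall>y\<in>M. tuple_value F y \<noteq> 0 \<longrightarrow> \<phi> M = vec.span {tuple_value F y})"

text \<open>Morphisms in local form: around every point some tuple of forms is defined, and it gives
  the map wherever it does not vanish. There is no mention of a common rational class, which makes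
  composition easy; \<open>variety_morphisms_eq_regular_maps\<close> restores it.\<close>

definition regular_maps ::
    "('a::field ^ 'i::finite) set set \<Rightarrow> ('a ^ 'j::finite) set set \<Rightarrow>
     (('a ^ 'i) set \<Rightarrow> ('a ^ 'j) set) set" where
  "regular_maps X Y =
     {\<phi> \<in> X \<rightarrow>\<^sub>E Y. \<forall>L\<in>X. \<exists>F. represents X F \<phi> \<and> (\<exists>x\<in>L. tuple_value F x \<noteq> 0)}"

lemma tuple_value_scale:
  assumes "\<forall>j. homogeneous e (F j)"
  shows "tuple_value F (s *s x) = s ^ e *s tuple_value F x"
  using assms by (simp add: tuple_value_def vec_eq_iff mpoly_eval_scale)

lemma tuple_value_span:
  assumes F: "\<forall>j. homogeneous e (F j)" and M: "M \<in> projective_space" "y \<in> M" "z \<in> M" "z \<noteq> 0"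
    and nz: "tuple_value F y \<noteq> 0"
  shows "tuple_value F z \<noteq> 0" "vec.span {tuple_value F y} = vec.span {tuple_value F z}"
proof -
  obtain s where s: "y = s *s z" using span_eqI[OF M(1,3,4)] M(2) by (auto simp: vec_span_singleton)
  have eq: "tuple_value F y = s ^ e *s tuple_value F z" by (simp add: s tuple_value_scale[OF F])
  then show z: "tuple_value F z \<noteq> 0" using nz by auto
  have "tuple_value F y \<in> vec.span {tuple_value F z}" using eq by (auto simp: vec_span_singleton)
  then show "vec.span {tuple_value F y} = vec.span {tuple_value F z}"
    using span_eqI[OF span_in_projective_space[OF z]] nz by metis
qed

text \<open>Transitivity of proportionality passes through a component \<open>H p\<close> outside
  the ideal: the minor of \<open>F\<close> and \<open>G\<close> times the square of
  \<open>H p\<close> is a combination of the given minors, and primality cancels the square.\<close>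

lemma rational_rel_trans:
  assumes prime: "prime_ideal (vanishing_ideal X)"
    and rel: "(H, F) \<in> rational_rel X" "(H, G) \<in> rational_rel X"
  shows "F j * G k - F k * G j \<in> vanishing_ideal X"
proof -
  interpret prime_ideal "vanishing_ideal X" by fact
  obtain p where p: "H p \<notin> vanishing_ideal X"
    using rel(1) by (auto simp: rational_rel_def rational_tuple_def)
  have u: "H p * F i - H i * F p \<in> vanishing_ideal X" for i
    using rel(1) by (auto simp: rational_rel_def)
  have w: "H p * G i - H i * G p \<in> vanishing_ideal X" for i
    using rel(2) by (auto simp: rational_rel_def)
  have "H p * H p * (F j * G k - F k * G j) =
      (H p * F j - H j * F p) * (H p * G k) + (H j * F p) * (H p * G k - H k * G p) -
      ((H p * F k - H k * F p) * (H p * G j) + (H k * F p) * (H p * G j - H j * G p))"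
    by (simp add: algebra_simps)
  also have "\<dots> \<in> vanishing_ideal X"
    by (intro diff_mem add_mem mult_mem[OF w] mult_mem'[OF u])
  finally show ?thesis using p by (simp add: mult_mem_iff)
qed

text \<open>Two tuples of one rational class give the same point wherever both are nonzero, so each
  represents the map. Conversely any two representing tuples are equivalent: at each point they span
  the same line or one of them is zero, and in both cases the minors vanish.\<close>

lemma variety_morphisms_eq_regular_maps:
  assumes X: "X \<subseteq> projective_space" "X \<noteq> {}" "prime_ideal (vanishing_ideal X)"
  shows "variety_morphisms X Y = regular_maps X Y"
proof (intro equalityI subsetI)
  fix \<phi> assume "\<phi> \<in> variety_morphisms X Y"
  then obtain R where R: "R \<in> rational_maps X" "\<And>L. L \<in> X \<Longrightarrow> rational_value R L (\<phi> L)"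
    and ext: "\<phi> \<in> X \<rightarrow>\<^sub>E Y" by (auto simp: variety_morphisms_def)
  obtain H where H: "R = rational_rel X `` {H}" using R(1) by (auto simp: rational_maps_def quotient_def)
  have rep: "represents X F \<phi>" if F: "F \<in> R" for F
  proof -
    obtain e where e: "\<forall>j. homogeneous e (F j)"
      using F by (auto simp: H rational_rel_def rational_tuple_def)
    have "\<phi> M = vec.span {tuple_value F y}" if M: "M \<in> X" "y \<in> M" and nz: "tuple_value F y \<noteq> 0" for M y
    proof -
      have P: "M \<in> projective_space" using M X by blast
      obtain z where z: "z \<in> M" "z \<noteq> 0" by (rule projective_pointE[OF P])
      obtain G x where G: "G \<in> R" "x \<in> M" "tuple_value G x \<noteq> 0" "\<phi> M = vec.span {tuple_value G x}"
        using R(2)[OF M(1)] by (auto simp: rational_value_def tuple_value_def)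
      obtain e' where e': "\<forall>j. homogeneous e' (G j)"
        using G(1) by (auto simp: H rational_rel_def rational_tuple_def)
      note 1 = tuple_value_span[OF e P M(2) z nz] and 2 = tuple_value_span[OF e' P G(2) z G(3)]
      have "tuple_value F z $ j * tuple_value G z $ k = tuple_value F z $ k * tuple_value G z $ j" for j k
        using vanishing_idealD[OF rational_rel_trans[OF X(3), of H F G j k] M(1) z(1)] F G(1)
        by (simp add: H tuple_value_def mpoly_eval.diff mpoly_eval.mult)
      then have "vec.span {tuple_value F z} = vec.span {tuple_value G z}"
        using 1(1) 2(1) by (intro span_eq_of_minors)
      then show ?thesis using 1(2) 2(2) G(4) by simp
    qed
    then show ?thesis using e by (auto simp: represents_def)
  qed
  have "\<exists>F. represents X F \<phi> \<and> (\<exists>x\<in>L. tuple_value F x \<noteq> 0)" if L: "L \<in> X" for L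
  proof -
    obtain F x where "F \<in> R" "x \<in> L" "tuple_value F x \<noteq> 0"
      using R(2)[OF L] unfolding rational_value_def tuple_value_def by blast
    then show ?thesis using rep by blast
  qed
  then show "\<phi> \<in> regular_maps X Y" using ext by (simp add: regular_maps_def)
next
  fix \<phi> assume phi: "\<phi> \<in> regular_maps X Y"
  have tup: "rational_tuple X F" if "represents X F \<phi>" "L \<in> X" "x \<in> L" "tuple_value F x \<noteq> 0" for F L x
    using that unfolding rational_tuple_def represents_def vanishing_ideal_def tuple_value_def
    by (auto simp: vec_eq_iff)
  obtain L0 where "L0 \<in> X" using X(2) by blast
  then obtain H x0 where H: "represents X H \<phi>" "x0 \<in> L0" "tuple_value H x0 \<noteq> 0"
    using phi by (auto simp: regular_maps_def)
  have Ht: "rational_tuple X H" using tup H \<open>L0 \<in> X\<close> by blast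
  define R where "R = rational_rel X `` {H}"
  have "R \<in> rational_maps X" using Ht by (auto simp: R_def rational_maps_def intro: quotientI)
  moreover have "rational_value R L (\<phi> L)" if L: "L \<in> X" for L
  proof -
    obtain F x where F: "represents X F \<phi>" "x \<in> L" "tuple_value F x \<noteq> 0"
      using phi L by (auto simp: regular_maps_def)
    have "H j * F k - H k * F j \<in> vanishing_ideal X" for j k
    proof (rule vanishing_idealI)
      fix M y assume M: "M \<in> X" "y \<in> M"
      have "tuple_value H y $ j * tuple_value F y $ k = tuple_value H y $ k * tuple_value F y $ j"
      proof (cases "tuple_value H y = 0 \<or> tuple_value F y = 0")
        case False
        then have "vec.span {tuple_value F y} = vec.span {tuple_value H y}"
          using H(1) F(1) M by (auto simp: represents_def)
        then have "tuple_value F y \<in> vec.span {tuple_value H y}"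
          by (metis insertI1 vec.span_base)
        then show ?thesis by (auto simp: vec_span_singleton)
      qed auto
      then show "mpoly_eval (H j * F k - H k * F j) y = 0"
        by (simp add: tuple_value_def mpoly_eval.diff mpoly_eval.mult)
    qed
    then have "F \<in> R" using tup[OF F(1) L F(2,3)] Ht by (auto simp: R_def rational_rel_def)
    moreover have "\<phi> L = vec.span {tuple_value F x}" using F L by (auto simp: represents_def)
    ultimately show ?thesis using F(2,3) by (auto simp: rational_value_def tuple_value_def)
  qed
  ultimately show "\<phi> \<in> variety_morphisms X Y"
    using phi by (auto simp: variety_morphisms_def regular_maps_def)
qed

lemma regular_mapsD: "\<phi> \<in> regular_maps X Y \<Longrightarrow> \<phi> \<in> X \<rightarrow>\<^sub>E Y"
  by (simp add: regular_maps_def)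

lemma regular_maps_id:
  assumes "X \<subseteq> projective_space"
  shows "restrict id X \<in> regular_maps X X"
proof -
  have t: "tuple_value mvar y = y" for y :: "'a ^ 'b" by (simp add: tuple_value_def vec_eq_iff)
  have "represents X mvar (restrict id X)"
    unfolding represents_def t using assms span_eqI homogeneous_mvar by (auto 4 4)
  moreover have "\<exists>x\<in>L. x \<noteq> 0" if "L \<in> X" for L
    using that assms projective_pointE by (metis subsetD)
  ultimately show ?thesis by (auto simp: regular_maps_def t intro!: exI[of _ mvar])
qed

lemma regular_maps_compose:
  assumes X: "X \<subseteq> projective_space" and Y: "Y \<subseteq> projective_space"
    and phi: "\<phi> \<in> regular_maps X Y" and psi: "\<psi> \<in> regular_maps Y Z"
  shows "compose X \<psi> \<phi> \<in> regular_maps X Z"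
proof -
  have maps: "\<phi> \<in> X \<rightarrow> Y" "\<psi> \<in> Y \<rightarrow> Z" using phi psi by (auto simp: regular_maps_def)
  have "\<exists>H. represents X H (compose X \<psi> \<phi>) \<and> (\<exists>x\<in>L. tuple_value H x \<noteq> 0)" if L: "L \<in> X" for L
  proof -
    obtain F x where F: "represents X F \<phi>" "x \<in> L" "tuple_value F x \<noteq> 0"
      using phi L by (auto simp: regular_maps_def)
    have PL: "\<phi> L = vec.span {tuple_value F x}" using F L by (auto simp: represents_def)
    have YL: "\<phi> L \<in> Y" using L maps by auto
    obtain G z where G: "represents Y G \<psi>" "z \<in> \<phi> L" "tuple_value G z \<noteq> 0"
      using psi YL by (auto simp: regular_maps_def)
    obtain e e' where e: "\<forall>j. homogeneous e (F j)" and e': "\<forall>j. homogeneous e' (G j)"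
      using F(1) G(1) by (auto simp: represents_def)
    define H where "H k = mpoly_subst F (G k)" for k
    have H: "tuple_value H y = tuple_value G (tuple_value F y)" for y
      by (simp add: H_def tuple_value_def mpoly_eval_subst)
    have "\<forall>k. homogeneous (e' * e) (H k)" using e e' by (auto simp: H_def intro: homogeneous_subst)
    moreover have "compose X \<psi> \<phi> M = vec.span {tuple_value H y}"
      if M: "M \<in> X" "y \<in> M" "tuple_value H y \<noteq> 0" for M y
    proof -
      have "\<phi> M \<in> Y" using maps M by auto
      then have "vec.subspace (\<phi> M)" using Y by (auto simp: projective_space_def)
      \<comment> \<open>The value of \<open>F\<close> at \<open>y\<close> can be zero although
        \<open>H\<close> is not, namely if \<open>G\<close> consists of constants; zero lies on the
        line as well.\<close>
      then have "tuple_value F y \<in> \<phi> M"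
        using F(1) M by (cases "tuple_value F y = 0") (auto simp: represents_def vec.subspace_0 vec.span_base)
      then show ?thesis
        using G(1) M \<open>\<phi> M \<in> Y\<close> by (auto simp: compose_def represents_def H)
    qed
    ultimately have "represents X H (compose X \<psi> \<phi>)" by (auto simp: represents_def)
    \<comment> \<open>\<open>G\<close> was chosen nonzero at some vector \<open>z\<close> of the
      line; homogeneity moves this to the spanning vector given by \<open>F\<close>.\<close>
    moreover have "tuple_value H x \<noteq> 0"
      unfolding H using Y YL by (intro tuple_value_span(1)[OF e' _ G(2) _ F(3) G(3)]) (auto simp: PL vec.span_base)
    ultimately show ?thesis using F(2) by blast
  qed
  moreover have "compose X \<psi> \<phi> \<in> X \<rightarrow>\<^sub>E Z"
    using maps by (auto simp: compose_def)
  ultimately show ?thesis by (simp add: regular_maps_def)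
qed

section \<open>The Veronese map and its inverse as morphisms\<close>

definition unveronese :: "('a::field ^ 3 mexp) set \<Rightarrow> ('a ^ 3) set" where
  "unveronese = inv_into projective_space veronese"

lemma unveronese_veronese [simp]: "L \<in> projective_space \<Longrightarrow> unveronese (veronese L) = L"
  unfolding unveronese_def by (rule inv_into_f_f[OF veronese_inj_on])

lemma veronese_regular:
  assumes X: "X \<subseteq> projective_space"
  shows "restrict veronese X \<in> regular_maps X (veronese ` X)"
proof -
  have t: "tuple_value ver_poly y = ver y" for y :: "'a ^ 3" by (simp add: tuple_value_def ver_def)
  have "veronese M = vec.span {ver y}" if "M \<in> X" "y \<in> M" "y \<noteq> 0" for M y
    using span_eqI[of M y] that X veronese_span[of y] by blast
  then have "represents X ver_poly (restrict veronese X)"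
    unfolding represents_def t using homogeneous_ver_poly by auto
  moreover have "\<exists>x\<in>L. x \<noteq> 0" if "L \<in> X" for L
    using that X projective_pointE by (metis subsetD)
  ultimately show ?thesis by (auto simp: regular_maps_def t intro!: exI[of _ ver_poly])
qed

text \<open>Each chart represents the inverse wherever it is nonzero, and by
  \<open>unver_nonzero\<close> the three charts together cover the image.\<close>

lemma unveronese_regular:
  assumes X: "X \<subseteq> projective_space"
  shows "restrict unveronese (veronese ` X) \<in> regular_maps (veronese ` X) X"
proof -
  have t: "tuple_value (unver_poly i) y = unver i y" for i and y :: "'a ^ 3 mexp"
    by (simp add: tuple_value_def unver_poly_def unver_def)
  have rep: "represents (veronese ` X) (unver_poly i) (restrict unveronese (veronese ` X))" for i
    unfolding represents_def t
  proof (intro conjI ballI impI)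
    show "\<exists>e. \<forall>j. homogeneous e (unver_poly i j :: (3 mexp, 'a) mpoly)"
      unfolding unver_poly_def using homogeneous_mvar by blast
    fix N y assume N: "N \<in> veronese ` X" "y \<in> N" "unver i y \<noteq> 0"
    then obtain L where L: "L \<in> X" "N = veronese L" by blast
    then have P: "L \<in> projective_space" using X by blast
    show "restrict unveronese (veronese ` X) N = vec.span {unver i y}"
      using span_eqI[OF P unver_in[OF P]] N L P by simp
  qed
  have nz: "\<exists>i. \<exists>y\<in>N. unver i y \<noteq> 0" if N: "N \<in> veronese ` X" for N
  proof -
    obtain L where L: "L \<in> projective_space" "N = veronese L" using N X by blast
    then obtain y where "y \<in> N" "y \<noteq> 0" using veronese_in_projective_space projective_pointE by metis
    then show ?thesis using unver_nonzero L by metis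
  qed
  have "\<exists>F. represents (veronese ` X) F (restrict unveronese (veronese ` X)) \<and>
      (\<exists>x\<in>N. tuple_value F x \<noteq> 0)" if "N \<in> veronese ` X" for N
    using nz[OF that] rep unfolding t[symmetric] by blast
  moreover have "unveronese N \<in> X" if "N \<in> veronese ` X" for N
    using that X by auto
  ultimately show ?thesis unfolding regular_maps_def by auto
qed


section \<open>The equivalence of categories\<close>

lemma is_category_variety_category:
  assumes "\<And>X. X \<in> Xs \<Longrightarrow> X \<subseteq> projective_space \<and> X \<noteq> {} \<and> prime_ideal (vanishing_ideal X)"
  shows "is_category (variety_category Xs)"
proof -
  have R: "variety_morphisms X Y = regular_maps X Y" if "X \<in> Xs" for X Y
    using assms[OF that] variety_morphisms_eq_regular_maps by blast
  have P: "X \<subseteq> projective_space" if "X \<in> Xs" for X using assms[OF that] by blast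
  show ?thesis
    unfolding is_category_def
  proof (intro conjI ballI)
    fix X assume "X \<in> Obj (variety_category Xs)"
    then show "Ident (variety_category Xs) X \<in> Hom (variety_category Xs) X X"
      using P by (simp add: variety_category_def R regular_maps_id)
  next
    fix X Y Z f g
    assume "X \<in> Obj (variety_category Xs)" "Y \<in> Obj (variety_category Xs)"
      "f \<in> Hom (variety_category Xs) X Y" "g \<in> Hom (variety_category Xs) Y Z"
    then show "Comp (variety_category Xs) X Y Z g f \<in> Hom (variety_category Xs) X Z"
      using P regular_maps_compose[where X = X and Y = Y] by (simp add: variety_category_def R)
  next
    fix X Y f
    assume "X \<in> Obj (variety_category Xs)" "f \<in> Hom (variety_category Xs) X Y"
    then have f: "f \<in> X \<rightarrow>\<^sub>E Y" by (intro regular_mapsD) (simp add: variety_category_def R)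
    then show "Comp (variety_category Xs) X X Y f (Ident (variety_category Xs) X) = f"
      by (auto simp: variety_category_def compose_def fun_eq_iff PiE_def extensional_def)
    show "Comp (variety_category Xs) X Y Y (Ident (variety_category Xs) Y) f = f"
      using f by (auto simp: variety_category_def compose_def fun_eq_iff PiE_def extensional_def Pi_iff)
  next
    fix W X Y Z f g h
    assume "W \<in> Obj (variety_category Xs)" "f \<in> Hom (variety_category Xs) W X"
    then have f: "f \<in> W \<rightarrow>\<^sub>E X" by (intro regular_mapsD) (simp add: variety_category_def R)
    then show "Comp (variety_category Xs) W Y Z h (Comp (variety_category Xs) W X Y g f) =
      Comp (variety_category Xs) W X Z (Comp (variety_category Xs) X Y Z h g) f"
      by (auto simp: variety_category_def compose_def fun_eq_iff)
  qed
qed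

text \<open>For functors that are inverse on objects and morphisms the identities serve as natural
  isomorphisms.\<close>

lemma equivalent_categories_of_inverse:
  assumes C: "is_category C" and D: "is_category D" and F: "is_functor C D F" and G: "is_functor D C G"
    and GF_obj: "\<And>X. X \<in> Obj C \<Longrightarrow> on_obj G (on_obj F X) = X"
    and GF_hom: "\<And>X Y f. X \<in> Obj C \<Longrightarrow> Y \<in> Obj C \<Longrightarrow> f \<in> Hom C X Y \<Longrightarrow>
      on_hom G (on_obj F X) (on_obj F Y) (on_hom F X Y f) = f"
    and FG_obj: "\<And>X. X \<in> Obj D \<Longrightarrow> on_obj F (on_obj G X) = X"
    and FG_hom: "\<And>X Y f. X \<in> Obj D \<Longrightarrow> Y \<in> Obj D \<Longrightarrow> f \<in> Hom D X Y \<Longrightarrow>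
      on_hom F (on_obj G X) (on_obj G Y) (on_hom G X Y f) = f"
  shows "equivalent_categories C D"
proof -
  have iso: "naturally_isomorphic E E H id_functor"
    if E: "is_category E" "\<And>X. X \<in> Obj E \<Longrightarrow> on_obj H X = X"
      "\<And>X Y f. X \<in> Obj E \<Longrightarrow> Y \<in> Obj E \<Longrightarrow> f \<in> Hom E X Y \<Longrightarrow> on_hom H X Y f = f"
    for E :: "('x, 'y) category" and H
    unfolding naturally_isomorphic_def
  proof (intro exI[of _ "Ident E"] conjI ballI)
    fix X assume X: "X \<in> Obj E"
    have "Ident E X \<in> Hom E X X" "Comp E X X X (Ident E X) (Ident E X) = Ident E X"
      using E(1) X unfolding is_category_def by blast+
    then show "is_iso E (on_obj H X) (on_obj id_functor X) (Ident E X)"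
      using X by (auto simp: is_iso_def id_functor_def E(2))
  next
    fix X Y f assume X: "X \<in> Obj E" "Y \<in> Obj E" "f \<in> Hom E X Y"
    have "Comp E X X Y f (Ident E X) = f" "Comp E X Y Y (Ident E Y) f = f"
      using E(1) X unfolding is_category_def by blast+
    then show "Comp E (on_obj H X) (on_obj H Y) (on_obj id_functor Y) (Ident E Y) (on_hom H X Y f) =
        Comp E (on_obj H X) (on_obj id_functor X) (on_obj id_functor Y) (on_hom id_functor X Y f) (Ident E X)"
      using X by (simp add: id_functor_def E(2,3))
  qed
  have "naturally_isomorphic C C (comp_functor G F) id_functor"
    by (rule iso[OF C]) (simp_all add: comp_functor_def GF_obj GF_hom)
  moreover have "naturally_isomorphic D D (comp_functor F G) id_functor"
    by (rule iso[OF D]) (simp_all add: comp_functor_def FG_obj FG_hom)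
  ultimately show ?thesis
    using C D F G unfolding equivalent_categories_def by blast
qed

text \<open>The functors conjugate a morphism by the Veronese map and its inverse, which are
  regular. Primality of the ideals, on both sides, is what identifies the hom-sets with regular
  maps.\<close>

lemma equivalent_categories_veronese:
  fixes Xs :: "('a::alg_closed_field ^ 3) set set set"
  assumes Xs: "\<And>X. X \<in> Xs \<Longrightarrow> X \<subseteq> projective_space \<and> X \<noteq> {} \<and> homogeneous_prime_ideal (vanishing_ideal X)"
  shows "equivalent_categories (variety_category Xs) (variety_category ((`) veronese ` Xs))"
proof -
  let ?Vs = "(`) veronese ` Xs"
  let ?C = "variety_category Xs" and ?D = "variety_category ?Vs"
  have P: "X \<subseteq> projective_space" if "X \<in> Xs" for X using Xs[OF that] by blast
  have Xs': "X \<subseteq> projective_space \<and> X \<noteq> {} \<and> prime_ideal (vanishing_ideal X)" if "X \<in> Xs" for X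
    using Xs[OF that] by (simp add: homogeneous_prime_ideal_iff)
  have Vs': "V \<subseteq> projective_space \<and> V \<noteq> {} \<and> prime_ideal (vanishing_ideal V)" if V: "V \<in> ?Vs" for V
  proof -
    obtain X where X: "X \<in> Xs" "V = veronese ` X" using V by blast
    then show ?thesis
      using Xs[OF X(1)] homogeneous_prime_ideal_veronese[of X] veronese_subset_projective_space[of X]
      by (simp add: homogeneous_prime_ideal_iff)
  qed
  have RC: "variety_morphisms X Y = regular_maps X Y"
    if "X \<in> Xs" for X and Y :: "('a ^ 3) set set"
    using Xs'[OF that] variety_morphisms_eq_regular_maps by blast
  have RD: "variety_morphisms (veronese ` X) Y = regular_maps (veronese ` X) Y"
    if "X \<in> Xs" for X and Y :: "('a ^ 3 mexp) set set"
    using Vs'[of "veronese ` X"] variety_morphisms_eq_regular_maps that by blast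
  have un [simp]: "unveronese ` veronese ` X = X" if "X \<in> Xs" for X
  proof -
    have "unveronese (veronese L) = L" if "L \<in> X" for L using P[OF \<open>X \<in> Xs\<close>] that by auto
    then show ?thesis by (auto simp: image_iff)
  qed
  have un' [simp]: "unveronese (veronese L) = L" if "X \<in> Xs" "L \<in> X" for X L
    using P[OF that(1)] that(2) by auto
  \<comment> \<open>The function is restricted to the image because morphisms are extensional; the
    same holds for \<open>G\<close>.\<close>
  define F :: "(('a ^ 3) set set, ('a ^ 3) set \<Rightarrow> ('a ^ 3) set,
      ('a ^ 3 mexp) set set, ('a ^ 3 mexp) set \<Rightarrow> ('a ^ 3 mexp) set) functor_data"
    where "F = \<lparr>on_obj = (\<lambda>X. veronese ` X),
    on_hom = (\<lambda>X Y f. \<lambda>N\<in>veronese ` X. veronese (f (unveronese N)))\<rparr>"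
  define G :: "(('a ^ 3 mexp) set set, ('a ^ 3 mexp) set \<Rightarrow> ('a ^ 3 mexp) set,
      ('a ^ 3) set set, ('a ^ 3) set \<Rightarrow> ('a ^ 3) set) functor_data"
    where "G = \<lparr>on_obj = (\<lambda>V. unveronese ` V),
    on_hom = (\<lambda>V W g. \<lambda>L\<in>unveronese ` V. unveronese (g (veronese L)))\<rparr>"
  have F_obj: "on_obj F X = veronese ` X" for X by (simp add: F_def)
  have G_obj: "on_obj G V = unveronese ` V" for V by (simp add: G_def)
  show ?thesis
  proof (rule equivalent_categories_of_inverse)
    show "is_category ?C" using Xs' by (rule is_category_variety_category)
    show "is_category ?D" using Vs' by (rule is_category_variety_category)
    show "is_functor ?C ?D F"
      unfolding is_functor_def
    proof (intro conjI ballI)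
      fix X Y f assume "X \<in> Obj ?C" "Y \<in> Obj ?C" "f \<in> Hom ?C X Y"
      then have X: "X \<in> Xs" "Y \<in> Xs" and f: "f \<in> regular_maps X Y" by (auto simp: variety_category_def RC)
      note VX = veronese_subset_projective_space[OF P[OF X(1)]]
      have fXY: "f \<in> X \<rightarrow> Y" using f by (auto simp: regular_maps_def)
      have "compose (veronese ` X) (restrict veronese Y)
          (compose (veronese ` X) f (restrict unveronese (veronese ` X))) \<in>
        regular_maps (veronese ` X) (veronese ` Y)"
        by (rule regular_maps_compose[OF VX P[OF X(2)]
            regular_maps_compose[OF VX P[OF X(1)] unveronese_regular[OF P[OF X(1)]] f]
            veronese_regular[OF P[OF X(2)]]])
      also have "compose (veronese ` X) (restrict veronese Y)
          (compose (veronese ` X) f (restrict unveronese (veronese ` X))) = on_hom F X Y f"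
        using fXY X by (auto simp: F_def compose_def fun_eq_iff)
      finally show "on_hom F X Y f \<in> Hom ?D (on_obj F X) (on_obj F Y)"
        using X by (simp add: variety_category_def RD F_obj)
    next
      fix X Y Z f g assume "X \<in> Obj ?C" "Y \<in> Obj ?C" "Z \<in> Obj ?C" "f \<in> Hom ?C X Y" "g \<in> Hom ?C Y Z"
      then have X: "X \<in> Xs" "Y \<in> Xs" "Z \<in> Xs" and fg: "f \<in> X \<rightarrow> Y" "g \<in> Y \<rightarrow> Z"
        by (auto simp: variety_category_def RC regular_maps_def)
      show "on_hom F X Z (Comp ?C X Y Z g f) =
        Comp ?D (on_obj F X) (on_obj F Y) (on_obj F Z) (on_hom F Y Z g) (on_hom F X Y f)"
      proof (rule ext)
        fix N
        have fL: "f L \<in> Y" if "L \<in> X" for L using fg that by auto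
        show "on_hom F X Z (Comp ?C X Y Z g f) N =
          Comp ?D (on_obj F X) (on_obj F Y) (on_obj F Z) (on_hom F Y Z g) (on_hom F X Y f) N"
        proof (cases "N \<in> veronese ` X")
          case True
          then obtain L where "L \<in> X" "N = veronese L" by blast
          then show ?thesis
            by (simp add: F_def variety_category_def compose_def un'[OF X(1)] un'[OF X(2)] fL)
        qed (simp add: F_def variety_category_def compose_def)
      qed
    qed (auto simp: F_def variety_category_def fun_eq_iff)
    show "is_functor ?D ?C G"
      unfolding is_functor_def
    proof (intro conjI ballI)
      fix V W g assume "V \<in> Obj ?D" "W \<in> Obj ?D" "g \<in> Hom ?D V W"
      then obtain X Y where X: "X \<in> Xs" "Y \<in> Xs" "V = veronese ` X" "W = veronese ` Y"
        and g: "g \<in> regular_maps V W" by (auto simp: variety_category_def RD)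
      have gVW: "g \<in> veronese ` X \<rightarrow> veronese ` Y" using g X by (auto simp: regular_maps_def)
      have "compose X (restrict unveronese (veronese ` Y)) (compose X g (restrict veronese X)) \<in>
        regular_maps X Y"
        by (rule regular_maps_compose[OF P[OF X(1)] veronese_subset_projective_space[OF P[OF X(2)]]
            regular_maps_compose[OF P[OF X(1)] veronese_subset_projective_space[OF P[OF X(1)]]
              veronese_regular[OF P[OF X(1)]] g[unfolded X(3,4)]]
            unveronese_regular[OF P[OF X(2)]]])
      also have "compose X (restrict unveronese (veronese ` Y)) (compose X g (restrict veronese X)) =
          on_hom G V W g"
        using gVW X by (auto simp: G_def compose_def fun_eq_iff)
      finally show "on_hom G V W g \<in> Hom ?C (on_obj G V) (on_obj G W)"
        using X by (simp add: variety_category_def RC G_obj)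
    next
      fix U V W f g assume UVW: "U \<in> Obj ?D" "V \<in> Obj ?D" "W \<in> Obj ?D" "f \<in> Hom ?D U V" "g \<in> Hom ?D V W"
      then obtain X Y Z where X: "X \<in> Xs" "Y \<in> Xs" "Z \<in> Xs" "U = veronese ` X" "V = veronese ` Y"
        "W = veronese ` Z" by (auto simp: variety_category_def)
      have "f \<in> regular_maps U V" "g \<in> regular_maps V W"
        using UVW(4,5) X by (simp_all add: variety_category_def RD)
      then have fg: "f \<in> U \<rightarrow> V" "g \<in> V \<rightarrow> W" by (simp_all add: regular_maps_def PiE_def)
      have "veronese (unveronese (f (veronese L))) = f (veronese L)"
        "unveronese (f (veronese L)) \<in> Y" if "L \<in> X" for L
        using X fg that by (auto dest!: funcset_mem[of f _ _ "veronese L"])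
      then show "on_hom G U W (Comp ?D U V W g f) =
        Comp ?C (on_obj G U) (on_obj G V) (on_obj G W) (on_hom G V W g) (on_hom G U V f)"
        using X by (auto simp: G_def variety_category_def compose_def fun_eq_iff)
    qed (auto simp: G_def variety_category_def fun_eq_iff)
    fix X assume "X \<in> Obj ?C"
    then show "on_obj G (on_obj F X) = X" by (simp add: F_def G_def variety_category_def)
  next
    fix X Y f assume "X \<in> Obj ?C" "Y \<in> Obj ?C" "f \<in> Hom ?C X Y"
    then have X: "X \<in> Xs" "Y \<in> Xs" and f: "f \<in> X \<rightarrow>\<^sub>E Y" by (auto simp: variety_category_def RC regular_maps_def)
    then show "on_hom G (on_obj F X) (on_obj F Y) (on_hom F X Y f) = f"
      by (auto simp: F_def G_def fun_eq_iff PiE_def extensional_def Pi_iff)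
  next
    fix V assume "V \<in> Obj ?D"
    then show "on_obj F (on_obj G V) = V" by (auto simp: F_def G_def variety_category_def)
  next
    fix V W g assume "V \<in> Obj ?D" "W \<in> Obj ?D" "g \<in> Hom ?D V W"
    then obtain X Y where X: "X \<in> Xs" "Y \<in> Xs" "V = veronese ` X" "W = veronese ` Y"
        and g: "g \<in> regular_maps V W" by (auto simp: variety_category_def RD)
    from g have g: "g \<in> V \<rightarrow>\<^sub>E W" by (rule regular_mapsD)
    show "on_hom F (on_obj G V) (on_obj G W) (on_hom G V W g) = g"
    proof (rule ext)
      fix N
      show "on_hom F (on_obj G V) (on_obj G W) (on_hom G V W g) N = g N"
      proof (cases "N \<in> V")
        case True
        then obtain L where L: "L \<in> X" "N = veronese L" using X(3) by blast
        have "g N \<in> veronese ` Y" using PiE_mem[OF g True] X(4) by simp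
        then obtain M where "M \<in> Y" "g N = veronese M" by blast
        then show ?thesis
          using L by (simp add: F_def G_def X un'[OF X(1)] un'[OF X(2)])
      next
        case False
        then show ?thesis using PiE_arb[OF g False] by (simp add: F_def G_def X)
      qed
    qed
  qed
qed

section \<open>Matching elliptic curves with smooth Grassmannians\<close>

lemma prime_elem_irreducible:
  fixes F :: "'r::idom"
  assumes "prime_elem F"
  shows "irreducible F"
proof (rule irreducibleI)
  show "F \<noteq> 0" "\<not> F dvd 1" using assms by (auto simp: prime_elem_def)
  have unit: "B dvd 1" if AB: "F = A * B" "F dvd A" for A B
  proof -
    obtain C where C: "A = F * C" using AB(2) by blast
    have "F * (C * B) = F * C * B" by (simp only: mult.assoc)
    also have "\<dots> = F * 1" by (simp only: C[symmetric] AB(1)[symmetric] mult_1_right)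
    finally have "C * B = 1" using \<open>F \<noteq> 0\<close> by simp
    then show ?thesis by (metis dvd_triv_right)
  qed
  fix A B assume AB: "F = A * B"
  then have "F dvd A * B" by simp
  then have "F dvd A \<or> F dvd B" using assms by (auto simp: prime_elem_def)
  then show "A dvd 1 \<or> B dvd 1" using unit[of A B] unit[of B A] AB by (auto simp: mult.commute)
qed

lemma (in plane_curve) Gr_V3_eq_veronese_curve:
  assumes "F = cubic c"
  shows "Gr_V3 c = veronese ` curve"
proof -
  have "{L \<in> projective_space. \<forall>x\<in>L. mpoly_eval F x = 0} = curve"
    by (auto simp: mem_curve_iff)
  then show ?thesis by (simp add: Gr_V3_veronese flip: assms)
qed

text \<open>Every cubic form is \<open>cubic c\<close> for some \<open>c\<close>, irreducible and
  prime mean the same for it, the Grassmannian is the Veronese image of its curve, and smoothness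
  passes both ways. So the objects correspond exactly, not only up to isomorphism.\<close>

lemma smooth_Grassmannians_eq:
  "{Gr_V3 c | c. irreducible (cubic c) \<and> smooth (Gr_V3 c)} = (`) veronese `
    {X :: ('a::{alg_closed_field, factorial_ring_gcd, semiring_gcd_mult_normalize} ^ 3) set set.
      elliptic_curve X}"
proof (intro equalityI subsetI)
  fix V :: "('a ^ 3 mexp) set set"
  assume "V \<in> {Gr_V3 c | c. irreducible (cubic c) \<and> smooth (Gr_V3 c)}"
  then obtain c where c: "V = Gr_V3 c" "irreducible (cubic c)" "smooth (Gr_V3 c)" by blast
  interpret plane_curve "cubic c" 3
    by unfold_locales (use c in \<open>auto intro: mpoly3_irreducible_imp_prime homogeneous_cubic\<close>)
  have V: "V = veronese ` curve" using Gr_V3_eq_veronese_curve c(1) by simp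
  then have "smooth curve" using smooth_veronese_curve c by simp
  then have "elliptic_curve curve"
    unfolding elliptic_curve_iff using plane_curve_axioms by blast
  then show "V \<in> (`) veronese ` {X. elliptic_curve X}" using V by blast
next
  fix V :: "('a ^ 3 mexp) set set"
  assume "V \<in> (`) veronese ` {X. elliptic_curve X}"
  then obtain F where F: "plane_curve F 3" "V = veronese ` plane_curve.curve F"
    "smooth (plane_curve.curve F)" by (auto simp: elliptic_curve_iff)
  interpret plane_curve F 3 by fact
  obtain c where c: "F = cubic c" by (rule homogeneous_3_cubic[OF hom])
  have "V = Gr_V3 c" using Gr_V3_eq_veronese_curve[OF c] F(2) by simp
  moreover have "smooth V" using F smooth_veronese_curve by simp
  ultimately show "V \<in> {Gr_V3 c | c. irreducible (cubic c) \<and> smooth (Gr_V3 c)}"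
    using prime_elem_irreducible[OF prime] c by blast
qed

theorem corollary3p3:
  assumes "perfect_field TYPE('k::field)"
  shows "equivalent_categories
    (elliptic_curve_category ::
      (('k alg_closure ^ 3) set set, ('k alg_closure ^ 3) set \<Rightarrow> ('k alg_closure ^ 3) set) category)
    (smooth_Grassmannian_category ::
      (('k alg_closure ^ 3 mexp) set set,
       ('k alg_closure ^ 3 mexp) set \<Rightarrow> ('k alg_closure ^ 3 mexp) set) category)"
  unfolding elliptic_curve_category_def smooth_Grassmannian_category_def smooth_Grassmannians_eq
proof (rule equivalent_categories_veronese)
  fix X :: "('k alg_closure ^ 3) set set"
  assume "X \<in> {X. elliptic_curve X}"
  then obtain F where "plane_curve F 3" and X: "X = plane_curve.curve F"
    by (auto simp: elliptic_curve_iff)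
  then interpret plane_curve F 3 by simp
  obtain L M where "L \<in> curve" "M \<in> curve" by (rule two_points)
  then show "X \<subseteq> projective_space \<and> X \<noteq> {} \<and> homogeneous_prime_ideal (vanishing_ideal X)"
    using curve_subset homogeneous_prime_ideal_curve X by auto
qed

end
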